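(* Consider the interconnected system described in the context, with a partition $\{1,\dots,n\}=I_\Sigma\cup I_{\max}$, and assume each subsystem $i$ has an ISS Lyapunov function $V_i$ (in the mixed sense defined in the context) with gains $\gamma_{ij}\in\mathcal{K}_\infty\cup\{0\}$, $\gamma_i\in\mathcal{K}$. Let $\Gamma$ be the gain operator built from $(\gamma_{ij})$. If $\Gamma$ is irreducible and there exists $\alpha\in\mathcal{K}_\infty$ such that $\Gamma\circ D_\alpha(s)\not\ge s$ for all $s\in\mathbb{R}^n_+\setminus\{0\}$, then the whole system $\dot x=f(x,u)$ is ISS and, for an arbitrary $\Omega$-path $\sigma\in\mathcal{K}_\infty^n$ with respect to $D_\alpha\circ\Gamma$, the function $V(x)=\max_{i=1,\dots,n}\sigma_i^{-1}(V_i(x_i))$ is an ISS Lyapunov function for the whole system.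
   Context: The interconnection is $\dot x_i=f_i(x_1,\dots,x_n,u_i)$, $i=1,\dots,n$, $x_i\in\mathbb{R}^{N_i}$, $u_i\in\mathbb{R}^{m_i}$, each $f_i$ continuous and, for every $r$, locally Lipschitz in $x=(x_1^T,\dots,x_n^T)^T$ uniformly in $|u_i|\le r$; written as $\dot x=f(x,u)$. $\mathcal{K}$: continuous strictly increasing functions $\mathbb{R}_+\to\mathbb{R}_+$ vanishing at $0$; $\mathcal{K}_\infty$: unbounded ones. A continuous $\rho:\mathbb{R}_+\to\mathbb{R}_+$ is positive definite if $\rho(r)=0\iff r=0$. $V:\mathbb{R}^N\to\mathbb{R}_+$ is proper and positive definite if $\psi_1(\|x\|)\le V(x)\le\psi_2(\|x\|)$ for some $\psi_1,\psi_2\in\mathcal{K}_\infty$. An ISS Lyapunov function for $\dot x=f(x,u)$ is a continuous $V$, proper, positive definite, locally Lipschitz on $\mathbb{R}^N\setminus\{0\}$, such that for some $\gamma\in\mathcal{K}$ and positive definite $\alpha$, at all points of differentiability, $V(x)\ge\gamma(\|u\|)\Rightarrow\nabla V(x)f(x,u)\le-\alpha(\|x\|)$. $V_i:\mathbb{R}^{N_i}\to\mathbb{R}_+$ is an ISS Lyapunov function for subsystem $i$ if it is continuous, proper, positive definite, locally Lipschitz on $\mathbb{R}^{N_i}\setminus\{0\}$, and there are $\gamma_{ij}\in\mathcal{K}_\infty\cup\{0\}$ ($\gamma_{ii}\equiv0$), $\gamma_i\in\mathcal{K}$ and positive definite $\alpha_i$ such that at all points of differentiability of $V_i$: for $i\in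 I_\Sigma$, $V_i(x_i)\ge\sum_j\gamma_{ij}(V_j(x_j))+\gamma_i(\|u\|)\Rightarrow\nabla V_i(x_i)f_i(x,u)\le-\alpha_i(\|x_i\|)$; for $i\in I_{\max}$, $V_i(x_i)\ge\max\{\max_j\gamma_{ij}(V_j(x_j)),\gamma_i(\|u\|)\}\Rightarrow\nabla V_i(x_i)f_i(x,u)\le-\alpha_i(\|x_i\|)$. $\Gamma(s)=(\Gamma_i(s))_i$ with $\Gamma_i(s)=\sum_j\gamma_{ij}(s_j)$ ($i\in I_\Sigma$), $\Gamma_i(s)=\max_j\gamma_{ij}(s_j)$ ($i\in I_{\max}$); $D_\alpha(s)=(D_i(s_i))_i$ with $D_i=\mathrm{id}+\alpha$ for $i\in I_\Sigma$, $D_i=\mathrm{id}$ for $i\in I_{\max}$. For $x,y\in\mathbb{R}^n$: $x<y$ iff $x_i<y_i$ for all $i$; $x\not\ge y$ iff $x_i<y_i$ for some $i$. $\Gamma$ is irreducible if the directed graph on $\{1,\dots,n\}$ with an edge $(i,j)$ whenever $\gamma_{ij}\ne0$ is strongly connected. A continuous $\sigma=(\sigma_1,\dots,\sigma_n)$ with $\sigma_i\in\mathcal{K}_\infty$ is an $\Omega$-path with respect to a map $M:\mathbb{R}^n_+\to\mathbb{R}^n_+$ if (i) each $\sigma_i^{-1}$ is locally Lipschitz on $(0,\infty)$; (ii) for every compact $P\subset(0,\infty)$ there are constants $0<c\le C$ with $c\le(\sigma_i^{-1})'(r)\le C$ for all $r\in P$ at which $\sigma_i^{-1}$ is differentiable,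 $i=1,\dots,n$; (iii) $M(\sigma(r))<\sigma(r)$ for all $r>0$. *)

theory Defs
  imports "HOL-Analysis.Analysis"
begin

section \<open>Comparison functions\<close>

text \<open>Functions R+ -> R+ are modelled as real => real; only values on {0..} matter.\<close>

definition classK :: "(real \<Rightarrow> real) \<Rightarrow> bool" where
  "classK g \<longleftrightarrow> continuous_on {0..} g \<and> strict_mono_on {0..} g \<and> g 0 = 0"

definition classKinf :: "(real \<Rightarrow> real) \<Rightarrow> bool" where
  "classKinf g \<longleftrightarrow> classK g \<and> filterlim g at_top at_top"

definition zero_gain :: "(real \<Rightarrow> real) \<Rightarrow> bool" where
  "zero_gain g \<longleftrightarrow> (\<forall>s\<ge>0. g s = 0)"

definition posdef :: "(real \<Rightarrow> real) \<Rightarrow> bool" where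
  "posdef \<rho> \<longleftrightarrow> continuous_on {0..} \<rho> \<and> (\<forall>r\<ge>0. \<rho> r \<ge> 0 \<and> (\<rho> r = 0 \<longleftrightarrow> r = 0))"

definition classKL :: "(real \<Rightarrow> real \<Rightarrow> real) \<Rightarrow> bool" where
  "classKL \<beta> \<longleftrightarrow> continuous_on ({0..} \<times> {0..}) (case_prod \<beta>) \<and>
     (\<forall>t\<ge>0. classK (\<lambda>r. \<beta> r t)) \<and>
     (\<forall>r\<ge>0. (\<forall>t1 t2. 0 \<le> t1 \<longrightarrow> t1 \<le> t2 \<longrightarrow> \<beta> r t2 \<le> \<beta> r t1) \<and>
             ((\<lambda>t. \<beta> r t) \<longlongrightarrow> 0) at_top)"

text \<open>Inverse of a K-infinity function on R+.\<close>
definition Kinv :: "(real \<Rightarrow> real) \<Rightarrow> real \<Rightarrow> real" where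
  "Kinv g = inv_into {0..} g"

text \<open>Local Lipschitz continuity on a set S (w.r.t. the relative topology).\<close>
definition locLip :: "'a::metric_space set \<Rightarrow> ('a \<Rightarrow> 'b::metric_space) \<Rightarrow> bool" where
  "locLip S V \<longleftrightarrow> (\<forall>\<xi>\<in>S. \<exists>\<delta>>0. \<exists>L. \<forall>a\<in>S \<inter> ball \<xi> \<delta>. \<forall>b\<in>S \<inter> ball \<xi> \<delta>.
       dist (V a) (V b) \<le> L * dist a b)"

section \<open>Block structure of the state / input spaces\<close>

text \<open>The global state x in R^N is real^'d; coordinate k belongs to subsystem blk k.
  The component x_i in R^{N_i} is identified with the vector bproj blk i x in the
  coordinate subspace bspace blk i (Euclidean norms agree).\<close>

definition bproj :: "('d::finite \<Rightarrow> nat) \<Rightarrow> nat \<Rightarrow> real^'d \<Rightarrow> real^'d" where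
  "bproj blk i x = (\<chi> k. if blk k = i then x $ k else 0)"

definition bspace :: "('d::finite \<Rightarrow> nat) \<Rightarrow> nat \<Rightarrow> (real^'d) set" where
  "bspace blk i = {x. \<forall>k. blk k \<noteq> i \<longrightarrow> x $ k = 0}"

section \<open>Gain operator, D_alpha, irreducibility, Omega-paths\<close>

definition gain_op :: "nat \<Rightarrow> nat set \<Rightarrow> (nat \<Rightarrow> nat \<Rightarrow> real \<Rightarrow> real) \<Rightarrow> (nat \<Rightarrow> real) \<Rightarrow> nat \<Rightarrow> real" where
  "gain_op n Isum \<gamma> s i =
     (if i \<in> Isum then (\<Sum>j<n. \<gamma> i j (s j)) else Max ((\<lambda>j. \<gamma> i j (s j)) ` {..<n}))"

definition Dalpha :: "nat set \<Rightarrow> (real \<Rightarrow> real) \<Rightarrow> (nat \<Rightarrow> real) \<Rightarrow> nat \<Rightarrow> real" where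
  "Dalpha Isum \<alpha> s i = (if i \<in> Isum then s i + \<alpha> (s i) else s i)"

definition gain_irreducible :: "nat \<Rightarrow> (nat \<Rightarrow> nat \<Rightarrow> real \<Rightarrow> real) \<Rightarrow> bool" where
  "gain_irreducible n \<gamma> \<longleftrightarrow>
     (\<forall>i<n. \<forall>j<n. (i, j) \<in> {(i, j). i < n \<and> j < n \<and> \<not> zero_gain (\<gamma> i j)}\<^sup>*)"

definition Omega_path :: "nat \<Rightarrow> ((nat \<Rightarrow> real) \<Rightarrow> nat \<Rightarrow> real) \<Rightarrow> (nat \<Rightarrow> real \<Rightarrow> real) \<Rightarrow> bool" where
  "Omega_path n M \<sigma> \<longleftrightarrow>
     (\<forall>i<n. classKinf (\<sigma> i)) \<and>
     (\<forall>i<n. locLip {0<..} (Kinv (\<sigma> i))) \<and>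
     (\<forall>P. compact P \<and> P \<subseteq> {0<..} \<longrightarrow>
        (\<exists>c C. 0 < c \<and> c \<le> C \<and>
           (\<forall>i<n. \<forall>r\<in>P. \<forall>d. (Kinv (\<sigma> i) has_real_derivative d) (at r) \<longrightarrow> c \<le> d \<and> d \<le> C))) \<and>
     (\<forall>r>0. \<forall>i<n. M (\<lambda>j. \<sigma> j r) i < \<sigma> i r)"

section \<open>The interconnection and ISS notions\<close>

text \<open>Regularity: continuity, and each f_i locally Lipschitz in x uniformly in |u_i| <= r.\<close>
definition sys_regular :: "nat \<Rightarrow> ('d::finite \<Rightarrow> nat) \<Rightarrow> ('m::finite \<Rightarrow> nat) \<Rightarrow>
    (real^'d \<Rightarrow> real^'m \<Rightarrow> real^'d) \<Rightarrow> bool" where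
  "sys_regular n blk blkU F \<longleftrightarrow> continuous_on UNIV (case_prod F) \<and>
     (\<forall>i<n. \<forall>x u. bproj blk i (F x u) = bproj blk i (F x (bproj blkU i u))) \<and>
     (\<forall>i<n. \<forall>r. \<forall>x0. \<exists>\<delta>>0. \<exists>L. \<forall>x\<in>ball x0 \<delta>. \<forall>y\<in>ball x0 \<delta>. \<forall>u.
        norm (bproj blkU i u) \<le> r \<longrightarrow>
        norm (bproj blk i (F x u) - bproj blk i (F y u)) \<le> L * norm (x - y))"

definition sub_ISS_Lyap :: "nat \<Rightarrow> ('d::finite \<Rightarrow> nat) \<Rightarrow> nat set \<Rightarrow>
    (real^'d \<Rightarrow> real^'m::finite \<Rightarrow> real^'d) \<Rightarrow> (nat \<Rightarrow> real^'d \<Rightarrow> real) \<Rightarrow>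
    (nat \<Rightarrow> nat \<Rightarrow> real \<Rightarrow> real) \<Rightarrow> (nat \<Rightarrow> real \<Rightarrow> real) \<Rightarrow> (nat \<Rightarrow> real \<Rightarrow> real) \<Rightarrow> nat \<Rightarrow> bool" where
  "sub_ISS_Lyap n blk Isum F V \<gamma> gi \<alpha>i i \<longleftrightarrow>
     continuous_on (bspace blk i) (V i) \<and>
     (\<exists>\<psi>1 \<psi>2. classKinf \<psi>1 \<and> classKinf \<psi>2 \<and>
        (\<forall>\<xi>\<in>bspace blk i. \<psi>1 (norm \<xi>) \<le> V i \<xi> \<and> V i \<xi> \<le> \<psi>2 (norm \<xi>))) \<and>
     locLip (bspace blk i - {0}) (V i) \<and>
     classK (gi i) \<and> posdef (\<alpha>i i) \<and>
     (\<forall>x u D. (V i has_derivative D) (at (bproj blk i x) within bspace blk i) \<longrightarrow>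
        V i (bproj blk i x) \<ge>
          (if i \<in> Isum then (\<Sum>j<n. \<gamma> i j (V j (bproj blk j x))) + gi i (norm u)
           else max (Max ((\<lambda>j. \<gamma> i j (V j (bproj blk j x))) ` {..<n})) (gi i (norm u))) \<longrightarrow>
        D (bproj blk i (F x u)) \<le> - \<alpha>i i (norm (bproj blk i x)))"

definition ISS_Lyap :: "(real^'d::finite \<Rightarrow> real^'m::finite \<Rightarrow> real^'d) \<Rightarrow> (real^'d \<Rightarrow> real) \<Rightarrow> bool" where
  "ISS_Lyap F V \<longleftrightarrow> continuous_on UNIV V \<and>
     (\<exists>\<psi>1 \<psi>2. classKinf \<psi>1 \<and> classKinf \<psi>2 \<and> (\<forall>x. \<psi>1 (norm x) \<le> V x \<and> V x \<le> \<psi>2 (norm x))) \<and>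
     locLip (UNIV - {0}) V \<and>
     (\<exists>\<gamma> \<alpha>. classK \<gamma> \<and> posdef \<alpha> \<and>
        (\<forall>x u D. (V has_derivative D) (at x) \<longrightarrow> V x \<ge> \<gamma> (norm u) \<longrightarrow> D (F x u) \<le> - \<alpha> (norm x)))"

text \<open>Inputs: measurable, essentially bounded on [0,inf); L-infinity norm = ess sup.\<close>
definition admissible_input :: "(real \<Rightarrow> 'm::euclidean_space) \<Rightarrow> bool" where
  "admissible_input u \<longleftrightarrow> u \<in> borel_measurable lborel \<and>
     (\<exists>c. AE t in lborel. 0 \<le> t \<longrightarrow> norm (u t) \<le> c)"

definition linf :: "(real \<Rightarrow> 'm::euclidean_space) \<Rightarrow> real" where
  "linf u = Inf {c. 0 \<le> c \<and> (AE t in lborel. 0 \<le> t \<longrightarrow> norm (u t) \<le> c)}"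

text \<open>Caratheodory solution on [0,T].\<close>
definition is_solution :: "('x::euclidean_space \<Rightarrow> 'm \<Rightarrow> 'x) \<Rightarrow> (real \<Rightarrow> 'm) \<Rightarrow> (real \<Rightarrow> 'x) \<Rightarrow> real \<Rightarrow> bool" where
  "is_solution F u x T \<longleftrightarrow> continuous_on {0..T} x \<and>
     (\<forall>t\<in>{0..T}. ((\<lambda>s. F (x s) (u s)) has_integral (x t - x 0)) {0..t})"

definition ISS :: "('x::euclidean_space \<Rightarrow> 'm::euclidean_space \<Rightarrow> 'x) \<Rightarrow> bool" where
  "ISS F \<longleftrightarrow>
     (\<exists>\<beta> \<gamma>. classKL \<beta> \<and> classK \<gamma> \<and>
        (\<forall>u x T. admissible_input u \<longrightarrow> 0 \<le> T \<longrightarrow> is_solution F u x T \<longrightarrow>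
           (\<forall>t\<in>{0..T}. norm (x t) \<le> \<beta> (norm (x 0)) t + \<gamma> (linf u)))) \<and>
     (\<forall>x0 u. admissible_input u \<longrightarrow> (\<exists>x. x 0 = x0 \<and> (\<forall>T\<ge>0. is_solution F u x T)))"

end

theory Submission
  imports Defs
begin

text \<open>
  Let \<open>M = D\<^sub>\<alpha> \<circ> \<Gamma>\<close>. Along a path \<open>\<sigma>\<close> with \<open>M (\<sigma> r) < \<sigma> r\<close>, every subsystem \<open>i\<close> that attains the
  maximum in \<open>V x = max\<^sub>i \<sigma>\<^sub>i\<^sup>-\<^sup>1 (V\<^sub>i x\<^sub>i)\<close> satisfies its own decrease condition with room to spare for
  the input. The decrease of \<open>V\<^sub>i\<close> is known only where \<open>V\<^sub>i\<close> is differentiable; by Rademacher's theorem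
  and Fubini it integrates to a bound on the upper Dini derivative of \<open>V\<^sub>i\<close> at every point, which
  passes to the maximum even where \<open>V\<close> is differentiable but no active \<open>V\<^sub>i\<close> is.

  Stability needs one such path. Brouwer's theorem gives points \<open>s\<close> of any prescribed size with
  \<open>M s \<le> s\<close>; iterating \<open>(id + M) / 2\<close> from them gives decreasing orbits starting arbitrarily high, and a
  compactness argument yields an orbit without a first element. Applying \<open>(id + M) / 2\<close> to it \<open>n\<close> times
  makes the inequality strict, irreducibility makes all components positive and unbounded, and piecewise
  linear interpolation in \<open>ln r\<close> turns the two-sided sequence into a path. The resulting \<open>V\<close> decreases along
  solutions at a rate \<open>\<kappa> V\<close>; rescaling \<open>V\<close> makes the decay exponential, which gives the KL estimate. The
  estimate in turn bounds solutions a priori, so that Picard iteration for a truncated vector field produces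
  global solutions.
\<close>

section \<open>Lipschitz functions of a real variable\<close>

definition slope_ge :: "real \<Rightarrow> real set \<Rightarrow> (real \<Rightarrow> real) \<Rightarrow> bool" where
  "slope_ge c S f \<longleftrightarrow> (\<forall>x\<in>S. \<forall>y\<in>S. x \<le> y \<longrightarrow> c * (y - x) \<le> f y - f x)"

definition slope_le :: "real \<Rightarrow> real set \<Rightarrow> (real \<Rightarrow> real) \<Rightarrow> bool" where
  "slope_le C S f \<longleftrightarrow> (\<forall>x\<in>S. \<forall>y\<in>S. x \<le> y \<longrightarrow> f y - f x \<le> C * (y - x))"

lemma slope_geD: "slope_ge c S f \<Longrightarrow> x \<in> S \<Longrightarrow> y \<in> S \<Longrightarrow> x \<le> y \<Longrightarrow> c * (y - x) \<le> f y - f x"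
  unfolding slope_ge_def by blast

lemma slope_leD: "slope_le C S f \<Longrightarrow> x \<in> S \<Longrightarrow> y \<in> S \<Longrightarrow> x \<le> y \<Longrightarrow> f y - f x \<le> C * (y - x)"
  unfolding slope_le_def by blast

lemma negligible_AE_lborel: "negligible N \<Longrightarrow> AE x in lborel. x \<notin> N"
  by (metis AE_completion_iff AE_not_in negligible_iff_null_sets)

lemma box_average_tendsto_AE:
  fixes f :: "'a::euclidean_space \<Rightarrow> 'b::euclidean_space"
  assumes "\<And>a b. f integrable_on cbox a b"
  shows "AE x in lborel. ((\<lambda>h. integral (cbox x (x + h *\<^sub>R One)) f /\<^sub>R h ^ DIM('a)) \<longlongrightarrow> f x) (at_right 0)"
proof -
  obtain N where N: "negligible N" "\<And>x e. x \<notin> N \<Longrightarrow> 0 < e \<Longrightarrow> \<exists>d>0. \<forall>h. 0 < h \<and> h < d \<longrightarrow>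
      norm (integral (cbox x (x + h *\<^sub>R One)) f /\<^sub>R h ^ DIM('a) - f x) < e"
    using integrable_ccontinuous_explicit[OF assms] by metis
  show ?thesis
    using negligible_AE_lborel[OF N(1)]
  proof eventually_elim
    case (elim x)
    show ?case
      unfolding tendsto_iff dist_norm eventually_at_right_field
      using N(2)[OF elim] by (simp add: imp_conjL)
  qed
qed

lemma integral_average_tendsto_AE:
  fixes f :: "real \<Rightarrow> 'b::euclidean_space"
  assumes "\<And>a b. f integrable_on {a..b}"
  shows "AE x in lborel. ((\<lambda>h. integral {x..x + h} f /\<^sub>R h) \<longlongrightarrow> f x) (at_right 0)"
  using box_average_tendsto_AE[of f] assms by simp

lemma absolutely_continuous_density_has_integral:
  fixes N :: "real measure"
  assumes "absolutely_continuous lborel N" "sets N = sets lborel" "mono F"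
    and N: "\<And>a b. a \<le> b \<Longrightarrow> emeasure N {a<..b} = ennreal (F b - F a)"
  obtains h where "\<And>a b. a \<le> b \<Longrightarrow> (h has_integral (F b - F a)) {a..b}"
proof -
  obtain k where [measurable]: "k \<in> borel_measurable lborel" and k: "density lborel k = N"
    using sigma_finite_measure.Radon_Nikodym[OF sigma_finite_lborel assms(1,2)] by auto
  have nn_k: "(\<integral>\<^sup>+x. k x * indicator {a<..b} x \<partial>lborel) = ennreal (F b - F a)" if "a \<le> b" for a b
    unfolding N[OF that, symmetric] k[symmetric] by (subst emeasure_density) auto
  have "AE x in lborel. \<forall>n::nat. k x * indicator {- real n<..real n} x \<noteq> \<infinity>"
    unfolding AE_all_countable by (intro allI nn_integral_PInf_AE) (auto simp: nn_k)
  then have finite: "AE x in lborel. k x \<noteq> \<infinity>"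
  proof eventually_elim
    case (elim x)
    obtain n :: nat where "\<bar>x\<bar> < n" using reals_Archimedean2 by blast
    then have "indicator {- real n<..real n} x = (1::ennreal)" by (auto simp: indicator_def)
    then show ?case using elim[rule_format, of n] by simp
  qed
  define h where "h = (\<lambda>x. enn2real (k x))"
  have "(h has_integral (F b - F a)) {a..b}" if ab: "a \<le> b" for a b
  proof -
    have "(\<integral>\<^sup>+x. ennreal (h x * indicator {a<..b} x) \<partial>lborel) = ennreal (F b - F a)"
      unfolding nn_k[OF ab, symmetric]
      by (rule nn_integral_cong_AE, rule AE_mp[OF finite])
         (auto simp: h_def indicator_def ennreal_enn2real_if top.not_eq_extremum)
    then have "((\<lambda>x. h x * indicator {a<..b} x) has_integral (F b - F a)) UNIV"
      using monoD[OF \<open>mono F\<close> ab] by (intro nn_integral_has_integral) (auto simp: h_def)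
    then have "((\<lambda>x. if x \<in> {a<..b} then h x else 0) has_integral (F b - F a)) UNIV"
      by (rule has_integral_eq[rotated]) auto
    then have "(h has_integral (F b - F a)) {a<..b}" by (simp only: has_integral_restrict_UNIV)
    moreover have "negligible {x \<in> {a<..b} - {a..b}. h x \<noteq> 0}" "negligible {x \<in> {a..b} - {a<..b}. h x \<noteq> 0}"
      by (auto intro: negligible_subset[of "{a}"])
    ultimately show ?thesis using has_integral_spike_set_eq by blast
  qed
  then show ?thesis using that by blast
qed

lemma slope_ge_1_bij:
  assumes cont: "continuous_on UNIV f" and slope: "slope_ge 1 UNIV f"
  shows "bij f"
proof (rule bijI)
  have expand: "y - x \<le> f y - f x" if "x \<le> y" for x y
    using slope_geD[OF slope, of x y] that by simp
  show "inj f"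
  proof (rule injI)
    fix x y assume "f x = f y"
    then show "x = y" using expand[of x y] expand[of y x] by linarith
  qed
  have "\<exists>x. f x = y" for y
  proof -
    have "f (- \<bar>y - f 0\<bar>) \<le> y" "y \<le> f \<bar>y - f 0\<bar>"
      using expand[of "- \<bar>y - f 0\<bar>" 0] expand[of 0 "\<bar>y - f 0\<bar>"] by auto
    then show ?thesis
      using IVT'[of f "- \<bar>y - f 0\<bar>" y "\<bar>y - f 0\<bar>"] continuous_on_subset[OF cont] by auto
  qed
  then show "surj f" by (metis surjI)
qed

lemma slope_ge_1_lipschitz_inv:
  assumes "bij f" and slope: "slope_ge 1 UNIV f"
  shows "1-lipschitz_on UNIV (inv f)"
proof (rule lipschitz_onI)
  fix x y
  have "f (inv f z) = z" for z using \<open>bij f\<close> by (simp add: bij_is_surj surj_f_inv_f)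
  then show "dist (inv f x) (inv f y) \<le> 1 * dist x y"
    using slope_geD[OF slope, of "inv f x" "inv f y"] slope_geD[OF slope, of "inv f y" "inv f x"]
    by (cases "inv f x \<le> inv f y") (auto simp: dist_real_def)
qed simp

lemma slope_ge_1_image_Ioc:
  assumes "bij f" and slope: "slope_ge 1 UNIV f"
  shows "f ` {a<..b} = {f a<..f b}"
proof -
  have mono: "f x \<le> f y \<longleftrightarrow> x \<le> y" for x y
    using slope_geD[OF slope, of x y] slope_geD[OF slope, of y x] by (cases x y rule: linorder_cases) auto
  have "y \<in> f ` {a<..b}" if "f a < y" "y \<le> f b" for y
  proof -
    obtain x where "y = f x" using \<open>bij f\<close> by (meson bij_pointE)
    then show ?thesis using that mono[of x a] mono[of x b] by (auto simp: not_le[symmetric])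
  qed
  then show ?thesis by (auto simp: mono not_le[symmetric])
qed

lemma absolutely_continuous_distr_inv:
  fixes f :: "real \<Rightarrow> real"
  assumes lip: "L-lipschitz_on UNIV f" and "bij f" and [measurable]: "inv f \<in> borel_measurable borel"
  shows "absolutely_continuous lborel (distr lborel borel (inv f))"
    and "A \<in> sets borel \<Longrightarrow> emeasure (distr lborel borel (inv f)) A = emeasure lborel (f ` A)"
proof -
  have vimage: "inv f -` A = f ` A" for A
    using bij_vimage_eq_inv_image[OF bij_imp_bij_inv[OF \<open>bij f\<close>]] by (simp add: inv_inv_eq \<open>bij f\<close>)
  then show distr: "emeasure (distr lborel borel (inv f)) A = emeasure lborel (f ` A)" if "A \<in> sets borel" for A
    using that by (subst emeasure_distr) auto
  show "absolutely_continuous lborel (distr lborel borel (inv f))"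
    unfolding absolutely_continuous_def
  proof
    fix A :: "real set" assume A: "A \<in> null_sets lborel"
    then have "negligible A" by (simp add: negligible_iff_null_sets null_sets_completionI)
    then have "negligible (f ` A)"
      by (rule negligible_locally_Lipschitz_image[rotated])
         (use lip in \<open>auto simp: lipschitz_on_def dist_norm intro!: exI[of _ UNIV] exI[of _ L]\<close>)
    moreover have "f ` A \<in> sets borel"
      using A measurable_sets[of "inv f" borel borel A] by (simp add: vimage null_sets_def)
    ultimately have "emeasure lborel (f ` A) = 0"
      by (simp add: negligible_iff_null_sets null_sets_completion_iff null_sets_def)
    then show "A \<in> null_sets (distr lborel borel (inv f))"
      using A distr[of A] by (auto simp: null_sets_def)
  qed
qed

text \<open>A Lipschitz function maps null sets to null sets, so the push-forward of Lebesgue measure under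
  \<open>f\<^sup>-\<^sup>1\<close>, which has the mass \<open>f b - f a\<close> on \<open>{a<..b}\<close>, has a density.\<close>

lemma lipschitz_integral_representation_expanding:
  fixes f :: "real \<Rightarrow> real"
  assumes lip: "L-lipschitz_on UNIV f" and slope: "slope_ge 1 UNIV f"
  obtains h where "\<And>a b. a \<le> b \<Longrightarrow> (h has_integral (f b - f a)) {a..b}"
proof (rule absolutely_continuous_density_has_integral)
  have bij: "bij f" by (rule slope_ge_1_bij[OF lipschitz_on_continuous_on[OF lip] slope])
  have "inv f \<in> borel_measurable borel"
    by (intro borel_measurable_continuous_onI lipschitz_on_continuous_on[OF slope_ge_1_lipschitz_inv[OF bij slope]])
  note distr = absolutely_continuous_distr_inv[OF lip bij this]
  show "absolutely_continuous lborel (distr lborel borel (inv f))" by (rule distr(1))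
  show mono: "mono f"
  proof (rule monoI)
    fix x y :: real assume "x \<le> y"
    then show "f x \<le> f y" using slope_geD[OF slope, of x y] by simp
  qed
  show "emeasure (distr lborel borel (inv f)) {a<..b} = ennreal (f b - f a)" if "a \<le> b" for a b
    using monoD[OF mono that] by (simp add: distr(2) slope_ge_1_image_Ioc[OF bij slope])
qed (use that in auto)

lemma lipschitz_integral_representation:
  fixes f :: "real \<Rightarrow> real"
  assumes lip: "L-lipschitz_on UNIV f"
  obtains h where "\<And>a b. a \<le> b \<Longrightarrow> (h has_integral (f b - f a)) {a..b}"
proof -
  have "0 \<le> L" by (rule lipschitz_on_nonneg[OF lip])
  define F where "F = (\<lambda>x. f x + (L + 1) * x)"
  have "(L + \<bar>L + 1\<bar>)-lipschitz_on UNIV F"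
    unfolding F_def using lipschitz_on_cmult_real[OF lipschitz_on_id, of "L + 1"]
    by (intro lipschitz_on_add lip) auto
  moreover have "slope_ge 1 UNIV F"
    unfolding slope_ge_def
  proof (intro ballI impI)
    fix x y :: real assume "x \<le> y"
    then have "f x - f y \<le> L * (y - x)"
      using lipschitz_onD[OF lip, of x y] by (simp add: dist_real_def)
    then show "1 * (y - x) \<le> F y - F x" by (simp add: F_def algebra_simps)
  qed
  ultimately obtain k where k: "\<And>a b. a \<le> b \<Longrightarrow> (k has_integral (F b - F a)) {a..b}"
    using lipschitz_integral_representation_expanding by blast
  have "((\<lambda>x. k x - (L + 1)) has_integral (f b - f a)) {a..b}" if "a \<le> b" for a b
    using has_integral_diff[OF k[OF that] has_integral_const_real[of "L + 1" a b]] that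
    by (simp add: F_def algebra_simps)
  then show ?thesis using that by blast
qed

lemma has_real_derivative_AE_if_has_integral:
  fixes f h :: "real \<Rightarrow> real"
  assumes int: "\<And>a b. a \<le> b \<Longrightarrow> (h has_integral (f b - f a)) {a..b}"
  shows "AE x in lborel. (f has_real_derivative h x) (at x)"
proof -
  have right: "AE x in lborel. ((\<lambda>t. (p (x + t) - p x) / t) \<longlongrightarrow> q x) (at_right 0)"
    if pq: "\<And>a b. a \<le> b \<Longrightarrow> (q has_integral (p b - p a)) {a..b}" for p q :: "real \<Rightarrow> real"
  proof -
    have "q integrable_on {a..b}" for a b using pq[of a b] by (cases "a \<le> b") auto
    from integral_average_tendsto_AE[OF this] show ?thesis
    proof eventually_elim
      case (elim x)
      have "\<forall>\<^sub>F t in at_right 0. integral {x..x + t} q /\<^sub>R t = (p (x + t) - p x) / t"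
        using eventually_at_right_less[of 0]
        by eventually_elim (simp add: integral_unique[OF pq] divide_inverse_commute)
      then show ?case by (rule Lim_transform_eventually[OF elim])
    qed
  qed
  have "((\<lambda>x. h (- x)) has_integral (- f (- b) - - f (- a))) {a..b}" if "a \<le> b" for a b
    using int[of "- b" "- a"] that has_integral_reflect_real[of h "f (- a) - f (- b)" "- a" "- b"] by simp
  then have "AE x in distr lborel borel uminus. ((\<lambda>t. (- f (- (x + t)) - - f (- x)) / t) \<longlongrightarrow> h (- x)) (at_right 0)"
    unfolding lborel_distr_uminus by (rule right)
  then have "AE x in lborel. ((\<lambda>t. (- f (- (- x + t)) - - f (- (- x))) / t) \<longlongrightarrow> h (- (- x))) (at_right 0)"
    by (rule AE_distrD[rotated]) simp
  moreover have "AE x in lborel. ((\<lambda>t. (f (x + t) - f x) / t) \<longlongrightarrow> h x) (at_right 0)"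
    using int by (rule right)
  ultimately show ?thesis
  proof eventually_elim
    case (elim x)
    have "(f (x - t) - f x) / - t = (f x - f (x - t)) / t" for t
      by (simp add: minus_divide_left)
    then have "((\<lambda>t. (f (x + t) - f x) / t) \<longlongrightarrow> h x) (at_left 0)"
      using elim(1) by (simp add: filterlim_at_left_to_right del: divide_minus_right)
    then show ?case using elim(2) by (simp add: DERIV_def filterlim_at_split)
  qed
qed

definition lipschitz_envelope :: "real \<Rightarrow> 'a::metric_space set \<Rightarrow> ('a \<Rightarrow> real) \<Rightarrow> 'a \<Rightarrow> real" where
  "lipschitz_envelope L S m x = (INF s\<in>S. m s + L * dist x s)"

lemma lipschitz_envelope_le:
  assumes "bdd_below ((\<lambda>s. m s + L * dist x s) ` S)" "s \<in> S"
  shows "lipschitz_envelope L S m x \<le> m s + L * dist x s"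
  unfolding lipschitz_envelope_def using assms by (rule cINF_lower)

lemma lipschitz_envelope_greatest:
  assumes "S \<noteq> {}" "\<And>s. s \<in> S \<Longrightarrow> c \<le> m s + L * dist x s"
  shows "c \<le> lipschitz_envelope L S m x"
  unfolding lipschitz_envelope_def using assms by (rule cINF_greatest)

lemma lipschitz_on_lipschitz_envelope:
  assumes bdd: "\<And>x. bdd_below ((\<lambda>s. m s + L * dist x s) ` S)" and "S \<noteq> {}" "0 \<le> L"
  shows "L-lipschitz_on UNIV (lipschitz_envelope L S m)"
proof (rule lipschitz_onI)
  have envelope_diff_le: "lipschitz_envelope L S m x - L * dist x y \<le> lipschitz_envelope L S m y" for x y
  proof (rule lipschitz_envelope_greatest[OF \<open>S \<noteq> {}\<close>])
    fix s assume "s \<in> S"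
    moreover have "L * dist x s \<le> L * (dist x y + dist y s)"
      using \<open>0 \<le> L\<close> by (intro mult_left_mono dist_triangle)
    ultimately show "lipschitz_envelope L S m x - L * dist x y \<le> m s + L * dist y s"
      using lipschitz_envelope_le[OF bdd, of s x] by (simp add: algebra_simps)
  qed
  show "dist (lipschitz_envelope L S m x) (lipschitz_envelope L S m y) \<le> L * dist x y" for x y
    using envelope_diff_le[of x y] envelope_diff_le[of y x] by (simp add: dist_real_def dist_commute abs_le_iff)
qed fact

lemma lipschitz_on_extension:
  fixes f :: "'a::metric_space \<Rightarrow> real"
  assumes lip: "L-lipschitz_on S f"
  obtains g where "L-lipschitz_on UNIV g" "\<And>x. x \<in> S \<Longrightarrow> g x = f x"
proof (cases "S = {}")
  case True
  then show ?thesis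
    using that[of "\<lambda>_. 0"] lipschitz_on_le[OF lipschitz_on_constant lipschitz_on_nonneg[OF lip]] by auto
next
  case False
  then obtain z where z: "z \<in> S" by blast
  have "0 \<le> L" by (rule lipschitz_on_nonneg[OF lip])
  have bound: "f t - L * dist x t \<le> f s + L * dist x s" if "s \<in> S" "t \<in> S" for x s t
  proof -
    have "f t - f s \<le> L * dist t s" using lipschitz_onD[OF lip that(2,1)] by (simp add: dist_real_def)
    also have "\<dots> \<le> L * (dist x t + dist x s)"
      using \<open>0 \<le> L\<close> by (intro mult_left_mono dist_triangle3)
    finally show ?thesis by (simp add: algebra_simps)
  qed
  then have bdd: "bdd_below ((\<lambda>s. f s + L * dist x s) ` S)" for x
    using z by (intro bdd_belowI2) blast
  have "lipschitz_envelope L S f x = f x" if "x \<in> S" for x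
  proof (rule antisym)
    show "lipschitz_envelope L S f x \<le> f x" using lipschitz_envelope_le[OF bdd that, of x] by simp
    show "f x \<le> lipschitz_envelope L S f x"
      using bound[OF _ that, of _ x] by (intro lipschitz_envelope_greatest False) auto
  qed
  then show ?thesis
    using that lipschitz_on_lipschitz_envelope[OF bdd False \<open>0 \<le> L\<close>] by blast
qed

lemma lipschitz_real_increment_le:
  fixes f :: "real \<Rightarrow> real"
  assumes lip: "L-lipschitz_on {a..b} f" and "a \<le> b"
    and deriv: "AE t in lborel. a < t \<longrightarrow> t < b \<longrightarrow> (\<forall>d. (f has_real_derivative d) (at t) \<longrightarrow> d \<le> c)"
  shows "f b - f a \<le> c * (b - a)"
proof -
  obtain F where F: "L-lipschitz_on UNIV F" "\<And>x. x \<in> {a..b} \<Longrightarrow> F x = f x"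
    using lipschitz_on_extension[OF lip] by blast
  obtain h where h: "\<And>a b. a \<le> b \<Longrightarrow> (h has_integral (F b - F a)) {a..b}"
    using lipschitz_integral_representation[OF F(1)] by blast
  have "AE t in lborel. (F has_real_derivative h t) (at t)"
    using h by (rule has_real_derivative_AE_if_has_integral)
  then have "AE t in lborel. t \<in> {a..b} \<longrightarrow> h t = min (h t) c"
    using deriv AE_lborel_singleton[of a] AE_lborel_singleton[of b]
  proof (eventually_elim, intro impI)
    fix t assume F': "(F has_real_derivative h t) (at t)" and t: "t \<noteq> a" "t \<noteq> b" "t \<in> {a..b}"
      and deriv_le: "a < t \<longrightarrow> t < b \<longrightarrow> (\<forall>d. (f has_real_derivative d) (at t) \<longrightarrow> d \<le> c)"
    have "(f has_real_derivative h t) (at t)"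
      using t by (intro has_field_derivative_transform_within_open[OF F', of "{a<..<b}"]) (auto simp: F(2))
    then show "h t = min (h t) c" using deriv_le t by (auto simp: min_def)
  qed
  then have "((\<lambda>t. min (h t) c) has_integral (F b - F a)) {a..b}"
    using h[OF \<open>a \<le> b\<close>] by (simp only: has_integral_AE)
  from has_integral_le[OF this has_integral_const_real] show ?thesis
    using \<open>a \<le> b\<close> F(2) by (simp add: mult.commute)
qed

section \<open>Rademacher's theorem\<close>

lemma AE_lborel_translate:
  fixes c :: "'a::euclidean_space"
  assumes "AE x in lborel. P x"
  shows "AE x in lborel. P (x + c)"
proof -
  have "AE x in distr lborel borel ((+) c). P x"
    unfolding lborel_distr_plus by (rule assms)
  then have "AE x in lborel. P (c + x)" by (rule AE_distrD[rotated]) simp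
  then show ?thesis by (simp add: add.commute)
qed

lemma AE_lborel_ball_ex:
  fixes x :: "'a::euclidean_space"
  assumes "AE y in lborel. P y" "e > 0"
  obtains y where "y \<in> ball x e" "P y"
proof (rule ccontr)
  assume "\<not> thesis"
  then have "\<forall>y. P y \<longrightarrow> y \<notin> ball x e" using that by blast
  then have "AE y in lborel. y \<notin> ball x e" using assms(1) by (auto elim: eventually_mono)
  then have "ball x e \<in> null_sets lborel" by (subst AE_iff_null_sets) auto
  then have "negligible (ball x e)" by (simp add: negligible_iff_null_sets null_sets_completionI)
  then show False using open_not_negligible[of "ball x e"] \<open>e > 0\<close> by auto
qed

lemma AE_lborel_on_lines:
  fixes w :: "'a::euclidean_space"
  assumes "AE y in lborel. P y"
  shows "AE y in lborel. AE t in lborel. P (y + t *\<^sub>R w)"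
proof -
  obtain N where N: "\<And>y. y \<notin> N \<Longrightarrow> P y" "N \<in> null_sets lborel"
    using AE_E3[OF assms] by auto
  then have [measurable]: "N \<in> sets borel" by auto
  have "Measurable.pred (lborel \<Otimes>\<^sub>M lborel) (\<lambda>p :: 'a \<times> real. fst p + snd p *\<^sub>R w \<notin> N)"
    by measurable
  then have meas: "{p :: 'a \<times> real \<in> space (lborel \<Otimes>\<^sub>M lborel). fst p + snd p *\<^sub>R w \<notin> N} \<in> sets (lborel \<Otimes>\<^sub>M lborel)"
    by (rule predE)
  have "AE t in lborel. AE y in lborel. y + t *\<^sub>R w \<notin> N"
    by (intro AE_I2 AE_lborel_translate[OF AE_not_in[OF N(2)]])
  then have "AE y in lborel. AE t in lborel. y + t *\<^sub>R w \<notin> N"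
    using lborel_pair.AE_commute[OF meas] by blast
  then show ?thesis using N(1) by (auto elim!: eventually_mono)
qed

lemma AE_lborel_if_AE_on_lines:
  fixes w :: "'a::euclidean_space"
  assumes [measurable]: "Measurable.pred borel P"
    and lines: "\<And>y. AE t in lborel. P (y + t *\<^sub>R w)"
  shows "AE y in lborel. P y"
proof -
  have "Measurable.pred (lborel \<Otimes>\<^sub>M lborel) (\<lambda>p :: 'a \<times> real. P (fst p + snd p *\<^sub>R w))"
    by measurable
  then have meas: "{p :: 'a \<times> real \<in> space (lborel \<Otimes>\<^sub>M lborel). P (fst p + snd p *\<^sub>R w)} \<in> sets (lborel \<Otimes>\<^sub>M lborel)"
    by (rule predE)
  have "AE y in lborel. AE t in lborel. P (y + t *\<^sub>R w)" using lines by simp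
  then have "AE t in lborel. AE y in lborel. P (y + t *\<^sub>R w)"
    using lborel_pair.AE_commute[OF meas] by blast
  then obtain t where "AE y in lborel. P (y + t *\<^sub>R w)"
    by (rule AE_lborel_ball_ex[OF _ zero_less_one, of _ 0]) blast
  from AE_lborel_translate[OF this, of "- (t *\<^sub>R w)"] show ?thesis by simp
qed

lemma lipschitz_on_along_line:
  fixes g :: "'a::real_normed_vector \<Rightarrow> 'b::metric_space"
  assumes lip: "L-lipschitz_on UNIV g"
  shows "(L * norm w)-lipschitz_on T (\<lambda>t. g (y + t *\<^sub>R w))"
proof (rule lipschitz_onI)
  fix s t
  have "dist (g (y + s *\<^sub>R w)) (g (y + t *\<^sub>R w)) \<le> L * dist (y + s *\<^sub>R w) (y + t *\<^sub>R w)"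
    by (rule lipschitz_onD[OF lip]) auto
  then show "dist (g (y + s *\<^sub>R w)) (g (y + t *\<^sub>R w)) \<le> L * norm w * dist s t"
    by (simp add: dist_norm mult_ac flip: scaleR_diff_left)
qed (use lipschitz_on_nonneg[OF lip] in simp)

definition dquot :: "('a::real_vector \<Rightarrow> real) \<Rightarrow> 'a \<Rightarrow> real \<Rightarrow> 'a \<Rightarrow> real" where
  "dquot g v t x = (g (x + t *\<^sub>R v) - g x) / t"

lemma borel_measurable_dquot [measurable]:
  fixes g :: "'a::euclidean_space \<Rightarrow> real"
  assumes [measurable]: "g \<in> borel_measurable borel"
  shows "dquot g v t \<in> borel_measurable borel"
  unfolding dquot_def by measurable

lemma dquot_add: "dquot g (u + v) t x = dquot g u t x + dquot g v t (x + t *\<^sub>R u)"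
  by (simp add: dquot_def scaleR_add_right add.assoc flip: add_divide_distrib)

lemma dquot_scaleR: "c \<noteq> 0 \<Longrightarrow> dquot g (c *\<^sub>R v) t x = c * dquot g v (c * t) x"
  by (simp add: dquot_def mult.commute)

lemma lipschitz_on_dquot:
  fixes g :: "'a::real_normed_vector \<Rightarrow> real"
  assumes lip: "L-lipschitz_on UNIV g"
  shows "L-lipschitz_on UNIV (\<lambda>v. dquot g v t x)"
proof (rule lipschitz_onI)
  fix v w
  have "\<bar>g (x + t *\<^sub>R v) - g (x + t *\<^sub>R w)\<bar> \<le> L * (\<bar>t\<bar> * norm (v - w))"
    using lipschitz_on_normD[OF lip, of "x + t *\<^sub>R v" "x + t *\<^sub>R w"] by (simp flip: scaleR_diff_right)
  moreover have "dquot g v t x - dquot g w t x = (g (x + t *\<^sub>R v) - g (x + t *\<^sub>R w)) / t"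
    by (simp add: dquot_def diff_divide_distrib)
  ultimately have "\<bar>dquot g v t x - dquot g w t x\<bar> \<le> L * (\<bar>t\<bar> * norm (v - w)) / \<bar>t\<bar>"
    by (simp only: abs_divide divide_right_mono abs_ge_zero)
  also have "\<dots> \<le> L * norm (v - w)"
    using lipschitz_on_nonneg[OF lip] by (cases "t = 0") auto
  finally show "dist (dquot g v t x) (dquot g w t x) \<le> L * dist v w"
    by (simp add: dist_norm)
qed (rule lipschitz_on_nonneg[OF lip])

lemma abs_dquot_le:
  fixes g :: "'a::real_normed_vector \<Rightarrow> real"
  assumes lip: "L-lipschitz_on UNIV g"
  shows "\<bar>dquot g v t x\<bar> \<le> L * norm v"
  using lipschitz_onD[OF lipschitz_on_dquot[OF lip, of t x], of v 0] by (simp add: dquot_def)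

lemma abs_dquot_diff_le:
  fixes g :: "'a::real_normed_vector \<Rightarrow> real"
  assumes lip: "L-lipschitz_on UNIV g" and "0 < t" "t \<le> s"
  shows "\<bar>dquot g v t x - dquot g v s x\<bar> \<le> 2 * (L * norm v) * (s - t) / t"
proof -
  have "t * dquot g v t x = g (x + t *\<^sub>R v) - g x" "s * dquot g v s x = g (x + s *\<^sub>R v) - g x"
    using assms(2,3) by (auto simp: dquot_def)
  then have "t * (dquot g v t x - dquot g v s x) = (g (x + t *\<^sub>R v) - g (x + s *\<^sub>R v)) + (s - t) * dquot g v s x"
    by (simp add: algebra_simps)
  moreover have "\<bar>g (x + t *\<^sub>R v) - g (x + s *\<^sub>R v)\<bar> \<le> L * norm v * (s - t)"
    using lipschitz_on_normD[OF lipschitz_on_along_line[OF lip, of v UNIV x], of t s] assms(3) by simp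
  moreover have "\<bar>(s - t) * dquot g v s x\<bar> \<le> (s - t) * (L * norm v)"
    unfolding abs_mult using abs_dquot_le[OF lip, of v s x] assms(3) by (intro mult_mono) auto
  ultimately have "\<bar>t * (dquot g v t x - dquot g v s x)\<bar> \<le> L * norm v * (s - t) + (s - t) * (L * norm v)"
    by linarith
  then have "t * \<bar>dquot g v t x - dquot g v s x\<bar> \<le> 2 * (L * norm v) * (s - t)"
    using assms(2) by (simp add: abs_mult mult_ac)
  then show ?thesis using assms(2) by (simp add: pos_le_divide_eq mult.commute)
qed

text \<open>For a Lipschitz function the steps \<open>1 / n\<close> determine the limit of the difference quotients:
  \<open>t\<close> and \<open>1 / \<lfloor>1 / t\<rfloor>\<close> differ by a factor that tends to \<open>1\<close>.\<close>

lemma dquot_tendsto_at_right_if_sequentially: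
  fixes g :: "'a::real_normed_vector \<Rightarrow> real"
  assumes lip: "L-lipschitz_on UNIV g"
    and lim: "(\<lambda>n. dquot g v (1 / real n) x) \<longlonglongrightarrow> d"
  shows "((\<lambda>t. dquot g v t x) \<longlongrightarrow> d) (at_right 0)"
proof -
  define m where "m = (\<lambda>t::real. nat \<lfloor>inverse t\<rfloor>)"
  have m: "filterlim m sequentially (at_right 0)"
    unfolding m_def
    by (rule filterlim_compose[OF filterlim_nat_sequentially
          filterlim_compose[OF filterlim_floor_sequentially filterlim_inverse_at_top_right]])
  have "\<forall>\<^sub>F t in at_right 0. \<bar>dquot g v t x - dquot g v (1 / real (m t)) x\<bar> \<le> 4 * (L * norm v) * t"
    using eventually_at_right_real[of 0 1, OF zero_less_one]
  proof eventually_elim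
    case (elim t)
    then have t: "0 < t" "t < 1" by auto
    then have "1 \<le> \<lfloor>inverse t\<rfloor>" using one_le_inverse[of t] by (simp add: le_floor_iff)
    then have mt: "real (m t) \<le> inverse t" "inverse t < real (m t) + 1" "1 \<le> real (m t)"
      unfolding m_def by linarith+
    have t_le: "t \<le> 1 / real (m t)" using mt t by (simp add: field_simps)
    have "inverse t * t \<le> (2 * real (m t)) * t" using mt t by (intro mult_right_mono) auto
    then have half: "1 / real (m t) \<le> 2 * t" using mt(3) t by (simp add: pos_divide_le_eq mult_ac)
    have "(1 / real (m t) - t) / t = (inverse t - real (m t)) / real (m t)"
      using t mt by (simp add: diff_divide_distrib inverse_eq_divide mult.commute)
    also have "\<dots> \<le> 1 / real (m t)" using mt by (intro divide_right_mono) auto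
    also have "\<dots> \<le> 2 * t" by (rule half)
    finally have "2 * (L * norm v) * ((1 / real (m t) - t) / t) \<le> 2 * (L * norm v) * (2 * t)"
      using lipschitz_on_nonneg[OF lip] by (intro mult_left_mono) auto
    then show ?case using abs_dquot_diff_le[OF lip t(1) t_le, of v x] by simp
  qed
  moreover have "((\<lambda>t. 4 * (L * norm v) * t) \<longlongrightarrow> 4 * (L * norm v) * 0) (at_right 0)"
    by (intro tendsto_intros)
  ultimately have "((\<lambda>t. dquot g v t x - dquot g v (1 / real (m t)) x) \<longlongrightarrow> 0) (at_right 0)"
    by (simp add: Lim_null_comparison[of _ "\<lambda>t. 4 * (L * norm v) * t"])
  from tendsto_add[OF this filterlim_compose[OF lim m]] show ?thesis by simp
qed

lemma filterlim_1_over_at_right: "filterlim (\<lambda>n. 1 / real n) (at_right 0) sequentially"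
  using lim_1_over_n by (auto simp: filterlim_at intro: eventually_mono[OF eventually_gt_at_top[of 0]])

definition ddir :: "('a::real_vector \<Rightarrow> real) \<Rightarrow> 'a \<Rightarrow> 'a \<Rightarrow> real" where
  "ddir g v x = lim (\<lambda>n. dquot g v (1 / real n) x)"

lemma borel_measurable_ddir [measurable]:
  fixes g :: "'a::euclidean_space \<Rightarrow> real"
  assumes [measurable]: "g \<in> borel_measurable borel"
  shows "ddir g v \<in> borel_measurable borel"
  unfolding ddir_def by measurable

lemma dquot_tendsto_ddir_AE:
  fixes g :: "'a::euclidean_space \<Rightarrow> real"
  assumes lip: "L-lipschitz_on UNIV g"
  shows "AE x in lborel. ((\<lambda>t. dquot g v t x) \<longlongrightarrow> ddir g v x) (at_right 0)"
proof -
  have [measurable]: "g \<in> borel_measurable borel"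
    by (intro borel_measurable_continuous_onI lipschitz_on_continuous_on[OF lip])
  have "AE x in lborel. convergent (\<lambda>n. dquot g v (1 / real n) x)"
  proof (rule AE_lborel_if_AE_on_lines)
    show "Measurable.pred borel (\<lambda>x. convergent (\<lambda>n. dquot g v (1 / real n) x))"
      unfolding Cauchy_convergent_iff[symmetric] by measurable
  next
    fix y
    obtain h where "\<And>a b. a \<le> b \<Longrightarrow> (h has_integral (g (y + b *\<^sub>R v) - g (y + a *\<^sub>R v))) {a..b}"
      using lipschitz_integral_representation[OF lipschitz_on_along_line[OF lip]] by metis
    then have "AE t in lborel. ((\<lambda>t. g (y + t *\<^sub>R v)) has_real_derivative h t) (at t)"
      by (rule has_real_derivative_AE_if_has_integral)
    then show "AE t in lborel. convergent (\<lambda>n. dquot g v (1 / real n) (y + t *\<^sub>R v))"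
    proof eventually_elim
      case (elim t)
      have "filterlim (\<lambda>n. 1 / real n) (at 0) sequentially"
        by (rule filterlim_mono[OF filterlim_1_over_at_right at_le]) auto
      from filterlim_compose[OF elim[unfolded DERIV_def] this]
      have "(\<lambda>n. dquot g v (1 / real n) (y + t *\<^sub>R v)) \<longlonglongrightarrow> h t"
        by (simp add: dquot_def algebra_simps)
      then show ?case unfolding convergent_def by blast
    qed
  qed
  then show ?thesis
    by eventually_elim (auto simp: ddir_def convergent_LIMSEQ_iff intro!: dquot_tendsto_at_right_if_sequentially[OF lip])
qed

lemma AE_eq_0_if_box_integrals_0:
  fixes f :: "'a::euclidean_space \<Rightarrow> real"
  assumes box: "\<And>a b. (f has_integral 0) (cbox a b)"
  shows "AE x in lborel. f x = 0"
proof -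
  have "f integrable_on cbox a b" for a b using box by blast
  from box_average_tendsto_AE[OF this] show ?thesis
    by eventually_elim (simp add: integral_unique[OF box] tendsto_const_iff)
qed

lemma integrable_indicator_mult:
  fixes f :: "'a::euclidean_space \<Rightarrow> real"
  assumes [measurable]: "f \<in> borel_measurable borel" "S \<in> sets borel"
    and "bounded S" and bound: "\<And>x. \<bar>f x\<bar> \<le> B"
  shows "integrable lborel (\<lambda>x. indicator S x * f x)"
proof (rule Bochner_Integration.integrable_bound)
  show "integrable lborel (\<lambda>x. indicator S x * B :: real)"
    using emeasure_bounded_finite[OF \<open>bounded S\<close>] by (intro integrable_mult_left integrable_real_indicator) auto
  have "0 \<le> B" using bound[of undefined] by linarith
  then show "AE x in lborel. norm (indicator S x * f x) \<le> norm (indicator S x * B)"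
    using bound by (intro AE_I2) (auto simp: indicator_def)
qed auto

lemma AE_limit_eq_0_if_box_integrals_tendsto_0:
  fixes e :: "nat \<Rightarrow> 'a::euclidean_space \<Rightarrow> real"
  assumes [measurable]: "\<And>n. e n \<in> borel_measurable borel" "E \<in> borel_measurable borel"
    and bound: "\<And>n x. \<bar>e n x\<bar> \<le> B" and lim: "AE x in lborel. (\<lambda>n. e n x) \<longlonglongrightarrow> E x"
    and box: "\<And>a b. (\<lambda>n. \<integral>x. indicator (cbox a b) x * e n x \<partial>lborel) \<longlonglongrightarrow> 0"
  shows "AE x in lborel. E x = 0"
proof (rule AE_eq_0_if_box_integrals_0)
  fix a b :: 'a
  let ?I = "indicator (cbox a b) :: 'a \<Rightarrow> real"
  have conv: "AE x in lborel. (\<lambda>n. ?I x * e n x) \<longlonglongrightarrow> ?I x * E x"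
    using lim by eventually_elim (intro tendsto_mult tendsto_const)
  have dominated: "AE x in lborel. norm (?I x * e n x) \<le> ?I x * B" for n
    using bound by (intro AE_I2) (auto simp: indicator_def)
  have "0 \<le> B" using bound[of 0 0] by linarith
  then have majorant: "integrable lborel (\<lambda>x. ?I x * B)"
    by (intro integrable_indicator_mult[OF _ _ bounded_cbox]) auto
  have "(\<lambda>n. \<integral>x. ?I x * e n x \<partial>lborel) \<longlonglongrightarrow> (\<integral>x. ?I x * E x \<partial>lborel)"
    by (rule integral_dominated_convergence[OF _ _ majorant conv dominated]) auto
  then have "(\<integral>x. ?I x * E x \<partial>lborel) = 0" using box by (rule LIMSEQ_unique)
  moreover have int: "integrable lborel (\<lambda>x. ?I x * E x)"
    by (rule integrable_dominated_convergence[OF _ _ majorant conv dominated]) auto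
  ultimately have "((\<lambda>x. ?I x * E x) has_integral 0) UNIV"
    using has_integral_integral_lborel[OF int] by simp
  then have "((\<lambda>x. if x \<in> cbox a b then E x else 0) has_integral 0) UNIV"
    by (rule has_integral_eq[rotated]) auto
  then show "(E has_integral 0) (cbox a b)" by (simp only: has_integral_restrict_UNIV)
qed

lemma integral_lborel_translate:
  fixes f :: "'a::euclidean_space \<Rightarrow> real"
  assumes [measurable]: "f \<in> borel_measurable borel"
  shows "(\<integral>x. f (x + c) \<partial>lborel) = (\<integral>x. f x \<partial>lborel)"
proof -
  have "(\<integral>x. f x \<partial>lborel) = (\<integral>x. f x \<partial>(distr lborel borel ((+) c)))" by (simp only: lborel_distr_plus)
  also have "\<dots> = (\<integral>x. f (c + x) \<partial>lborel)" by (rule integral_distr) auto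
  finally show ?thesis by (simp add: add.commute)
qed

lemma indicator_cbox_translate:
  fixes a b c :: "'a::euclidean_space"
  shows "indicator (cbox a b) (x - c) = indicator (cbox (a + c) (b + c)) x"
  by (auto simp: indicator_def mem_box algebra_simps)

lemma indicator_translate_tendsto:
  fixes c :: "nat \<Rightarrow> 'a::real_normed_vector"
  assumes "c \<longlonglongrightarrow> 0" "x \<notin> frontier S"
  shows "(\<lambda>n. indicator S (x - c n) :: real) \<longlonglongrightarrow> indicator S x"
proof (rule isCont_tendsto_compose[where g="indicator S"])
  show "isCont (indicator S :: 'a \<Rightarrow> real) x" using assms(2) by (simp add: isCont_indicator)
  show "(\<lambda>n. x - c n) \<longlonglongrightarrow> x" using tendsto_diff[OF tendsto_const assms(1), of x] by simp
qed

lemma translated_box_difference_tendsto_0: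
  fixes c :: "nat \<Rightarrow> 'a::euclidean_space"
  assumes c: "c \<longlonglongrightarrow> 0"
  shows "(\<lambda>n. \<integral>x. \<bar>indicator (cbox a b) (x - c n) - indicator (cbox a b) x :: real\<bar> \<partial>lborel) \<longlonglongrightarrow> 0"
proof -
  let ?I = "indicator (cbox a b) :: 'a \<Rightarrow> real"
  have "Bseq c" using c convergent_def convergent_imp_Bseq by blast
  then obtain K where K: "\<And>n. norm (c n) \<le> K" unfolding Bseq_def by auto
  obtain r where r: "cbox a b \<subseteq> cball 0 r"
    using bounded_subset_cball bounded_cbox by (metis bounded_pos subset_iff mem_cball_0)
  have "0 \<le> K" using K[of 0] norm_ge_zero order_trans by blast
  have dominated: "\<bar>?I (x - c n) - ?I x\<bar> \<le> indicator (cball 0 (r + K)) x" for x n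
  proof (cases "x \<in> cball 0 (r + K)")
    case False
    then have "r < norm (x - c n)" using norm_triangle_ineq2[of x "c n"] K[of n] by auto
    then have "x - c n \<notin> cbox a b" using r by (auto dest!: subsetD)
    moreover have "x \<notin> cbox a b" using False r \<open>0 \<le> K\<close> by (auto dest!: subsetD)
    ultimately show ?thesis by simp
  qed (auto simp: indicator_def)
  have "(\<lambda>n. \<integral>x. \<bar>?I (x - c n) - ?I x\<bar> \<partial>lborel) \<longlonglongrightarrow> (\<integral>x. 0 \<partial>(lborel :: 'a measure))"
  proof (rule integral_dominated_convergence[where w="indicator (cball 0 (r + K))"])
    show "integrable lborel (indicator (cball 0 (r + K)) :: 'a \<Rightarrow> real)"
      by (intro integrable_real_indicator) (use emeasure_bounded_finite[OF bounded_cball] in auto)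
    show "AE x in lborel. norm \<bar>?I (x - c n) - ?I x\<bar> \<le> indicator (cball 0 (r + K)) x" for n
      using dominated by simp
    have "AE x in lborel. x \<notin> frontier (cbox a b)"
      by (intro negligible_AE_lborel negligible_convex_frontier convex_box)
    then show "AE x in lborel. (\<lambda>n. \<bar>?I (x - c n) - ?I x\<bar>) \<longlonglongrightarrow> 0"
    proof eventually_elim
      case (elim x)
      from tendsto_rabs[OF tendsto_diff[OF indicator_translate_tendsto[OF c elim] tendsto_const[of "?I x"]]]
      show ?case by simp
    qed
  qed auto
  then show ?thesis by simp
qed

lemma box_integral_translation_difference_le:
  fixes k :: "'a::euclidean_space \<Rightarrow> real"
  assumes [measurable]: "k \<in> borel_measurable borel" and bound: "\<And>x. \<bar>k x\<bar> \<le> B"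
  shows "\<bar>\<integral>x. indicator (cbox a b) x * (k (x + c) - k x) \<partial>lborel\<bar>
    \<le> B * (\<integral>x. \<bar>indicator (cbox a b) (x - c) - indicator (cbox a b) x\<bar> \<partial>lborel)"
proof -
  let ?I = "indicator (cbox a b) :: 'a \<Rightarrow> real"
  have int: "integrable lborel (\<lambda>x. indicator (cbox p q) x * f x)"
    if "f \<in> borel_measurable borel" "\<And>x. \<bar>f x\<bar> \<le> D" for p q :: 'a and f :: "'a \<Rightarrow> real" and D
    by (rule integrable_indicator_mult[OF that(1) _ _ that(2)]) auto
  have int_k: "integrable lborel (\<lambda>x. indicator (cbox p q) x * k x)" for p q by (rule int[OF assms])
  have int_shift: "integrable lborel (\<lambda>x. ?I x * k (x + c))" by (rule int[OF _ bound]) simp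
  have int_diff: "integrable lborel (\<lambda>x. (?I (x - c) - ?I x) * k x)"
    using Bochner_Integration.integrable_diff[OF int_k int_k, of "a + c" "b + c" a b]
    by (simp add: indicator_cbox_translate left_diff_distrib)
  have "(\<integral>x. ?I x * (k (x + c) - k x) \<partial>lborel) = (\<integral>x. ?I x * k (x + c) \<partial>lborel) - (\<integral>x. ?I x * k x \<partial>lborel)"
    unfolding right_diff_distrib by (rule Bochner_Integration.integral_diff[OF int_shift int_k])
  also have "(\<integral>x. ?I x * k (x + c) \<partial>lborel) = (\<integral>x. ?I (x - c) * k x \<partial>lborel)"
    using integral_lborel_translate[of "\<lambda>x. ?I (x - c) * k x" c] by simp
  also have "\<dots> - (\<integral>x. ?I x * k x \<partial>lborel) = (\<integral>x. (?I (x - c) - ?I x) * k x \<partial>lborel)"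
    unfolding left_diff_distrib indicator_cbox_translate
    by (rule Bochner_Integration.integral_diff[OF int_k int_k, symmetric])
  also have "\<bar>\<dots>\<bar> \<le> (\<integral>x. \<bar>(?I (x - c) - ?I x) * k x\<bar> \<partial>lborel)" by (rule integral_abs_bound)
  also have "\<dots> \<le> (\<integral>x. B * \<bar>?I (x - c) - ?I x\<bar> \<partial>lborel)"
  proof (rule integral_mono)
    show "integrable lborel (\<lambda>x. \<bar>(?I (x - c) - ?I x) * k x\<bar>)" using int_diff by (rule integrable_abs)
    show "integrable lborel (\<lambda>x. B * \<bar>?I (x - c) - ?I x\<bar>)"
      using Bochner_Integration.integrable_diff[OF int int, of "\<lambda>_. 1" 1 "\<lambda>_. 1" 1 "a + c" "b + c" a b]
      by (intro integrable_mult_right integrable_abs) (simp add: indicator_cbox_translate)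
    show "\<bar>(?I (x - c) - ?I x) * k x\<bar> \<le> B * \<bar>?I (x - c) - ?I x\<bar>" for x
      using mult_left_mono[OF bound[of x], of "\<bar>?I (x - c) - ?I x\<bar>"] by (simp add: abs_mult mult.commute)
  qed
  finally show ?thesis by simp
qed

text \<open>The defect of additivity at scale \<open>t\<close> is the difference between the quotient in direction \<open>v\<close>
  and its translate by \<open>t u\<close>, which disappears from box averages as \<open>t\<close> tends to \<open>0\<close>.\<close>

lemma ddir_add_AE:
  fixes g :: "'a::euclidean_space \<Rightarrow> real"
  assumes lip: "L-lipschitz_on UNIV g"
  shows "AE x in lborel. ddir g (u + v) x = ddir g u x + ddir g v x"
proof -
  have [measurable]: "g \<in> borel_measurable borel"
    by (intro borel_measurable_continuous_onI lipschitz_on_continuous_on[OF lip])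
  define k where "k = (\<lambda>n. dquot g v (1 / real n))"
  define e where "e = (\<lambda>n x. k n (x + (1 / real n) *\<^sub>R u) - k n x)"
  have [measurable]: "k n \<in> borel_measurable borel" for n unfolding k_def by measurable
  have k_bound: "\<bar>k n x\<bar> \<le> L * norm v" for n x unfolding k_def by (rule abs_dquot_le[OF lip])
  have "AE x in lborel. ddir g (u + v) x - ddir g u x - ddir g v x = 0"
  proof (rule AE_limit_eq_0_if_box_integrals_tendsto_0)
    show "e n \<in> borel_measurable borel" for n unfolding e_def by measurable
    show "(\<lambda>x. ddir g (u + v) x - ddir g u x - ddir g v x) \<in> borel_measurable borel" by measurable
    show "\<bar>e n x\<bar> \<le> 2 * (L * norm v)" for n x
      using k_bound[of n x] k_bound[of n "x + (1 / real n) *\<^sub>R u"] unfolding e_def by linarith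
    show "AE x in lborel. (\<lambda>n. e n x) \<longlonglongrightarrow> ddir g (u + v) x - ddir g u x - ddir g v x"
      using dquot_tendsto_ddir_AE[OF lip, of "u + v"] dquot_tendsto_ddir_AE[OF lip, of u] dquot_tendsto_ddir_AE[OF lip, of v]
    proof eventually_elim
      case (elim x)
      have "e n x = dquot g (u + v) (1 / real n) x - dquot g u (1 / real n) x - dquot g v (1 / real n) x" for n
        by (simp add: e_def k_def dquot_add)
      then show ?case by (auto intro!: tendsto_diff filterlim_compose[OF _ filterlim_1_over_at_right] elim)
    qed
    fix a b :: 'a
    let ?I = "indicator (cbox a b) :: 'a \<Rightarrow> real"
    show "(\<lambda>n. \<integral>x. ?I x * e n x \<partial>lborel) \<longlonglongrightarrow> 0"
    proof (rule Lim_null_comparison)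
      have "(\<lambda>n. (1 / real n) *\<^sub>R u) \<longlonglongrightarrow> 0 *\<^sub>R u" by (intro tendsto_intros lim_1_over_n)
      then show "(\<lambda>n. (L * norm v) * (\<integral>x. \<bar>?I (x - (1 / real n) *\<^sub>R u) - ?I x\<bar> \<partial>lborel)) \<longlonglongrightarrow> 0"
        by (intro tendsto_mult_right_zero translated_box_difference_tendsto_0) simp
      show "\<forall>\<^sub>F n in sequentially. norm (\<integral>x. ?I x * e n x \<partial>lborel)
          \<le> (L * norm v) * (\<integral>x. \<bar>?I (x - (1 / real n) *\<^sub>R u) - ?I x\<bar> \<partial>lborel)"
        unfolding e_def real_norm_def
        by (intro always_eventually allI box_integral_translation_difference_le k_bound) simp
    qed
  qed
  then show ?thesis by eventually_elim simp
qed

lemma ddir_0 [simp]: "ddir g 0 x = 0"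
  by (simp add: ddir_def dquot_def)

lemma ddir_pos_scaleR_AE:
  fixes g :: "'a::euclidean_space \<Rightarrow> real"
  assumes lip: "L-lipschitz_on UNIV g" and "0 < c"
  shows "AE x in lborel. ddir g (c *\<^sub>R v) x = c * ddir g v x"
  using dquot_tendsto_ddir_AE[OF lip, of v] dquot_tendsto_ddir_AE[OF lip, of "c *\<^sub>R v"]
proof eventually_elim
  case (elim x)
  have "((\<lambda>t. c * dquot g v (c * t) x) \<longlongrightarrow> c * ddir g v x) (at_right 0)"
    using elim(1) filterlim_times_pos[OF filterlim_ident \<open>0 < c\<close>, of 0 0]
    by (intro tendsto_mult tendsto_const filterlim_compose[OF elim(1)]) (simp add: mult.commute)
  then show ?case
    using elim(2) \<open>0 < c\<close> by (auto simp: dquot_scaleR intro: tendsto_unique[OF trivial_limit_at_right_real])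
qed

lemma ddir_scaleR_AE:
  fixes g :: "'a::euclidean_space \<Rightarrow> real"
  assumes lip: "L-lipschitz_on UNIV g"
  shows "AE x in lborel. ddir g (c *\<^sub>R v) x = c * ddir g v x"
proof -
  consider "0 < c" | "c = 0" | (negative) "0 < - c" by linarith
  then show ?thesis
  proof cases
    case negative
    show ?thesis
      using ddir_pos_scaleR_AE[OF lip negative, of v] ddir_add_AE[OF lip, of "c *\<^sub>R v" "(- c) *\<^sub>R v"]
      by eventually_elim (simp flip: scaleR_add_left)
  qed (use ddir_pos_scaleR_AE[OF lip] in auto)
qed

lemma ddir_sum_AE:
  fixes g :: "'a::euclidean_space \<Rightarrow> real"
  assumes lip: "L-lipschitz_on UNIV g" and "finite A"
  shows "AE x in lborel. ddir g (\<Sum>b\<in>A. c b *\<^sub>R b) x = (\<Sum>b\<in>A. c b * ddir g b x)"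
  using \<open>finite A\<close>
proof (induction A rule: finite_induct)
  case (insert b A)
  show ?case
    using insert.IH ddir_scaleR_AE[OF lip, of "c b" b] ddir_add_AE[OF lip, of "c b *\<^sub>R b" "\<Sum>b\<in>A. c b *\<^sub>R b"]
    by eventually_elim (simp add: insert.hyps)
qed simp

lemma uniform_limit_if_dense_lipschitz:
  fixes f :: "'t \<Rightarrow> 'a::metric_space \<Rightarrow> 'b::metric_space"
  assumes f: "\<And>t. L-lipschitz_on UNIV (f t)" and l: "M-lipschitz_on UNIV l" and "compact S"
    and dense: "\<And>U. open U \<Longrightarrow> U \<noteq> {} \<Longrightarrow> \<exists>v\<in>D. v \<in> U"
    and lim: "\<And>v. v \<in> D \<Longrightarrow> ((\<lambda>t. f t v) \<longlongrightarrow> l v) F"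
  shows "uniform_limit S f l F"
proof (rule uniform_limitI)
  fix e :: real assume "0 < e"
  have LM: "0 \<le> L" "0 \<le> M" using lipschitz_on_nonneg[OF f] lipschitz_on_nonneg[OF l] by auto
  define \<eta> where "\<eta> = e / 3 / (L + M + 1)"
  have "0 < L + M + 1" using LM by linarith
  then have \<eta>: "0 < \<eta>" using \<open>0 < e\<close> by (simp add: \<eta>_def)
  have "(L + M + 1) * \<eta> = e / 3"
    unfolding \<eta>_def times_divide_eq_right[of _ "e / 3"] using \<open>0 < L + M + 1\<close> by (intro nonzero_mult_div_cancel_left) simp
  then have L\<eta>: "L * \<eta> \<le> e / 3" "M * \<eta> \<le> e / 3"
    using LM \<eta> mult_nonneg_nonneg[of L \<eta>] mult_nonneg_nonneg[of M \<eta>] by (auto simp: algebra_simps)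
  have "S \<subseteq> (\<Union>v\<in>D. ball v \<eta>)"
    using dense[of "ball _ \<eta>"] \<eta> by (force simp: dist_commute)
  then obtain K where K: "K \<subseteq> D" "finite K" "S \<subseteq> (\<Union>v\<in>K. ball v \<eta>)"
    using compactE_image[OF \<open>compact S\<close>, of D "\<lambda>v. ball v \<eta>"] by (metis open_ball)
  have "\<forall>\<^sub>F t in F. \<forall>v\<in>K. dist (f t v) (l v) < e / 3"
    using K \<open>0 < e\<close> by (intro eventually_ball_finite ballI tendstoD[OF lim]) auto
  then show "\<forall>\<^sub>F t in F. \<forall>w\<in>S. dist (f t w) (l w) < e"
  proof (eventually_elim, intro ballI)
    fix t w assume K_close: "\<forall>v\<in>K. dist (f t v) (l v) < e / 3" and "w \<in> S"
    then obtain v where v: "v \<in> K" "dist v w < \<eta>" using K(3) by auto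
    have "dist (f t w) (f t v) \<le> L * dist v w" "dist (l v) (l w) \<le> M * dist v w"
      using lipschitz_onD[OF f, of w v] lipschitz_onD[OF l, of v w] by (auto simp: dist_commute)
    moreover have "L * dist v w \<le> L * \<eta>" "M * dist v w \<le> M * \<eta>"
      using v LM by (auto intro: mult_left_mono)
    moreover have "dist (f t w) (l w) \<le> dist (f t w) (f t v) + dist (f t v) (l v) + dist (l v) (l w)"
      using dist_triangle[of "f t w" "l w" "f t v"] dist_triangle[of "f t v" "l w" "l v"] by linarith
    moreover have "dist (f t v) (l v) < e / 3" using K_close v by blast
    ultimately show "dist (f t w) (l w) < e" using L\<eta> by linarith
  qed
qed

lemma has_derivative_if_dquot_uniform_limit:
  fixes g :: "'a::euclidean_space \<Rightarrow> real"
  assumes unif: "uniform_limit (sphere 0 1) (\<lambda>t v. dquot g v t x) (\<lambda>v. z \<bullet> v) (at_right 0)"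
  shows "(g has_derivative (\<lambda>v. z \<bullet> v)) (at x)"
  unfolding has_derivative_at_alt
proof (intro conjI allI impI bounded_linear_inner_right)
  fix e :: real assume "0 < e"
  then obtain d where d: "0 < d" "\<And>t w. 0 < t \<Longrightarrow> t < d \<Longrightarrow> norm w = 1 \<Longrightarrow> \<bar>dquot g w t x - z \<bullet> w\<bar> < e"
    using uniform_limitD[OF unif] unfolding eventually_at_right_field by (fastforce simp: dist_real_def)
  have "norm (g y - g x - z \<bullet> (y - x)) \<le> e * norm (y - x)" if y: "norm (y - x) < d" for y
  proof (cases "y = x")
    case False
    define t where "t = norm (y - x)"
    define w where "w = (1 / t) *\<^sub>R (y - x)"
    have t: "0 < t" "t < d" using False y by (auto simp: t_def)
    have w: "y - x = t *\<^sub>R w" "norm w = 1" using t by (auto simp: w_def t_def)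
    have "t * dquot g w t x = g y - g x" using t by (simp add: dquot_def flip: w(1))
    then have "g y - g x - z \<bullet> (y - x) = t * (dquot g w t x - z \<bullet> w)"
      by (simp add: w(1) right_diff_distrib)
    then have "norm (g y - g x - z \<bullet> (y - x)) = t * \<bar>dquot g w t x - z \<bullet> w\<bar>"
      using t by (simp add: abs_mult)
    also have "\<dots> \<le> t * e" using d(2)[OF t w(2)] t by (intro mult_left_mono) auto
    finally show ?thesis by (simp add: t_def mult.commute)
  qed simp
  then show "\<exists>d>0. \<forall>y. norm (y - x) < d \<longrightarrow> norm (g y - g x - z \<bullet> (y - x)) \<le> e * norm (y - x)"
    using d(1) by blast
qed

theorem Rademacher:
  fixes g :: "'a::euclidean_space \<Rightarrow> real"
  assumes lip: "L-lipschitz_on UNIV g"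
  shows "AE x in lborel. g differentiable at x"
proof -
  obtain D :: "'a set" where D: "countable D" "\<And>U. open U \<Longrightarrow> U \<noteq> {} \<Longrightarrow> \<exists>v\<in>D. v \<in> U"
    using countable_dense_setE by metis
  have "AE x in lborel. ((\<lambda>t. dquot g v t x) \<longlongrightarrow> (\<Sum>b\<in>Basis. (v \<bullet> b) * ddir g b x)) (at_right 0)" for v
    using dquot_tendsto_ddir_AE[OF lip, of v] ddir_sum_AE[OF lip finite_Basis, of "\<lambda>b. v \<bullet> b"]
    by eventually_elim (simp add: euclidean_representation)
  then have "AE x in lborel. \<forall>v\<in>D. ((\<lambda>t. dquot g v t x) \<longlongrightarrow> (\<Sum>b\<in>Basis. (v \<bullet> b) * ddir g b x)) (at_right 0)"
    unfolding AE_ball_countable[OF D(1)] by blast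
  then show ?thesis
  proof eventually_elim
    case (elim x)
    let ?z = "\<Sum>b\<in>Basis. ddir g b x *\<^sub>R b"
    have z: "?z \<bullet> v = (\<Sum>b\<in>Basis. (v \<bullet> b) * ddir g b x)" for v
      by (simp add: inner_sum_left inner_commute[of v] mult.commute)
    obtain M where "M-lipschitz_on UNIV (\<lambda>v. ?z \<bullet> v)"
      using bounded_linear.lipschitz_boundE[OF bounded_linear_inner_right] by blast
    then have "uniform_limit (sphere 0 1) (\<lambda>t v. dquot g v t x) (\<lambda>v. ?z \<bullet> v) (at_right 0)"
      using elim unfolding z[symmetric]
      by (intro uniform_limit_if_dense_lipschitz[OF lipschitz_on_dquot[OF lip] _ compact_sphere D(2)]) auto
    then show ?case using has_derivative_if_dquot_uniform_limit unfolding differentiable_def by blast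
  qed
qed

lemma has_derivative_along_line:
  assumes "(f has_derivative D) (at (y + t *\<^sub>R v))"
  shows "((\<lambda>s. f (y + s *\<^sub>R v)) has_real_derivative D v) (at t)"
proof -
  have "((\<lambda>s::real. y + s *\<^sub>R v) has_derivative (\<lambda>s. s *\<^sub>R v)) (at t)"
    by (auto intro!: derivative_eq_intros)
  from has_derivative_compose[OF this assms]
  have "((\<lambda>s. f (y + s *\<^sub>R v)) has_derivative (\<lambda>s. D (s *\<^sub>R v))) (at t)" .
  moreover have "D (s *\<^sub>R v) = D v * s" for s
    using has_derivative_linear[OF assms] by (simp add: linear_cmul mult.commute)
  ultimately show ?thesis by (simp add: has_field_derivative_def)
qed

lemma lipschitz_segment_increment_le:
  fixes g :: "'a::euclidean_space \<Rightarrow> real"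
  assumes lip: "L-lipschitz_on UNIV g" and "0 \<le> h"
    and diff: "AE t in lborel. g differentiable at (y + t *\<^sub>R w)"
    and deriv: "\<And>t D. 0 < t \<Longrightarrow> t < h \<Longrightarrow> (g has_derivative D) (at (y + t *\<^sub>R w)) \<Longrightarrow> D w \<le> c"
  shows "g (y + h *\<^sub>R w) \<le> g y + c * h"
proof -
  have "AE t in lborel. 0 < t \<longrightarrow> t < h \<longrightarrow> (\<forall>d. ((\<lambda>t. g (y + t *\<^sub>R w)) has_real_derivative d) (at t) \<longrightarrow> d \<le> c)"
    using diff
  proof (eventually_elim, intro impI allI)
    fix t d assume t: "0 < t" "t < h" and d: "((\<lambda>t. g (y + t *\<^sub>R w)) has_real_derivative d) (at t)"
      and "g differentiable at (y + t *\<^sub>R w)"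
    then obtain D where D: "(g has_derivative D) (at (y + t *\<^sub>R w))" unfolding differentiable_def by blast
    have "d = D w" using DERIV_unique[OF d has_derivative_along_line[OF D]] .
    then show "d \<le> c" using deriv[OF t D] by simp
  qed
  from lipschitz_real_increment_le[OF lipschitz_on_along_line[OF lip] \<open>0 \<le> h\<close> this]
  show ?thesis by (simp add: algebra_simps)
qed

text \<open>The derivative bound is available only where \<open>g\<close> is differentiable, which may be nowhere on
  the given segment, but holds almost everywhere on arbitrarily close parallel segments.\<close>

lemma lipschitz_increment_le_if_derivative_le:
  fixes g :: "'a::euclidean_space \<Rightarrow> real"
  assumes lip: "L-lipschitz_on S g" and "open S" "0 \<le> h"
    and seg: "\<And>t. t \<in> {0..h} \<Longrightarrow> x + t *\<^sub>R w \<in> S"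
    and deriv: "\<And>y D. y \<in> S \<Longrightarrow> (g has_derivative D) (at y) \<Longrightarrow> D w \<le> c"
  shows "g (x + h *\<^sub>R w) \<le> g x + c * h"
proof (rule ccontr)
  assume "\<not> g (x + h *\<^sub>R w) \<le> g x + c * h"
  obtain G where G: "L-lipschitz_on UNIV G" "\<And>y. y \<in> S \<Longrightarrow> G y = g y"
    using lipschitz_on_extension[OF lip] by blast
  have "compact ((\<lambda>t. x + t *\<^sub>R w) ` {0..h})"
    by (intro compact_continuous_image continuous_intros compact_Icc)
  moreover have "(\<lambda>t. x + t *\<^sub>R w) ` {0..h} \<subseteq> S" using seg by blast
  ultimately obtain \<epsilon> where \<epsilon>: "0 < \<epsilon>" "(\<Union>z\<in>(\<lambda>t. x + t *\<^sub>R w) ` {0..h}. ball z \<epsilon>) \<subseteq> S"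
    by (rule compact_subset_open_imp_ball_epsilon_subset[OF _ \<open>open S\<close>])
  define \<phi> where "\<phi> = (\<lambda>y. G y + c * h - G (y + h *\<^sub>R w))"
  have "\<phi> x < 0"
    using \<open>\<not> g (x + h *\<^sub>R w) \<le> g x + c * h\<close> seg[of 0] seg[of h] \<open>0 \<le> h\<close> by (simp add: \<phi>_def G(2))
  moreover have "continuous_on UNIV (\<lambda>y. G (y + h *\<^sub>R w))"
    by (rule continuous_on_compose2[OF lipschitz_on_continuous_on[OF G(1)]]) (auto intro!: continuous_intros)
  then have "continuous_on UNIV \<phi>"
    unfolding \<phi>_def by (intro continuous_on_diff continuous_on_add continuous_on_const lipschitz_on_continuous_on[OF G(1)])
  then have "(\<phi> \<longlongrightarrow> \<phi> x) (nhds x)"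
    by (simp add: continuous_on_def flip: tendsto_at_iff_tendsto_nhds)
  ultimately have "\<forall>\<^sub>F y in nhds x. \<phi> y < 0" by (intro order_tendstoD)
  then obtain \<delta> where \<delta>: "0 < \<delta>" "\<And>y. dist y x < \<delta> \<Longrightarrow> \<phi> y < 0"
    unfolding eventually_nhds_metric by blast
  obtain y where y: "y \<in> ball x (min \<epsilon> \<delta>)" "AE t in lborel. G differentiable at (y + t *\<^sub>R w)"
    by (rule AE_lborel_ball_ex[OF AE_lborel_on_lines[OF Rademacher[OF G(1)]], of "min \<epsilon> \<delta>" x]) (use \<epsilon> \<delta> in auto)
  have "G (y + h *\<^sub>R w) \<le> G y + c * h"
  proof (rule lipschitz_segment_increment_le[OF G(1) \<open>0 \<le> h\<close> y(2)])
    fix t D assume t: "0 < t" "t < h" and D: "(G has_derivative D) (at (y + t *\<^sub>R w))"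
    have "y + t *\<^sub>R w \<in> (\<Union>z\<in>(\<lambda>t. x + t *\<^sub>R w) ` {0..h}. ball z \<epsilon>)"
      using y(1) t by (intro UN_I[of "x + t *\<^sub>R w"]) (auto simp: dist_norm)
    then have yt: "y + t *\<^sub>R w \<in> S" by (rule subsetD[OF \<epsilon>(2)])
    then have "(g has_derivative D) (at (y + t *\<^sub>R w))"
      by (rule has_derivative_transform_within_open[OF D \<open>open S\<close>]) (rule G(2))
    then show "D w \<le> c" by (rule deriv[OF yt])
  qed
  then show False using \<delta>(2)[of y] y(1) by (simp add: \<phi>_def dist_commute)
qed

section \<open>Locally Lipschitz functions\<close>

definition lipschitz_near :: "('a::metric_space \<Rightarrow> 'b::metric_space) \<Rightarrow> 'a \<Rightarrow> bool" where
  "lipschitz_near f x \<longleftrightarrow> (\<exists>\<delta>>0. \<exists>L. L-lipschitz_on (ball x \<delta>) f)"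

lemma lipschitz_nearE:
  assumes "lipschitz_near f x"
  obtains \<delta> L where "0 < \<delta>" "L-lipschitz_on (ball x \<delta>) f"
  using assms unfolding lipschitz_near_def by blast

lemma lipschitz_nearI: "0 < \<delta> \<Longrightarrow> L-lipschitz_on (ball x \<delta>) f \<Longrightarrow> lipschitz_near f x"
  unfolding lipschitz_near_def by blast

lemma locLip_iff_lipschitz_on:
  "locLip S f \<longleftrightarrow> (\<forall>\<xi>\<in>S. \<exists>\<delta>>0. \<exists>L. L-lipschitz_on (S \<inter> ball \<xi> \<delta>) f)"
proof
  assume f: "locLip S f"
  show "\<forall>\<xi>\<in>S. \<exists>\<delta>>0. \<exists>L. L-lipschitz_on (S \<inter> ball \<xi> \<delta>) f"
  proof
    fix \<xi> assume "\<xi> \<in> S"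
    then obtain \<delta> L where \<delta>: "0 < \<delta>"
      and L: "\<And>a b. a \<in> S \<inter> ball \<xi> \<delta> \<Longrightarrow> b \<in> S \<inter> ball \<xi> \<delta> \<Longrightarrow> dist (f a) (f b) \<le> L * dist a b"
      using f unfolding locLip_def by blast
    have "\<bar>L\<bar>-lipschitz_on (S \<inter> ball \<xi> \<delta>) f"
    proof (rule lipschitz_onI)
      fix a b assume ab: "a \<in> S \<inter> ball \<xi> \<delta>" "b \<in> S \<inter> ball \<xi> \<delta>"
      have "L * dist a b \<le> \<bar>L\<bar> * dist a b" by (intro mult_right_mono) auto
      with L[OF ab] show "dist (f a) (f b) \<le> \<bar>L\<bar> * dist a b" by linarith
    qed simp
    then show "\<exists>\<delta>>0. \<exists>L. L-lipschitz_on (S \<inter> ball \<xi> \<delta>) f" using \<delta> by blast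
  qed
qed (unfold locLip_def lipschitz_on_def, meson)

lemma locLip_open_iff:
  assumes "open S"
  shows "locLip S f \<longleftrightarrow> (\<forall>\<xi>\<in>S. lipschitz_near f \<xi>)"
proof
  assume f: "locLip S f"
  show "\<forall>\<xi>\<in>S. lipschitz_near f \<xi>"
  proof
    fix \<xi> assume "\<xi> \<in> S"
    then obtain \<delta> L e where "0 < \<delta>" and L: "L-lipschitz_on (S \<inter> ball \<xi> \<delta>) f" and "0 < e" "ball \<xi> e \<subseteq> S"
      using f \<open>open S\<close> unfolding locLip_iff_lipschitz_on by (meson open_contains_ball)
    moreover from this have "L-lipschitz_on (ball \<xi> (min \<delta> e)) f"
      by (intro lipschitz_on_subset[OF L]) auto
    ultimately show "lipschitz_near f \<xi>" by (intro lipschitz_nearI[of "min \<delta> e"]) auto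
  qed
next
  assume "\<forall>\<xi>\<in>S. lipschitz_near f \<xi>"
  then show "locLip S f"
    unfolding locLip_iff_lipschitz_on lipschitz_near_def by (meson inf_le2 lipschitz_on_subset)
qed

lemma locLip_subset: "locLip S f \<Longrightarrow> T \<subseteq> S \<Longrightarrow> locLip T f"
  unfolding locLip_iff_lipschitz_on by (meson Int_mono lipschitz_on_subset order_refl subsetD)

lemma locLip_imp_local_lipschitz:
  assumes "locLip S f"
  shows "local_lipschitz T S (\<lambda>_. f)"
proof (rule local_lipschitzI)
  fix t x assume "x \<in> S"
  then obtain \<delta> L where "0 < \<delta>" "L-lipschitz_on (S \<inter> ball x \<delta>) f"
    using assms unfolding locLip_iff_lipschitz_on by blast
  moreover have "cball x (\<delta> / 2) \<inter> S \<subseteq> S \<inter> ball x \<delta>" using \<open>0 < \<delta>\<close> by auto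
  ultimately show "\<exists>u>0. \<exists>L. \<forall>s\<in>cball t u \<inter> T. L-lipschitz_on (cball x u \<inter> S) f"
    by (meson half_gt_zero lipschitz_on_subset)
qed

lemma locLip_compact_imp_lipschitz:
  assumes "compact S" "locLip S f"
  obtains L where "L-lipschitz_on S f"
proof -
  have "local_lipschitz {0::real} S (\<lambda>_. f)" using assms(2) by (rule locLip_imp_local_lipschitz)
  then show ?thesis
    by (rule local_lipschitz_compact_implies_lipschitz[OF _ \<open>compact S\<close>]) (use that in auto)
qed

lemma lipschitz_near_isCont: "lipschitz_near f x \<Longrightarrow> isCont f x"
  by (elim lipschitz_nearE) (metis centre_in_ball continuous_on_eq_continuous_at lipschitz_on_continuous_on open_ball)

lemma lipschitz_near_cong:
  assumes "\<forall>\<^sub>F y in nhds x. f y = g y"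
  shows "lipschitz_near f x \<longleftrightarrow> lipschitz_near g x"
proof -
  have "lipschitz_near q x" if p: "lipschitz_near p x" and eq: "\<forall>\<^sub>F y in nhds x. p y = q y" for p q :: "'a \<Rightarrow> 'b"
  proof -
    obtain \<delta> L e where "0 < \<delta>" and L: "L-lipschitz_on (ball x \<delta>) p" and e: "0 < e" "\<And>y. dist y x < e \<Longrightarrow> p y = q y"
      using p eq by (auto elim!: lipschitz_nearE simp: eventually_nhds_metric)
    have "L-lipschitz_on (ball x (min \<delta> e)) q"
      by (rule lipschitz_on_transform[OF lipschitz_on_subset[OF L]]) (auto simp: e(2) dist_commute)
    then show ?thesis using \<open>0 < \<delta>\<close> e(1) by (intro lipschitz_nearI[of "min \<delta> e"]) auto
  qed
  then show ?thesis using assms by (metis (mono_tags, lifting) eventually_mono)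
qed

lemma lipschitz_near_compose:
  assumes "lipschitz_near f x" "lipschitz_near h (f x)"
  shows "lipschitz_near (\<lambda>y. h (f y)) x"
proof -
  obtain \<delta> L where \<delta>: "0 < \<delta>" and L: "L-lipschitz_on (ball x \<delta>) f" using assms(1) by (rule lipschitz_nearE)
  obtain e K where e: "0 < e" and K: "K-lipschitz_on (ball (f x) e) h" using assms(2) by (rule lipschitz_nearE)
  obtain d where d: "0 < d" "\<And>y. dist y x < d \<Longrightarrow> dist (f y) (f x) < e"
    using lipschitz_near_isCont[OF assms(1)] e unfolding continuous_at_eps_delta by blast
  have "(K * L)-lipschitz_on (ball x (min \<delta> d)) (\<lambda>y. h (f y))"
  proof (rule lipschitz_on_compose2[OF lipschitz_on_subset[OF L] lipschitz_on_subset[OF K]])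
    show "f ` ball x (min \<delta> d) \<subseteq> ball (f x) e" using d(2) by (auto simp: dist_commute)
  qed auto
  then show ?thesis using \<delta> d(1) by (intro lipschitz_nearI[of "min \<delta> d"]) auto
qed

lemma lipschitz_near_max:
  fixes f g :: "'a::metric_space \<Rightarrow> real"
  assumes "lipschitz_near f x" "lipschitz_near g x"
  shows "lipschitz_near (\<lambda>y. max (f y) (g y)) x"
proof -
  obtain \<delta> L where \<delta>: "0 < \<delta>" and L: "L-lipschitz_on (ball x \<delta>) f" using assms(1) by (rule lipschitz_nearE)
  obtain e K where e: "0 < e" and K: "K-lipschitz_on (ball x e) g" using assms(2) by (rule lipschitz_nearE)
  have "(max L K)-lipschitz_on (ball x (min \<delta> e)) (\<lambda>y. max (f y) (g y))"
  proof (rule lipschitz_onI)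
    fix a b assume ab: "a \<in> ball x (min \<delta> e)" "b \<in> ball x (min \<delta> e)"
    have "\<bar>f a - f b\<bar> \<le> L * dist a b" "\<bar>g a - g b\<bar> \<le> K * dist a b"
      using lipschitz_onD[OF L, of a b] lipschitz_onD[OF K, of a b] ab by (auto simp: dist_real_def)
    moreover have "L * dist a b \<le> max L K * dist a b" "K * dist a b \<le> max L K * dist a b"
      by (auto intro: mult_right_mono)
    ultimately show "dist (max (f a) (g a)) (max (f b) (g b)) \<le> max L K * dist a b"
      unfolding dist_real_def by linarith
  qed (use lipschitz_on_nonneg[OF L] in auto)
  then show ?thesis using \<delta> e by (intro lipschitz_nearI[of "min \<delta> e"]) auto
qed

lemma lipschitz_near_Max_image:
  fixes f :: "'i \<Rightarrow> 'a::metric_space \<Rightarrow> real"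
  assumes "finite I" "I \<noteq> {}" "\<And>i. i \<in> I \<Longrightarrow> lipschitz_near (f i) x"
  shows "lipschitz_near (\<lambda>y. Max ((\<lambda>i. f i y) ` I)) x"
  using assms
proof (induction I rule: finite_ne_induct)
  case (insert i I)
  then have "lipschitz_near (\<lambda>y. max (f i y) (Max ((\<lambda>i. f i y) ` I))) x"
    by (intro lipschitz_near_max) auto
  then show ?case using insert by simp
qed simp

lemma lipschitz_near_if_continuous_derivative:
  fixes f :: "real \<Rightarrow> real"
  assumes "open S" "x \<in> S" and cont: "continuous_on S f'"
    and deriv: "\<And>y. y \<in> S \<Longrightarrow> (f has_real_derivative f' y) (at y)"
  shows "lipschitz_near f x"
proof -
  obtain e where e: "0 < e" "cball x e \<subseteq> S" using assms(1,2) open_contains_cball by blast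
  have "compact (f' ` cball x e)"
    by (intro compact_continuous_image continuous_on_subset[OF cont e(2)] compact_cball)
  then obtain B where B: "0 < B" "\<And>y. y \<in> cball x e \<Longrightarrow> \<bar>f' y\<bar> \<le> B"
    using compact_imp_bounded bounded_pos by (metis image_eqI real_norm_def)
  have "B-lipschitz_on (cball x e) f"
  proof (rule bounded_derivative_imp_lipschitz)
    fix y assume y: "y \<in> cball x e"
    show "(f has_derivative (*) (f' y)) (at y within cball x e)"
      using deriv[OF subsetD[OF e(2) y]] by (simp add: has_field_derivative_def has_derivative_at_withinI)
    show "onorm ((*) (f' y)) \<le> B"
      using B(2)[OF y] by (intro onorm_le) (simp add: abs_mult mult_right_mono)
  qed (use B in auto)
  then show ?thesis using e(1) by (meson ball_subset_cball lipschitz_nearI lipschitz_on_subset)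
qed

lemma lipschitz_on_mult_bounded:
  fixes f g :: "'a::metric_space \<Rightarrow> real"
  assumes f: "K-lipschitz_on S f" "\<And>x. x \<in> S \<Longrightarrow> \<bar>f x\<bar> \<le> A" and g: "L-lipschitz_on S g" "\<And>x. x \<in> S \<Longrightarrow> \<bar>g x\<bar> \<le> B"
    and "0 \<le> A" "0 \<le> B"
  shows "(A * L + B * K)-lipschitz_on S (\<lambda>x. f x * g x)"
proof (rule lipschitz_onI)
  fix x y assume xy: "x \<in> S" "y \<in> S"
  have "f x * g x - f y * g y = f x * (g x - g y) + g y * (f x - f y)" by (simp add: algebra_simps)
  moreover have "\<bar>f x * (g x - g y)\<bar> \<le> A * (L * dist x y)"
    unfolding abs_mult using lipschitz_onD[OF g(1) xy] f(2)[OF xy(1)] \<open>0 \<le> A\<close>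
    by (intro mult_mono) (auto simp: dist_real_def)
  moreover have "\<bar>g y * (f x - f y)\<bar> \<le> B * (K * dist x y)"
    unfolding abs_mult using lipschitz_onD[OF f(1) xy] g(2)[OF xy(2)] \<open>0 \<le> B\<close>
    by (intro mult_mono) (auto simp: dist_real_def)
  ultimately show "dist (f x * g x) (f y * g y) \<le> (A * L + B * K) * dist x y"
    unfolding dist_real_def by (simp add: algebra_simps)
qed (use lipschitz_on_nonneg[OF f(1)] lipschitz_on_nonneg[OF g(1)] \<open>0 \<le> A\<close> \<open>0 \<le> B\<close> in simp)

section \<open>Comparison functions\<close>

lemma finite_positive_lower_bound:
  fixes e :: "'i \<Rightarrow> real"
  assumes "finite I" "\<And>i. i \<in> I \<Longrightarrow> 0 < e i"
  obtains e0 where "0 < e0" "\<And>i. i \<in> I \<Longrightarrow> e0 \<le> e i"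
proof (rule that)
  show "0 < Min (insert 1 (e ` I))" using assms by (subst Min_gr_iff) auto
  show "Min (insert 1 (e ` I)) \<le> e i" if "i \<in> I" for i using assms(1) that by (intro Min_le) auto
qed

lemma classK_less: "classK g \<Longrightarrow> 0 \<le> x \<Longrightarrow> x < y \<Longrightarrow> g x < g y"
  unfolding classK_def by (auto simp: strict_mono_on_def)

lemma classK_le: "classK g \<Longrightarrow> 0 \<le> x \<Longrightarrow> x \<le> y \<Longrightarrow> g x \<le> g y"
  using classK_less[of g x y] by (cases "x = y") auto

lemma classK_zero: "classK g \<Longrightarrow> g 0 = 0"
  by (simp add: classK_def)

lemma classK_nonneg: "classK g \<Longrightarrow> 0 \<le> x \<Longrightarrow> 0 \<le> g x"
  using classK_le[of g 0 x] by (simp add: classK_zero)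

lemma classK_pos: "classK g \<Longrightarrow> 0 < x \<Longrightarrow> 0 < g x"
  using classK_less[of g 0 x] by (simp add: classK_zero)

lemma classK_le_iff: "classK g \<Longrightarrow> 0 \<le> x \<Longrightarrow> 0 \<le> y \<Longrightarrow> g x \<le> g y \<longleftrightarrow> x \<le> y"
  using classK_le[of g x y] classK_less[of g y x] by (cases "x \<le> y") auto

lemma classK_less_iff: "classK g \<Longrightarrow> 0 \<le> x \<Longrightarrow> 0 \<le> y \<Longrightarrow> g x < g y \<longleftrightarrow> x < y"
  using classK_le_iff[of g y x] by (simp add: not_le[symmetric])

lemma classK_cont: "classK g \<Longrightarrow> continuous_on {0..} g"
  by (simp add: classK_def)

lemma classKinf_classK: "classKinf g \<Longrightarrow> classK g"
  by (simp add: classKinf_def)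

lemma classK_compose: "classK f \<Longrightarrow> classK g \<Longrightarrow> classK (\<lambda>x. f (g x))"
  using classK_less[of f] classK_less[of g] classK_nonneg[of g] unfolding classK_def
  by (auto intro!: strict_mono_onI continuous_on_compose2[of "{0..}" f])

lemma classKinf_compose: "classKinf f \<Longrightarrow> classKinf g \<Longrightarrow> classKinf (\<lambda>x. f (g x))"
  unfolding classKinf_def using classK_compose[of f g] filterlim_compose[of f at_top at_top g at_top] by simp

lemma classKinf_surj:
  assumes "classKinf g" "0 \<le> y"
  obtains x where "0 \<le> x" "g x = y"
proof -
  have "\<forall>\<^sub>F x in at_top. y \<le> g x \<and> 0 \<le> x"
    using assms eventually_ge_at_top[of 0] by (auto simp: classKinf_def filterlim_at_top intro: eventually_conj)
  then obtain b where b: "y \<le> g b" "0 \<le> b" using eventually_happens'[of at_top] by force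
  have "continuous_on {0..b} g"
    using classK_cont[OF classKinf_classK[OF assms(1)]] continuous_on_subset by fastforce
  with IVT'[of g 0 y b] b assms show ?thesis
    using that classK_zero[OF classKinf_classK[OF assms(1)]] by auto
qed

lemma Kinv_Kinf: "classKinf g \<Longrightarrow> 0 \<le> y \<Longrightarrow> g (Kinv g y) = y"
  and Kinv_nonneg: "classKinf g \<Longrightarrow> 0 \<le> y \<Longrightarrow> 0 \<le> Kinv g y"
proof -
  assume "classKinf g" "0 \<le> y"
  then have "y \<in> g ` {0..}" by (metis atLeast_iff classKinf_surj image_eqI)
  then show "g (Kinv g y) = y" "0 \<le> Kinv g y"
    unfolding Kinv_def using inv_into_into[of y g "{0..}"] by (auto simp: f_inv_into_f)
qed

lemma Kinv_cancel: "classKinf g \<Longrightarrow> 0 \<le> x \<Longrightarrow> Kinv g (g x) = x"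
  using classK_le_iff[OF classKinf_classK, of g x "Kinv g (g x)"] classK_le_iff[OF classKinf_classK, of g "Kinv g (g x)" x]
  by (simp add: Kinv_Kinf Kinv_nonneg classK_nonneg[OF classKinf_classK])

lemma Kinv_le_iff: "classKinf g \<Longrightarrow> 0 \<le> x \<Longrightarrow> 0 \<le> y \<Longrightarrow> Kinv g y \<le> x \<longleftrightarrow> y \<le> g x"
  using classK_le_iff[OF classKinf_classK, of g "Kinv g y" x] by (simp add: Kinv_Kinf Kinv_nonneg)

lemma Kinv_less_iff: "classKinf g \<Longrightarrow> 0 \<le> x \<Longrightarrow> 0 \<le> y \<Longrightarrow> Kinv g y < x \<longleftrightarrow> y < g x"
  using classK_less_iff[OF classKinf_classK, of g "Kinv g y" x] by (simp add: Kinv_Kinf Kinv_nonneg)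

lemma less_Kinv_iff: "classKinf g \<Longrightarrow> 0 \<le> x \<Longrightarrow> 0 \<le> y \<Longrightarrow> x < Kinv g y \<longleftrightarrow> g x < y"
  using Kinv_le_iff[of g x y] by linarith

lemma Kinv_classKinf:
  assumes g: "classKinf g"
  shows "classKinf (Kinv g)"
  unfolding classKinf_def classK_def
proof (intro conjI)
  have K: "classK g" using g by (rule classKinf_classK)
  show "Kinv g 0 = 0" using Kinv_cancel[OF g, of 0] classK_zero[OF K] by simp
  show "strict_mono_on {0..} (Kinv g)"
    by (rule strict_mono_onI) (simp add: Kinv_less_iff g Kinv_Kinf Kinv_nonneg)
  show "filterlim (Kinv g) at_top at_top"
    unfolding filterlim_at_top_ge[where c=0]
  proof (intro allI impI)
    fix Z :: real assume "0 \<le> Z"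
    show "\<forall>\<^sub>F x in at_top. Z \<le> Kinv g x"
      using eventually_gt_at_top[of "g Z"]
    proof eventually_elim
      case (elim x)
      then show ?case
        using less_Kinv_iff[OF g \<open>0 \<le> Z\<close>, of x] classK_nonneg[OF K \<open>0 \<le> Z\<close>] by simp
    qed
  qed
  have "g ` {0..} = {0..}"
    by (auto simp: classK_nonneg[OF K]) (metis atLeast_iff classKinf_surj[OF g] image_eqI)
  moreover have "inj_on g {0..}"
    using classK_le_iff[OF K] by (intro inj_onI) (metis antisym atLeast_iff order_refl)
  ultimately obtain h where h: "homeomorphism {0..} {0..} g h"
    using homeomorphism_into_1d[OF convex_imp_path_connected[OF convex_real_interval(1)] classK_cont[OF K]] by blast
  then have "h y = Kinv g y" if "y \<in> {0..}" for y
    using that Kinv_cancel[OF g, of "h y"] by (metis atLeast_iff homeomorphism_def imageI)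
  then show "continuous_on {0..} (Kinv g)"
    using h by (metis continuous_on_cong homeomorphism_cont2)
qed

lemma classK_add: "classK f \<Longrightarrow> classK g \<Longrightarrow> classK (\<lambda>x. f x + g x)"
  using classK_less[of f] classK_less[of g] unfolding classK_def
  by (auto intro!: continuous_on_add strict_mono_onI add_strict_mono)

lemma classKinf_add: "classKinf f \<Longrightarrow> classK g \<Longrightarrow> classKinf (\<lambda>x. f x + g x)"
  unfolding classKinf_def
proof (intro conjI)
  assume f: "classK f \<and> filterlim f at_top at_top" and g: "classK g"
  show "classK (\<lambda>x. f x + g x)" using f g by (blast intro: classK_add)
  have "\<forall>\<^sub>F x in at_top. f x \<le> f x + g x"
    using eventually_ge_at_top[of 0] by eventually_elim (simp add: classK_nonneg[OF g])
  then show "filterlim (\<lambda>x. f x + g x) at_top at_top"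
    by (rule filterlim_at_top_mono[OF conjunct2[OF f]])
qed

lemma classKinf_id: "classKinf (\<lambda>x. x)"
  unfolding classKinf_def classK_def by (auto intro!: strict_mono_onI filterlim_ident)

lemma classKinf_cmult: "0 < c \<Longrightarrow> classKinf (\<lambda>x. c * x)"
  unfolding classKinf_def classK_def
  using filterlim_tendsto_pos_mult_at_top[OF tendsto_const _ filterlim_ident]
  by (auto intro!: strict_mono_onI continuous_on_mult_left continuous_on_id)

lemma classKinf_min:
  assumes "classKinf f" "classKinf g" shows "classKinf (\<lambda>x. min (f x) (g x))"
  unfolding classKinf_def classK_def
proof (intro conjI)
  have K: "classK f" "classK g" using assms by (auto intro: classKinf_classK)
  show "continuous_on {0..} (\<lambda>x. min (f x) (g x))" by (intro continuous_intros classK_cont K)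
  show "strict_mono_on {0..} (\<lambda>x. min (f x) (g x))"
    by (intro strict_mono_onI) (use classK_less[OF K(1)] classK_less[OF K(2)] in \<open>auto simp: min_less_iff_disj intro: less_trans\<close>)
  show "min (f 0) (g 0) = 0" by (simp add: K classK_zero)
  show "filterlim (\<lambda>x. min (f x) (g x)) at_top at_top"
    using assms unfolding classKinf_def filterlim_at_top by (auto intro: eventually_conj)
qed

lemma pos_if_strict_mono_tendsto_0:
  fixes f :: "real \<Rightarrow> real"
  assumes mono: "strict_mono_on {0<..} f" and lim: "(f \<longlongrightarrow> 0) (at_right 0)" and "0 < s"
  shows "0 < f s"
proof -
  have "f t < f (s / 2)" if "0 < t" "t < s / 2" for t using strict_mono_onD[OF mono] that by simp
  then have "\<forall>\<^sub>F t in at_right 0. f t \<le> f (s / 2)"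
    using \<open>0 < s\<close> by (intro eventually_at_rightI[of 0 "s / 2"]) (auto simp: less_imp_le)
  then have "0 \<le> f (s / 2)" by (rule tendsto_upperbound[OF lim]) simp
  also have "\<dots> < f s" using \<open>0 < s\<close> by (intro strict_mono_onD[OF mono]) auto
  finally show ?thesis .
qed

lemma classKinf_extend_0:
  fixes f :: "real \<Rightarrow> real"
  assumes cont: "continuous_on {0<..} f" and mono: "strict_mono_on {0<..} f"
    and lim: "(f \<longlongrightarrow> 0) (at_right 0)" and top: "filterlim f at_top at_top"
  shows "classKinf (\<lambda>s. if s \<le> 0 then 0 else f s)"
  unfolding classKinf_def classK_def
proof (intro conjI)
  let ?h = "\<lambda>s. if s \<le> 0 then 0 else f s"
  show "strict_mono_on {0..} ?h"
    by (intro strict_mono_onI) (auto simp: strict_mono_onD[OF mono] pos_if_strict_mono_tendsto_0[OF mono lim])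
  show "continuous_on {0..} ?h"
    unfolding continuous_on_def
  proof
    fix x :: real assume "x \<in> {0..}"
    then consider (zero) "x = 0" | (pos) "0 < x" by fastforce
    then show "(?h \<longlongrightarrow> ?h x) (at x within {0..})"
    proof cases
      case zero
      have "\<forall>\<^sub>F s in at_right 0. f s = ?h s"
        using eventually_at_right_less[of 0] by eventually_elim simp
      then show ?thesis using Lim_transform_eventually[OF lim] zero by (simp add: at_within_Ici_at_right)
    next
      case pos
      have "\<forall>\<^sub>F s in nhds x. f s = ?h s"
        using eventually_nhds_in_open[of "{0<..}" x] pos by (auto elim!: eventually_mono)
      moreover have "isCont f x" using cont pos continuous_on_eq_continuous_at[of "{0<..}" f] by simp
      ultimately have "isCont ?h x" by (simp only: isCont_cong)
      then show ?thesis
        by (simp add: continuous_at_imp_continuous_within continuous_within[symmetric] isCont_def Lim_at_imp_Lim_at_within)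
    qed
  qed
  show "filterlim ?h at_top at_top"
    using top by (rule filterlim_mono_eventually[OF _ order_refl order_refl])
      (auto intro: eventually_mono[OF eventually_gt_at_top[of 0]])
qed simp

lemma classK_finite_upper:
  assumes "finite I" "\<And>i. i \<in> I \<Longrightarrow> classK (f i)"
  obtains \<psi> where "classK \<psi>" "\<And>i r. i \<in> I \<Longrightarrow> 0 \<le> r \<Longrightarrow> f i r \<le> \<psi> r"
  using assms
proof (induction I arbitrary: thesis rule: finite_induct)
  case empty
  then show ?case using classKinf_classK[OF classKinf_id] by auto
next
  case (insert i I)
  then obtain \<psi> where "classK \<psi>" "\<And>j r. j \<in> I \<Longrightarrow> 0 \<le> r \<Longrightarrow> f j r \<le> \<psi> r" by blast
  moreover have "classK (f i)" using insert.prems by simp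
  ultimately show ?case
    by (intro insert.prems(1)[of "\<lambda>r. \<psi> r + f i r"])
       (auto intro: classK_add simp: classK_nonneg intro: add_increasing2)
qed

lemma classKinf_finite_upper:
  assumes "finite I" "\<And>i. i \<in> I \<Longrightarrow> classKinf (f i)"
  obtains \<psi> where "classKinf \<psi>" "\<And>i r. i \<in> I \<Longrightarrow> 0 \<le> r \<Longrightarrow> f i r \<le> \<psi> r"
proof -
  obtain \<psi> where \<psi>: "classK \<psi>" "\<And>i r. i \<in> I \<Longrightarrow> 0 \<le> r \<Longrightarrow> f i r \<le> \<psi> r"
    using classK_finite_upper[of I f] assms classKinf_classK by blast
  show ?thesis
    by (rule that[of "\<lambda>r. r + \<psi> r"]) (use \<psi> in \<open>auto intro: classKinf_add classKinf_id add_increasing\<close>)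
qed

lemma classKinf_finite_lower:
  assumes "finite I" "\<And>i. i \<in> I \<Longrightarrow> classKinf (f i)"
  obtains \<psi> where "classKinf \<psi>" "\<And>i r. i \<in> I \<Longrightarrow> 0 \<le> r \<Longrightarrow> \<psi> r \<le> f i r"
  using assms
proof (induction I arbitrary: thesis rule: finite_induct)
  case empty
  then show ?case using classKinf_id by auto
next
  case (insert i I)
  then obtain \<psi> where "classKinf \<psi>" "\<And>j r. j \<in> I \<Longrightarrow> 0 \<le> r \<Longrightarrow> \<psi> r \<le> f j r" by blast
  moreover have "classKinf (f i)" using insert.prems by simp
  ultimately show ?case
    by (intro insert.prems(1)[of "\<lambda>r. min (\<psi> r) (f i r)"]) (auto intro: classKinf_min simp: min_le_iff_disj)
qed

lemma gain_function_le: "classKinf g \<or> zero_gain g \<Longrightarrow> 0 \<le> x \<Longrightarrow> x \<le> y \<Longrightarrow> g x \<le> g y"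
  using classK_le[OF classKinf_classK, of g x y] by (auto simp: zero_gain_def)

lemma gain_function_nonneg: "classKinf g \<or> zero_gain g \<Longrightarrow> 0 \<le> x \<Longrightarrow> 0 \<le> g x"
  using classK_nonneg[OF classKinf_classK, of g x] by (auto simp: zero_gain_def)

lemma gain_function_continuous:
  assumes "classKinf g \<or> zero_gain g"
  shows "continuous_on {0..} g"
proof (cases "zero_gain g")
  case True
  then have "continuous_on {0..} g \<longleftrightarrow> continuous_on {0..} (\<lambda>x::real. 0::real)"
    by (intro continuous_on_cong) (auto simp: zero_gain_def)
  then show ?thesis by simp
qed (use assms classK_cont classKinf_classK in blast)

lemma isCont_clamp:
  assumes "continuous_on {0..} (g :: real \<Rightarrow> real)"
  shows "isCont (\<lambda>x. g (max 0 x)) x"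
proof -
  have "continuous_on UNIV (\<lambda>x. g (max 0 x))"
    by (intro continuous_on_compose2[OF assms] continuous_intros) auto
  then show ?thesis by (simp add: continuous_on_eq_continuous_at)
qed

lemma posdef_pos: "posdef \<rho> \<Longrightarrow> 0 < r \<Longrightarrow> 0 < \<rho> r"
  unfolding posdef_def by (metis less_eq_real_def order_less_irrefl)

lemma posdef_continuous_on: "posdef \<rho> \<Longrightarrow> S \<subseteq> {0..} \<Longrightarrow> continuous_on S \<rho>"
  unfolding posdef_def using continuous_on_subset by blast

lemma posdef_bounded_below:
  assumes "posdef \<rho>" "0 < a"
  obtains e where "0 < e" "\<And>r. r \<in> {a..b} \<Longrightarrow> e \<le> \<rho> r"
proof (cases "a \<le> b")
  case True
  have "continuous_on {a..b} \<rho>" using assms by (intro posdef_continuous_on) auto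
  then obtain m where "m \<in> {a..b}" "\<And>r. r \<in> {a..b} \<Longrightarrow> \<rho> m \<le> \<rho> r"
    using continuous_attains_inf[of "{a..b}" \<rho>] True by auto
  then show ?thesis using that[of "\<rho> m"] posdef_pos[OF assms(1), of m] assms(2) by auto
qed (use that[of 1] in auto)

lemma exists_locally_bounded_below_rate:
  fixes P :: "real \<Rightarrow> real \<Rightarrow> bool"
  assumes mono: "\<And>r e e'. P r e \<Longrightarrow> 0 < e' \<Longrightarrow> e' \<le> e \<Longrightarrow> P r e'"
    and loc: "\<And>a b. 0 < a \<Longrightarrow> a \<le> b \<Longrightarrow> \<exists>e>0. \<forall>r\<in>{a..b}. P r e"
  obtains m where "\<And>r. 0 < r \<Longrightarrow> 0 < m r \<and> m r \<le> r \<and> P r (m r)"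
    "\<And>a b. 0 < a \<Longrightarrow> \<exists>e>0. \<forall>r\<in>{a..b}. e \<le> m r"
proof -
  have "\<exists>e>0. \<forall>r\<in>{1 / (real k + 1)..real k + 1}. P r e" for k :: nat
    by (intro loc) (auto simp: field_simps)
  then obtain e where e: "\<And>k. 0 < e k" "\<And>k r. r \<in> {1 / (real k + 1)..real k + 1} \<Longrightarrow> P r (e k)"
    by metis
  define k where "k = (\<lambda>r::real. nat \<lceil>max r (1 / r)\<rceil>)"
  define E where "E = (\<lambda>j. Min (e ` {..j}))"
  have E_pos: "0 < E j" for j using e(1) by (auto simp: E_def Min_gr_iff)
  have E_antimono: "E j \<le> E i" if "i \<le> j" for i j
    unfolding E_def using that by (intro Min_antimono) auto
  have E_le: "E j \<le> e j" for j unfolding E_def by (intro Min_le) auto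
  show ?thesis
  proof (rule that[of "\<lambda>r. min r (E (k r))"])
    fix r :: real assume r: "0 < r"
    have k: "r \<le> real (k r)" "1 / r \<le> real (k r)"
      unfolding k_def using real_nat_ceiling_ge[of "max r (1 / r)"] by auto
    then have "P r (e (k r))" using r by (intro e(2)) (auto simp: field_simps)
    then show "0 < min r (E (k r)) \<and> min r (E (k r)) \<le> r \<and> P r (min r (E (k r)))"
      using mono[of r "e (k r)" "min r (E (k r))"] r E_pos[of "k r"] E_le[of "k r"] by auto
  next
    fix a b :: real assume a: "0 < a"
    define K where "K = nat \<lceil>max b (1 / a)\<rceil>"
    have "min a (E K) \<le> min r (E (k r))" if r: "r \<in> {a..b}" for r
    proof -
      have "max r (1 / r) \<le> max b (1 / a)" using r a by (intro max.mono) (auto intro: divide_left_mono)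
      then have "k r \<le> K" unfolding k_def K_def by (intro nat_mono ceiling_mono)
      then show ?thesis using E_antimono r by (intro min.mono) auto
    qed
    then show "\<exists>e>0. \<forall>r\<in>{a..b}. e \<le> min r (E (k r))" using a E_pos[of K] by (intro exI[of _ "min a (E K)"]) auto
  qed
qed

lemma posdef_lipschitz_envelope:
  fixes m :: "real \<Rightarrow> real"
  assumes m: "\<And>r. 0 < r \<Longrightarrow> 0 < m r \<and> m r \<le> r"
    and bounded_below: "\<And>a b. 0 < a \<Longrightarrow> \<exists>e>0. \<forall>r\<in>{a..b}. e \<le> m r"
  shows "posdef (lipschitz_envelope 1 {0<..} m)"
    and "0 < r \<Longrightarrow> lipschitz_envelope 1 {0<..} m r \<le> m r"
proof -
  let ?q = "lipschitz_envelope 1 {0<..} m"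
  have bdd: "bdd_below ((\<lambda>s. m s + 1 * dist r s) ` {0<..})" for r
    by (intro bdd_belowI2[of _ 0] add_nonneg_nonneg less_imp_le[OF conjunct1[OF m]]) auto
  have envelope_le: "?q r \<le> m s + \<bar>r - s\<bar>" if "0 < s" for r s
    using lipschitz_envelope_le[OF bdd, of s r] that by (simp add: dist_real_def)
  show "?q r \<le> m r" if "0 < r" for r using envelope_le[OF that, of r] by simp
  have nonneg: "0 \<le> ?q r" for r
    by (intro lipschitz_envelope_greatest add_nonneg_nonneg less_imp_le[OF conjunct1[OF m]]) auto
  have pos: "0 < ?q r" if r: "0 < r" for r
  proof -
    obtain e where e: "0 < e" "\<And>s. s \<in> {r / 2..2 * r} \<Longrightarrow> e \<le> m s"
      using bounded_below[of "r / 2" "2 * r"] r by auto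
    have "min e (r / 2) \<le> ?q r"
    proof (rule lipschitz_envelope_greatest)
      fix s :: real assume "s \<in> {0<..}"
      then show "min e (r / 2) \<le> m s + 1 * dist r s"
        using e(2)[of s] m[of s] by (cases "s \<in> {r / 2..2 * r}") (auto simp: dist_real_def)
    qed simp
    then show ?thesis using e(1) r by (meson half_gt_zero min_less_iff_conj order_less_le_trans)
  qed
  have "?q 0 \<le> e" if "0 < e" for e
    using envelope_le[of "e / 2" 0] m[of "e / 2"] that by simp
  then have "?q 0 = 0" using nonneg[of 0] by (meson antisym dense_ge)
  moreover have "continuous_on {0..} ?q"
    using lipschitz_on_continuous_on[OF lipschitz_on_lipschitz_envelope[OF bdd]] by (auto intro: continuous_on_subset)
  ultimately show "posdef ?q"
    unfolding posdef_def using nonneg pos by (metis less_eq_real_def order_less_irrefl)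
qed

lemma posdef_minorant:
  fixes P :: "real \<Rightarrow> real \<Rightarrow> bool"
  assumes mono: "\<And>r e e'. P r e \<Longrightarrow> 0 < e' \<Longrightarrow> e' \<le> e \<Longrightarrow> P r e'"
    and loc: "\<And>a b. 0 < a \<Longrightarrow> a \<le> b \<Longrightarrow> \<exists>e>0. \<forall>r\<in>{a..b}. P r e"
  obtains q where "posdef q" "\<And>r. 0 < r \<Longrightarrow> P r (q r) \<and> q r \<le> r"
proof -
  obtain m where m: "\<And>r. 0 < r \<Longrightarrow> 0 < m r \<and> m r \<le> r \<and> P r (m r)"
    "\<And>a b. 0 < a \<Longrightarrow> \<exists>e>0. \<forall>r\<in>{a..b}. e \<le> m r"
    using exists_locally_bounded_below_rate[of P] mono loc by blast
  let ?q = "lipschitz_envelope 1 {0<..} m"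
  have q: "posdef ?q" and envelope_le: "\<And>r. 0 < r \<Longrightarrow> ?q r \<le> m r"
    using posdef_lipschitz_envelope[of m, OF _ m(2)] m(1) by blast+
  have "P r (?q r) \<and> ?q r \<le> r" if "0 < r" for r
    using mono[of r "m r" "?q r"] m(1)[OF that] envelope_le[OF that] posdef_pos[OF q that] by auto
  with q that show ?thesis by blast
qed

definition positive_slopes :: "(real \<Rightarrow> real) \<Rightarrow> bool" where
  "positive_slopes f \<longleftrightarrow> (\<forall>a b. 0 < a \<longrightarrow> a \<le> b \<longrightarrow> (\<exists>c>0. slope_ge c {a..b} f))"

definition finite_slopes :: "(real \<Rightarrow> real) \<Rightarrow> bool" where
  "finite_slopes f \<longleftrightarrow> (\<forall>a b. 0 < a \<longrightarrow> a \<le> b \<longrightarrow> (\<exists>C>0. slope_le C {a..b} f))"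

lemma locLip_if_finite_slopes:
  assumes mono: "mono_on {0<..} f" and f: "finite_slopes f"
  shows "locLip {0<..} f"
  unfolding locLip_open_iff[OF open_greaterThan]
proof
  fix x :: real assume "x \<in> {0<..}"
  then have "0 < x / 2" "x / 2 \<le> 2 * x" "0 < x" by auto
  then obtain C where C: "0 < C" "slope_le C {x / 2..2 * x} f"
    using f unfolding finite_slopes_def by blast
  have "C-lipschitz_on (ball x (x / 2)) f"
  proof (rule lipschitz_on_leI)
    fix u v assume "u \<in> ball x (x / 2)" "v \<in> ball x (x / 2)" and "u \<le> v"
    then have "x / 2 \<le> u" "v \<le> 2 * x" unfolding mem_ball dist_real_def by linarith+
    then show "dist (f u) (f v) \<le> C * dist u v"
      using slope_leD[OF C(2), of u v] mono_onD[OF mono, of u v] \<open>0 < x\<close> \<open>u \<le> v\<close> by (simp add: dist_real_def)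
  qed (use C in simp)
  then show "lipschitz_near f x" using \<open>0 < x\<close> by (intro lipschitz_nearI[of "x / 2"]) auto
qed

lemma Kinv_slopes:
  assumes K: "classKinf \<sigma>"
  shows "finite_slopes \<sigma> \<Longrightarrow> positive_slopes (Kinv \<sigma>)" and "positive_slopes \<sigma> \<Longrightarrow> finite_slopes (Kinv \<sigma>)"
proof -
  note K' = classKinf_classK[OF Kinv_classKinf[OF K]]
  have interval: "0 < Kinv \<sigma> a" "Kinv \<sigma> a \<le> Kinv \<sigma> b" if "0 < a" "a \<le> b" for a b
    using that by (auto intro: classK_pos[OF K'] classK_le[OF K'])
  have range: "Kinv \<sigma> u \<in> {Kinv \<sigma> a..Kinv \<sigma> b}" if "0 < a" "u \<in> {a..b}" for a b u
    using that by (auto intro: classK_le[OF K'])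
  show "positive_slopes (Kinv \<sigma>)" if \<sigma>: "finite_slopes \<sigma>"
    unfolding positive_slopes_def
  proof (intro allI impI)
    fix a b :: real assume ab: "0 < a" "a \<le> b"
    obtain C where C: "0 < C" "slope_le C {Kinv \<sigma> a..Kinv \<sigma> b} \<sigma>"
      using \<sigma> interval[OF ab] unfolding finite_slopes_def by blast
    have "slope_ge (1 / C) {a..b} (Kinv \<sigma>)"
      unfolding slope_ge_def
      using slope_leD[OF C(2) range[OF ab(1)] range[OF ab(1)]] C(1) ab
      by (auto simp: Kinv_Kinf[OF K] classK_le[OF K'] field_simps)
    then show "\<exists>c>0. slope_ge c {a..b} (Kinv \<sigma>)" using C(1) by (intro exI[of _ "1 / C"]) auto
  qed
  show "finite_slopes (Kinv \<sigma>)" if \<sigma>: "positive_slopes \<sigma>"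
    unfolding finite_slopes_def
  proof (intro allI impI)
    fix a b :: real assume ab: "0 < a" "a \<le> b"
    obtain c where c: "0 < c" "slope_ge c {Kinv \<sigma> a..Kinv \<sigma> b} \<sigma>"
      using \<sigma> interval[OF ab] unfolding positive_slopes_def by blast
    have "slope_le (1 / c) {a..b} (Kinv \<sigma>)"
      unfolding slope_le_def
      using slope_geD[OF c(2) range[OF ab(1)] range[OF ab(1)]] c(1) ab
      by (auto simp: Kinv_Kinf[OF K] classK_le[OF K'] field_simps)
    then show "\<exists>C>0. slope_le C {a..b} (Kinv \<sigma>)" using c(1) by (intro exI[of _ "1 / c"]) auto
  qed
qed

lemma positive_slopes_if_derivative_ge:
  assumes lip: "locLip {0<..} \<tau>"
    and deriv: "\<And>P. compact P \<Longrightarrow> P \<subseteq> {0<..} \<Longrightarrow> \<exists>c>0. \<forall>r\<in>P. \<forall>d. (\<tau> has_real_derivative d) (at r) \<longrightarrow> c \<le> d"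
  shows "positive_slopes \<tau>"
  unfolding positive_slopes_def
proof (intro allI impI)
  fix a b :: real assume ab: "0 < a" "a \<le> b"
  obtain c where c: "0 < c" "\<And>r d. r \<in> {a..b} \<Longrightarrow> (\<tau> has_real_derivative d) (at r) \<Longrightarrow> c \<le> d"
    using deriv[of "{a..b}"] ab by (auto simp: subset_iff)
  obtain L where "L-lipschitz_on {a..b} \<tau>"
    by (rule locLip_compact_imp_lipschitz[OF compact_Icc locLip_subset[OF lip]]) (use ab in auto)
  then have L: "L-lipschitz_on {a..b} (\<lambda>t. - \<tau> t)" by simp
  have "c * (y - x) \<le> \<tau> y - \<tau> x" if xy: "x \<in> {a..b}" "y \<in> {a..b}" "x \<le> y" for x y
  proof -
    have "- \<tau> y - - \<tau> x \<le> (- c) * (y - x)"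
    proof (rule lipschitz_real_increment_le[OF lipschitz_on_subset[OF L] xy(3)])
      show "AE t in lborel. x < t \<longrightarrow> t < y \<longrightarrow> (\<forall>d. ((\<lambda>t. - \<tau> t) has_real_derivative d) (at t) \<longrightarrow> d \<le> - c)"
      proof (intro AE_I2 impI allI)
        fix t d assume t: "x < t" "t < y" and "((\<lambda>t. - \<tau> t) has_real_derivative d) (at t)"
        then have "(\<tau> has_real_derivative - d) (at t)" using DERIV_minus by fastforce
        then show "d \<le> - c" using c(2)[of t "- d"] t xy by auto
      qed
    qed (use xy in auto)
    then show ?thesis by (simp add: algebra_simps)
  qed
  then show "\<exists>c>0. slope_ge c {a..b} \<tau>" using c(1) unfolding slope_ge_def by blast
qed

section \<open>Existence of paths of strict decrease\<close>

lemma tendsto_Max_image: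
  fixes f :: "'i \<Rightarrow> 'z \<Rightarrow> real"
  assumes "finite I" "I \<noteq> {}" "\<And>j. j \<in> I \<Longrightarrow> (f j \<longlongrightarrow> l j) F"
  shows "((\<lambda>z. Max ((\<lambda>j. f j z) ` I)) \<longlongrightarrow> Max (l ` I)) F"
  using assms
proof (induction I rule: finite_ne_induct)
  case (insert j I)
  have "((\<lambda>z. max (f j z) (Max ((\<lambda>j. f j z) ` I))) \<longlongrightarrow> max (l j) (Max (l ` I))) F"
    using insert by (intro tendsto_max) auto
  then show ?case using insert by simp
qed simp

lemma Max_image_mono:
  fixes f g :: "'i \<Rightarrow> real"
  assumes "finite I" "I \<noteq> {}" "\<And>j. j \<in> I \<Longrightarrow> f j \<le> g j"
  shows "Max (f ` I) \<le> Max (g ` I)"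
  using assms by (auto intro!: Max.boundedI intro: order_trans[OF _ Max_ge])

text \<open>The comparison functions are only specified on \<open>{0..}\<close>; clamping their arguments makes
  \<open>\<Gamma>\<close> and \<open>M = D\<^sub>\<alpha> \<circ> \<Gamma>\<close> continuous and monotone on all vectors.\<close>

locale mixed_gains =
  fixes n :: nat and Isum :: "nat set" and \<gamma> :: "nat \<Rightarrow> nat \<Rightarrow> real \<Rightarrow> real" and \<alpha> :: "real \<Rightarrow> real"
  assumes n_pos: "0 < n"
    and gains: "\<And>i j. i < n \<Longrightarrow> j < n \<Longrightarrow> classKinf (\<gamma> i j) \<or> zero_gain (\<gamma> i j)"
    and irred: "gain_irreducible n \<gamma>"
    and alpha: "classKinf \<alpha>"
    and small_gain: "\<And>s. (\<forall>i<n. 0 \<le> s i) \<Longrightarrow> (\<exists>i<n. s i \<noteq> 0) \<Longrightarrow>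
                       (\<exists>i<n. gain_op n Isum \<gamma> (Dalpha Isum \<alpha> s) i < s i)"
begin

definition \<Gamma> :: "(nat \<Rightarrow> real) \<Rightarrow> nat \<Rightarrow> real" where
  "\<Gamma> s = gain_op n Isum \<gamma> (\<lambda>j. max 0 (s j))"

definition M :: "(nat \<Rightarrow> real) \<Rightarrow> nat \<Rightarrow> real" where
  "M s = Dalpha Isum (\<lambda>r. \<alpha> (max 0 r)) (\<Gamma> s)"

lemma gain_mono: "i < n \<Longrightarrow> j < n \<Longrightarrow> 0 \<le> x \<Longrightarrow> x \<le> y \<Longrightarrow> \<gamma> i j x \<le> \<gamma> i j y"
  using gain_function_le[OF gains] .

lemma gain_nonneg: "i < n \<Longrightarrow> j < n \<Longrightarrow> 0 \<le> x \<Longrightarrow> 0 \<le> \<gamma> i j x"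
  using gain_function_nonneg[OF gains] .

lemma zero_gain_or_less: "i < n \<Longrightarrow> j < n \<Longrightarrow> 0 \<le> x \<Longrightarrow> x < y \<Longrightarrow> zero_gain (\<gamma> i j) \<or> \<gamma> i j x < \<gamma> i j y"
  using gains[of i j] classK_less[OF classKinf_classK, of "\<gamma> i j" x y] by blast

lemma gain_cont: "i < n \<Longrightarrow> j < n \<Longrightarrow> isCont (\<lambda>x. \<gamma> i j (max 0 x)) x"
  by (intro isCont_clamp gain_function_continuous gains)

lemma alpha_cont: "isCont (\<lambda>x. \<alpha> (max 0 x)) x"
  by (intro isCont_clamp classK_cont classKinf_classK alpha)

lemma M_tendsto:
  assumes i: "i < n" and s: "\<And>j. j < n \<Longrightarrow> ((\<lambda>z. s z j) \<longlongrightarrow> l j) F"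
  shows "((\<lambda>z. M (s z) i) \<longlongrightarrow> M l i) F"
proof -
  have g: "((\<lambda>z. \<gamma> i j (max 0 (s z j))) \<longlongrightarrow> \<gamma> i j (max 0 (l j))) F" if "j < n" for j
    by (rule isCont_tendsto_compose[OF gain_cont[OF i that] s[OF that]])
  have "((\<lambda>z. \<Gamma> (s z) i) \<longlongrightarrow> \<Gamma> l i) F"
    unfolding \<Gamma>_def gain_op_def using g n_pos
    by (auto intro!: tendsto_sum tendsto_Max_image)
  then show ?thesis
    unfolding M_def Dalpha_def
    by (auto intro!: tendsto_add isCont_tendsto_compose[OF alpha_cont])
qed

lemma M_continuous_on:
  assumes "i < n" "\<And>j. j < n \<Longrightarrow> continuous_on S (\<lambda>z. s z j)"
  shows "continuous_on S (\<lambda>z. M (s z) i)"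
  using assms unfolding continuous_on_def by (auto intro!: M_tendsto)

lemma \<Gamma>_mono: "i < n \<Longrightarrow> (\<And>j. j < n \<Longrightarrow> s j \<le> t j) \<Longrightarrow> \<Gamma> s i \<le> \<Gamma> t i"
  unfolding \<Gamma>_def gain_op_def using n_pos
  by (auto intro!: sum_mono Max_image_mono gain_mono max.mono)

lemma \<Gamma>_nonneg: "i < n \<Longrightarrow> 0 \<le> \<Gamma> s i"
  unfolding \<Gamma>_def gain_op_def using n_pos
  by (auto intro!: sum_nonneg gain_nonneg simp: Max_ge_iff lessThan_empty_iff)

lemma D_le_iff: "0 \<le> x \<Longrightarrow> 0 \<le> y \<Longrightarrow> x + \<alpha> (max 0 x) \<le> y + \<alpha> (max 0 y) \<longleftrightarrow> x \<le> y"
  using classK_le_iff[OF classK_add[OF classKinf_classK[OF classKinf_id] classKinf_classK[OF alpha]], of x y] by simp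

lemma D_less_iff: "0 \<le> x \<Longrightarrow> 0 \<le> y \<Longrightarrow> x + \<alpha> (max 0 x) < y + \<alpha> (max 0 y) \<longleftrightarrow> x < y"
  using D_le_iff[of y x] by (simp add: not_le[symmetric])

lemma M_mono: "i < n \<Longrightarrow> (\<And>j. j < n \<Longrightarrow> s j \<le> t j) \<Longrightarrow> M s i \<le> M t i"
  using \<Gamma>_mono[of i s t] \<Gamma>_nonneg[of i s] \<Gamma>_nonneg[of i t] D_le_iff[of "\<Gamma> s i" "\<Gamma> t i"]
  by (auto simp: M_def Dalpha_def)

lemma M_ge_\<Gamma>: "i < n \<Longrightarrow> \<Gamma> s i \<le> M s i"
  using \<Gamma>_nonneg[of i s] classK_nonneg[OF classKinf_classK[OF alpha], of "\<Gamma> s i"] by (auto simp: M_def Dalpha_def)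

lemma M_nonneg: "i < n \<Longrightarrow> 0 \<le> M s i"
  using M_ge_\<Gamma>[of i s] \<Gamma>_nonneg[of i s] by linarith

lemma \<Gamma>_eq: "(\<And>j. j < n \<Longrightarrow> 0 \<le> s j) \<Longrightarrow> i < n \<Longrightarrow> \<Gamma> s i = gain_op n Isum \<gamma> s i"
  unfolding \<Gamma>_def gain_op_def
  by (auto intro!: sum.cong arg_cong[where f=Max] image_cong simp: max_def)

lemma M_eq: "(\<And>j. j < n \<Longrightarrow> 0 \<le> s j) \<Longrightarrow> i < n \<Longrightarrow> M s i = Dalpha Isum \<alpha> (gain_op n Isum \<gamma> s) i"
  using \<Gamma>_nonneg[of i s] by (simp add: M_def Dalpha_def \<Gamma>_eq[symmetric] max_def)

lemma M_cong: "(\<And>j. j < n \<Longrightarrow> s j = t j) \<Longrightarrow> i < n \<Longrightarrow> M s i = M t i"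
  by (simp add: M_mono antisym)

lemma \<Gamma>_ge_gain:
  assumes ij: "i < n" "j < n" and "0 \<le> s j"
  shows "\<gamma> i j (s j) \<le> \<Gamma> s i"
proof -
  have "\<gamma> i j (max 0 (s j)) \<le> (\<Sum>j<n. \<gamma> i j (max 0 (s j)))"
    using ij by (intro member_le_sum) (auto intro: gain_nonneg)
  moreover have "\<gamma> i j (max 0 (s j)) \<le> Max ((\<lambda>j. \<gamma> i j (max 0 (s j))) ` {..<n})"
    using ij by (intro Max_ge) auto
  ultimately show ?thesis using \<open>0 \<le> s j\<close> unfolding \<Gamma>_def gain_op_def by (auto simp: max_def)
qed

lemma M_ge_gain: "i < n \<Longrightarrow> j < n \<Longrightarrow> 0 \<le> s j \<Longrightarrow> \<gamma> i j (s j) \<le> M s i"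
  using \<Gamma>_ge_gain M_ge_\<Gamma> order_trans by blast

lemma M_ge_imp_eq_0:
  assumes s: "\<And>i. i < n \<Longrightarrow> 0 \<le> s i" and ge: "\<And>i. i < n \<Longrightarrow> s i \<le> M s i" and "i < n"
  shows "s i = 0"
proof (rule ccontr)
  assume "s i \<noteq> 0"
  define w where "w = \<Gamma> s"
  have w: "0 \<le> w j" "Dalpha Isum \<alpha> w j = M s j" if "j < n" for j
    using \<Gamma>_nonneg[OF that, of s] by (simp_all add: w_def M_def Dalpha_def max_def)
  have "w i \<noteq> 0"
  proof
    assume "w i = 0"
    then have "M s i = 0" using classK_zero[OF classKinf_classK[OF alpha]] by (simp add: M_def Dalpha_def w_def)
    then show False using ge[OF \<open>i < n\<close>] s[OF \<open>i < n\<close>] \<open>s i \<noteq> 0\<close> by simp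
  qed
  then obtain k where k: "k < n" "gain_op n Isum \<gamma> (Dalpha Isum \<alpha> w) k < w k"
    using small_gain[of w] w(1) \<open>i < n\<close> by blast
  have "\<Gamma> s k \<le> \<Gamma> (Dalpha Isum \<alpha> w) k" using ge w(2) by (intro \<Gamma>_mono k) auto
  also have "\<dots> = gain_op n Isum \<gamma> (Dalpha Isum \<alpha> w) k" using w(2) M_nonneg k by (intro \<Gamma>_eq) auto
  finally show False using k by (simp add: w_def)
qed

end

definition scaled_simplex :: "'d set \<Rightarrow> real \<Rightarrow> (real^'d::finite) set" where
  "scaled_simplex K R = {x. (\<forall>j. 0 \<le> x $ j) \<and> (\<forall>j. j \<notin> K \<longrightarrow> x $ j = 0) \<and> (\<Sum>j\<in>K. x $ j) = R}"

lemma convex_scaled_simplex: "convex (scaled_simplex K R)"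
  unfolding convex_def scaled_simplex_def
  by (auto simp: sum.distrib simp flip: sum_distrib_left distrib_right)

lemma compact_scaled_simplex: "compact (scaled_simplex K R)"
proof -
  have "scaled_simplex K R = (\<Inter>j. {x. 0 \<le> x $ j}) \<inter> (\<Inter>j\<in>-K. {x. x $ j = 0}) \<inter> {x. (\<Sum>j\<in>K. x $ j) = R}"
    by (auto simp: scaled_simplex_def)
  also have "closed \<dots>"
    by (intro closed_Int closed_INT ballI closed_Collect_le closed_Collect_eq continuous_intros)
  finally have "closed (scaled_simplex K R)" .
  moreover have "bounded (scaled_simplex K R)"
  proof (rule boundedI)
    fix x assume x: "x \<in> scaled_simplex K R"
    have "norm x \<le> (\<Sum>j\<in>UNIV. \<bar>x $ j\<bar>)" by (rule norm_le_l1_cart)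
    also have "\<dots> = (\<Sum>j\<in>K. \<bar>x $ j\<bar>)"
      using x by (intro sum.mono_neutral_right) (auto simp: scaled_simplex_def)
    also have "\<dots> = R" using x by (simp add: scaled_simplex_def)
    finally show "norm x \<le> R" .
  qed
  ultimately show ?thesis by (simp add: compact_eq_bounded_closed)
qed

lemma scaled_simplex_nonempty:
  assumes "k \<in> K" "0 \<le> R"
  shows "scaled_simplex K R \<noteq> {}"
proof -
  have "(\<Sum>j\<in>K. axis k R $ j) = R" using \<open>k \<in> K\<close> by (simp add: axis_def sum.delta)
  then have "axis k R \<in> scaled_simplex K R" using assms by (auto simp: scaled_simplex_def axis_def)
  then show ?thesis by blast
qed

text \<open>Brouwer's theorem for the map that adds the excess \<open>e x\<close> to \<open>x\<close> and rescales to the simplex.\<close>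

lemma scaled_simplex_proportional_excess:
  fixes K :: "'d::finite set" and e :: "real^'d \<Rightarrow> 'd \<Rightarrow> real"
  assumes "0 < R" "K \<noteq> {}"
    and cont: "\<And>j. j \<in> K \<Longrightarrow> continuous_on UNIV (\<lambda>x. e x j)" and e: "\<And>x j. 0 \<le> e x j"
  obtains x where "x \<in> scaled_simplex K R" "\<And>j. j \<in> K \<Longrightarrow> R * e x j = (\<Sum>j\<in>K. e x j) * x $ j"
proof -
  define E where "E = (\<lambda>x. \<Sum>j\<in>K. e x j)"
  define \<Phi> where "\<Phi> = (\<lambda>x. \<chi> j. if j \<in> K then R * (x $ j + e x j) / (R + E x) else 0)"
  have pos: "0 < R + E x" for x using \<open>0 < R\<close> e by (simp add: E_def add_pos_nonneg sum_nonneg)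
  have "continuous_on UNIV E" unfolding E_def by (intro continuous_on_sum cont)
  then have "continuous_on UNIV (\<lambda>x. \<Phi> x $ j)" for j
    unfolding \<Phi>_def using pos
    by (cases "j \<in> K") (auto intro!: continuous_intros cont simp: less_imp_neq[THEN not_sym])
  then have "continuous_on (scaled_simplex K R) \<Phi>"
    using continuous_on_vec_lambda[of UNIV "\<lambda>j x. \<Phi> x $ j"] by (auto intro: continuous_on_subset)
  moreover have "\<Phi> \<in> scaled_simplex K R \<rightarrow> scaled_simplex K R"
  proof
    fix x :: "real^'d" assume x: "x \<in> scaled_simplex K R"
    have "(\<Sum>j\<in>K. \<Phi> x $ j) = R * ((\<Sum>j\<in>K. x $ j) + E x) / (R + E x)"
      by (simp add: \<Phi>_def E_def sum.distrib flip: sum_distrib_left sum_divide_distrib)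
    also have "\<dots> = R" using x pos[of x] by (simp add: scaled_simplex_def)
    finally show "\<Phi> x \<in> scaled_simplex K R"
      using x e pos[of x] \<open>0 < R\<close> by (auto simp: scaled_simplex_def \<Phi>_def intro!: divide_nonneg_pos)
  qed
  moreover have "scaled_simplex K R \<noteq> {}" using scaled_simplex_nonempty \<open>0 < R\<close> \<open>K \<noteq> {}\<close> by force
  ultimately obtain x where x: "x \<in> scaled_simplex K R" "\<Phi> x = x"
    using brouwer[OF compact_scaled_simplex convex_scaled_simplex] by metis
  have "R * e x j = E x * x $ j" if "j \<in> K" for j
  proof -
    have "R * (x $ j + e x j) / (R + E x) = x $ j" using arg_cong[OF x(2), of "\<lambda>x. x $ j"] that by (simp add: \<Phi>_def)
    then show ?thesis using pos[of x] by (simp add: divide_eq_eq algebra_simps)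
  qed
  then show ?thesis using that x(1) by (simp add: E_def)
qed

context mixed_gains
begin

definition subinvariant :: "(nat \<Rightarrow> real) \<Rightarrow> bool" where
  "subinvariant s \<longleftrightarrow> (\<forall>i<n. M s i \<le> s i)"

lemma subinvariantD: "subinvariant s \<Longrightarrow> i < n \<Longrightarrow> M s i \<le> s i"
  by (simp add: subinvariant_def)

lemma subinvariant_nonneg: "subinvariant s \<Longrightarrow> i < n \<Longrightarrow> 0 \<le> s i"
  using subinvariantD[of s i] M_nonneg[of i s] by linarith

lemma exists_subinvariant_of_sum:
  fixes k :: "nat \<Rightarrow> 'd::finite" and R :: real
  assumes inj: "inj_on k {..<n}" and "0 < R"
  obtains s where "subinvariant s" "(\<Sum>i<n. s i) = R"
proof -
  define idx where "idx = inv_into {..<n} k"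
  have idx: "idx (k i) = i" if "i < n" for i using inj that by (simp add: idx_def)
  have sum_k: "(\<Sum>j\<in>k ` {..<n}. f j) = (\<Sum>i<n. f (k i))" for f :: "'d \<Rightarrow> real" using inj by (simp add: sum.reindex)
  define v where "v = (\<lambda>(x::real^'d) i. x $ k i)"
  define e where "e = (\<lambda>x j. max 0 (M (v x) (idx j) - x $ j))"
  obtain x where x: "x \<in> scaled_simplex (k ` {..<n}) R"
    and excess: "\<And>j. j \<in> k ` {..<n} \<Longrightarrow> R * e x j = (\<Sum>j\<in>k ` {..<n}. e x j) * x $ j"
  proof (rule scaled_simplex_proportional_excess[of R "k ` {..<n}" e])
    show "continuous_on UNIV (\<lambda>x. e x j)" if "j \<in> k ` {..<n}" for j
      using that unfolding e_def v_def by (auto simp: idx intro!: continuous_intros M_continuous_on)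
  qed (use \<open>0 < R\<close> n_pos that in \<open>auto simp: e_def lessThan_empty_iff\<close>)
  have v_nonneg: "0 \<le> v x i" for i using x by (simp add: v_def scaled_simplex_def)
  have v_sum: "(\<Sum>i<n. v x i) = R" using x by (simp add: v_def scaled_simplex_def sum_k)
  define E where "E = (\<Sum>i<n. e x (k i))"
  have e_k: "R * e x (k i) = E * v x i" "e x (k i) = max 0 (M (v x) i - v x i)" if "i < n" for i
    using excess[of "k i"] that by (auto simp: E_def sum_k v_def e_def idx)
  have "0 \<le> E" by (simp add: E_def e_def sum_nonneg)
  have "E = 0"
  proof (rule ccontr)
    assume "E \<noteq> 0"
    have "v x i \<le> M (v x) i" if "i < n" for i
    proof (cases "v x i = 0")
      case False
      then have "0 < R * e x (k i)" using e_k(1)[OF that] \<open>0 \<le> E\<close> \<open>E \<noteq> 0\<close> v_nonneg[of i] by simp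
      then show ?thesis using e_k(2)[OF that] \<open>0 < R\<close> by (simp add: zero_less_mult_iff)
    qed (simp add: M_nonneg[OF that])
    then have "v x i = 0" if "i < n" for i using M_ge_imp_eq_0[of "v x"] v_nonneg that by blast
    then show False using v_sum \<open>0 < R\<close> by simp
  qed
  then have "max 0 (M (v x) i - v x i) = 0" if "i < n" for i
    using e_k[OF that] \<open>0 < R\<close> by simp
  then have "subinvariant (v x)"
    unfolding subinvariant_def by (metis diff_le_0_iff_le max.cobounded2)
  then show ?thesis using v_sum that by blast
qed

definition avg :: "(nat \<Rightarrow> real) \<Rightarrow> nat \<Rightarrow> real" where
  "avg s i = (s i + M s i) / 2"

lemma avg_cong: "(\<And>j. j < n \<Longrightarrow> s j = t j) \<Longrightarrow> i < n \<Longrightarrow> avg s i = avg t i"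
  using M_cong[of s t i] by (simp add: avg_def)

lemma avg_ge_half: "i < n \<Longrightarrow> s i / 2 \<le> avg s i"
  using M_nonneg[of i s] by (simp add: avg_def)

lemma avg_le: "subinvariant s \<Longrightarrow> i < n \<Longrightarrow> avg s i \<le> s i"
  and M_le_avg: "subinvariant s \<Longrightarrow> i < n \<Longrightarrow> M s i \<le> avg s i"
  using subinvariantD[of s i] by (simp_all add: avg_def)

lemma subinvariant_avg:
  assumes s: "subinvariant s"
  shows "subinvariant (avg s)"
  unfolding subinvariant_def
proof (intro allI impI)
  fix i assume "i < n"
  then have "M (avg s) i \<le> M s i" by (intro M_mono avg_le[OF s])
  then show "M (avg s) i \<le> avg s i" using M_le_avg[OF s \<open>i < n\<close>] by linarith
qed

lemma subinvariant_funpow_avg: "subinvariant s \<Longrightarrow> subinvariant ((avg ^^ k) s)"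
  by (induction k) (auto intro: subinvariant_avg)

lemma funpow_avg_ge: "i < n \<Longrightarrow> s i / 2 ^ k \<le> (avg ^^ k) s i"
proof (induction k)
  case (Suc k)
  have "s i / 2 ^ Suc k = (s i / 2 ^ k) / 2" by simp
  also have "\<dots> \<le> (avg ^^ k) s i / 2" using Suc by simp
  also have "\<dots> \<le> avg ((avg ^^ k) s) i" by (rule avg_ge_half[OF Suc.prems])
  finally show ?case by simp
qed simp

lemma funpow_avg_pos:
  assumes "i < n" "0 < s i"
  shows "0 < (avg ^^ k) s i"
proof -
  have "0 < s i / 2 ^ k" using assms(2) by simp
  then show ?thesis using funpow_avg_ge[OF assms(1), of s k] by linarith
qed

lemma avg_common_limit_eq_0:
  assumes x: "\<And>i. i < n \<Longrightarrow> (\<lambda>k. x k i) \<longlonglongrightarrow> l i" and avg: "\<And>i. i < n \<Longrightarrow> (\<lambda>k. avg (x k) i) \<longlonglongrightarrow> l i"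
    and nonneg: "\<And>k i. i < n \<Longrightarrow> 0 \<le> x k i" and "i < n"
  shows "l i = 0"
proof (rule M_ge_imp_eq_0)
  fix j assume j: "j < n"
  show "0 \<le> l j" by (rule LIMSEQ_le_const[OF x[OF j]]) (use nonneg[OF j] in blast)
  have "(\<lambda>k. avg (x k) j) \<longlonglongrightarrow> (l j + M l j) / 2"
    unfolding avg_def by (intro tendsto_divide tendsto_add tendsto_const M_tendsto x j) auto
  then have "(l j + M l j) / 2 = l j" using LIMSEQ_unique avg[OF j] by blast
  then show "l j \<le> M l j" by simp
qed fact

lemma funpow_avg_tendsto_0:
  assumes s: "subinvariant s" and "i < n"
  shows "(\<lambda>k. (avg ^^ k) s i) \<longlonglongrightarrow> 0"
proof -
  have "\<exists>l. (\<lambda>k. (avg ^^ k) s i) \<longlonglongrightarrow> l" if i: "i < n" for i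
  proof -
    have "decseq (\<lambda>k. (avg ^^ k) s i)"
      by (rule decseq_SucI) (simp add: avg_le[OF subinvariant_funpow_avg[OF s] i])
    then show ?thesis
      using decseq_convergent[of _ 0] subinvariant_nonneg[OF subinvariant_funpow_avg[OF s] i] by blast
  qed
  then obtain l where l: "\<And>i. i < n \<Longrightarrow> (\<lambda>k. (avg ^^ k) s i) \<longlonglongrightarrow> l i" by metis
  have "l i = 0"
  proof (rule avg_common_limit_eq_0[OF l])
    show "(\<lambda>k. avg ((avg ^^ k) s) i) \<longlonglongrightarrow> l i" if "i < n" for i using LIMSEQ_Suc[OF l[OF that]] by simp
  qed (use subinvariant_nonneg[OF subinvariant_funpow_avg[OF s]] \<open>i < n\<close> in auto)
  then show ?thesis using l[OF \<open>i < n\<close>] by simp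
qed

lemma subinvariant_pos:
  assumes y: "subinvariant y" and "i < n" "0 < y i" "j < n"
  shows "0 < y j"
proof -
  have "(j, i) \<in> {(i, j). i < n \<and> j < n \<and> \<not> zero_gain (\<gamma> i j)}\<^sup>*"
    using irred assms by (simp add: gain_irreducible_def)
  then show ?thesis
  proof (induction rule: converse_rtrancl_induct)
    case (step k l)
    then have kl: "k < n" "l < n" "classKinf (\<gamma> k l)" using gains[of k l] by auto
    have "0 < \<gamma> k l (y l)" by (rule classK_pos[OF classKinf_classK[OF kl(3)] step.IH])
    also have "\<dots> \<le> M y k" using kl step.IH by (intro M_ge_gain) auto
    also have "\<dots> \<le> y k" by (rule subinvariantD[OF y kl(1)])
    finally show ?case .
  qed fact
qed

lemma sum_gains_le_imp_zero_gain:
  assumes i: "i < n" and y': "\<And>j. j < n \<Longrightarrow> 0 \<le> y' j \<and> y' j \<le> y j"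
    and sum_le: "(\<Sum>j<n. \<gamma> i j (y j)) \<le> (\<Sum>j<n. \<gamma> i j (y' j))" and j: "j < n" "y' j < y j"
  shows "zero_gain (\<gamma> i j)"
proof (rule ccontr)
  assume "\<not> zero_gain (\<gamma> i j)"
  then have "\<gamma> i j (y' j) < \<gamma> i j (y j)" using zero_gain_or_less[OF i j(1)] y'[OF j(1)] j(2) by blast
  moreover have "\<gamma> i l (y' l) \<le> \<gamma> i l (y l)" if "l < n" for l using gain_mono[OF i that] y'[OF that] by blast
  ultimately have "(\<Sum>j<n. \<gamma> i j (y' j)) < (\<Sum>j<n. \<gamma> i j (y j))"
    using j(1) by (intro sum_strict_mono_ex1) auto
  then show False using sum_le by simp
qed

lemma \<Gamma>_le_restrict:
  assumes i: "i < n" and y': "\<And>j. j < n \<Longrightarrow> 0 \<le> y' j \<and> y' j \<le> y j"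
    and less: "\<And>j. j < n \<Longrightarrow> j \<notin> A \<Longrightarrow> y' j < y j" and \<Gamma>_le: "\<Gamma> y i \<le> \<Gamma> y' i"
  shows "\<Gamma> y i \<le> \<Gamma> (\<lambda>j. if j \<in> A then y j else 0) i"
proof -
  define z where "z = (\<lambda>j. if j \<in> A then y j else 0)"
  have y: "0 \<le> y j" if "j < n" for j using y'[OF that] by linarith
  have z: "0 \<le> z j" if "j < n" for j using y[OF that] by (simp add: z_def)
  have "\<Gamma> y i \<le> \<Gamma> z i"
  proof (cases "i \<in> Isum")
    case True
    then have sum: "\<Gamma> s i = (\<Sum>j<n. \<gamma> i j (s j))" if "\<And>j. j < n \<Longrightarrow> 0 \<le> s j" for s
      using \<Gamma>_eq[OF that i] by (simp add: gain_op_def)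
    have "zero_gain (\<gamma> i j)" if "j < n" "j \<notin> A" for j
      using \<Gamma>_le y y'
      by (intro sum_gains_le_imp_zero_gain[where y=y and y'=y', OF i y' _ that(1) less[OF that]]) (simp_all add: sum)
    then have "\<gamma> i j (y j) = \<gamma> i j (z j)" if "j < n" for j using y[OF that] that by (auto simp: z_def zero_gain_def)
    then have "(\<Sum>j<n. \<gamma> i j (y j)) = (\<Sum>j<n. \<gamma> i j (z j))" by simp
    then show ?thesis using y z by (simp add: sum)
  next
    case False
    then have "\<Gamma> y' i = Max ((\<lambda>j. \<gamma> i j (y' j)) ` {..<n})" using \<Gamma>_eq[of y' i] y' i by (simp add: gain_op_def)
    also have "\<dots> \<in> (\<lambda>j. \<gamma> i j (y' j)) ` {..<n}" using n_pos by (intro Max_in) auto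
    finally obtain j where j: "j < n" "\<Gamma> y i \<le> \<gamma> i j (y' j)" using \<Gamma>_le by auto
    show ?thesis
    proof (cases "j \<in> A")
      case True
      have "\<gamma> i j (y j) \<le> \<Gamma> z i" using \<Gamma>_ge_gain[OF i j(1), of z] z[OF j(1)] True by (simp add: z_def)
      then show ?thesis using j gain_mono[OF i j(1)] y'[OF j(1)] by fastforce
    next
      case False
      have "\<gamma> i j (y j) \<le> \<Gamma> y i" using y j(1) by (intro \<Gamma>_ge_gain i)
      then have "zero_gain (\<gamma> i j)"
        using zero_gain_or_less[OF i j(1)] y'[OF j(1)] less[OF j(1) False] j(2) by fastforce
      then have "\<Gamma> y i \<le> 0" using j y' by (auto simp: zero_gain_def)
      then show ?thesis using \<Gamma>_nonneg[OF i, of z] by linarith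
    qed
  qed
  then show ?thesis by (simp add: z_def)
qed

text \<open>If averaging did not strictly enlarge the set of strict components, the remaining components
  \<open>A\<close> would carry a vector \<open>z\<close>, namely \<open>y\<close> restricted to \<open>A\<close>, with \<open>M z \<ge> z\<close>.\<close>

lemma avg_enlarges_strict_components:
  assumes y: "subinvariant y" "\<And>i. i < n \<Longrightarrow> 0 < y i"
    and A: "A = {i. i < n \<and> M y i = y i}" "A \<noteq> {}"
  shows "\<exists>i\<in>A. M (avg y) i < avg y i"
proof (rule ccontr)
  assume "\<not> ?thesis"
  then have stuck: "y i \<le> M (avg y) i" if "i \<in> A" for i
    using that A by (auto simp: not_less avg_def)
  have avg_y: "0 \<le> avg y j \<and> avg y j \<le> y j" if "j < n" for j
    using subinvariant_nonneg[OF subinvariant_avg[OF y(1)] that] avg_le[OF y(1) that] by simp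
  have less: "avg y j < y j" if "j < n" "j \<notin> A" for j
    using subinvariantD[OF y(1) that(1)] that by (auto simp: avg_def A)
  define z where "z = (\<lambda>i. if i \<in> A then y i else 0)"
  have "z i \<le> M z i" if i: "i < n" for i
  proof (cases "i \<in> A")
    case True
    then have "M y i \<le> M (avg y) i" using stuck by (simp add: A)
    then have "\<Gamma> y i \<le> \<Gamma> (avg y) i"
      using D_less_iff[of "\<Gamma> (avg y) i" "\<Gamma> y i"] \<Gamma>_nonneg[OF i] by (auto simp: M_def Dalpha_def split: if_splits)
    from \<Gamma>_le_restrict[OF i avg_y less this] have "\<Gamma> y i \<le> \<Gamma> z i" by (simp add: z_def)
    then have "M y i \<le> M z i"
      using D_le_iff[of "\<Gamma> y i" "\<Gamma> z i"] \<Gamma>_nonneg[OF i] by (auto simp: M_def Dalpha_def)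
    then show ?thesis using True by (auto simp: z_def A)
  qed (simp add: z_def M_nonneg[OF i])
  moreover have "0 \<le> z i" if "i < n" for i using y(2)[OF that] by (simp add: z_def)
  moreover obtain i where "i \<in> A" using A(2) by blast
  ultimately have "z i = 0" using A(1) M_ge_imp_eq_0[of z i] by simp
  then show False using \<open>i \<in> A\<close> y(2)[of i] A(1) by (simp add: z_def)
qed

lemma avg_equality_components_subset:
  assumes y: "subinvariant y"
  shows "{i. i < n \<and> M (avg y) i = avg y i} \<subseteq> {i. i < n \<and> M y i = y i}"
proof
  fix i assume "i \<in> {i. i < n \<and> M (avg y) i = avg y i}"
  then have i: "i < n" "M (avg y) i = avg y i" by auto
  have "M (avg y) i \<le> M y i" by (intro M_mono avg_le y i)
  then have "y i \<le> M y i" using i by (simp add: avg_def)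
  then show "i \<in> {i. i < n \<and> M y i = y i}" using subinvariantD[OF y i(1)] i(1) by simp
qed

lemma funpow_avg_strict:
  assumes y: "subinvariant y" "\<And>i. i < n \<Longrightarrow> 0 < y i" and "i < n"
  shows "M ((avg ^^ n) y) i < (avg ^^ n) y i"
proof -
  define y' where "y' = (\<lambda>k. (avg ^^ k) y)"
  define A where "A = (\<lambda>k. {i. i < n \<and> M (y' k) i = y' k i})"
  have y'_Suc: "y' (Suc k) = avg (y' k)" for k by (simp add: y'_def)
  have sub: "subinvariant (y' k)" for k unfolding y'_def by (rule subinvariant_funpow_avg[OF y(1)])
  have pos: "0 < y' k i" if "i < n" for k i unfolding y'_def by (rule funpow_avg_pos[of i y, OF that y(2)[OF that]])
  have antimono: "A (Suc k) \<subseteq> A k" for k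
    unfolding A_def y'_Suc by (rule avg_equality_components_subset[OF sub])
  have finite: "finite (A k)" for k by (simp add: A_def)
  have "card (A k) \<le> n - k" for k
  proof (induction k)
    case 0
    have "card (A 0) \<le> card {..<n}" by (rule card_mono) (auto simp: A_def)
    then show ?case by simp
  next
    case (Suc k)
    show ?case
    proof (cases "A k = {}")
      case False
      then obtain i where "i \<in> A k" "M (y' (Suc k)) i < y' (Suc k) i"
        using avg_enlarges_strict_components[of "y' k" "A k", OF sub pos] by (auto simp: A_def y'_Suc)
      moreover from this have "i \<notin> A (Suc k)" by (simp add: A_def)
      ultimately have "A (Suc k) \<subset> A k" using antimono[of k] by blast
      then have "card (A (Suc k)) < card (A k)" by (rule psubset_card_mono[OF finite])
      then show ?thesis using Suc by linarith
    qed (use antimono[of k] in simp)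
  qed
  from this[of n] have "A n = {}" using finite by simp
  then show ?thesis using subinvariantD[OF sub \<open>i < n\<close>, of n] \<open>i < n\<close> by (force simp: A_def y'_def)
qed

end

section \<open>Two-sided orbits of the averaged operator\<close>

lemma compact_PiE_UNIV:
  fixes S :: "'i \<Rightarrow> 'a::topological_space set"
  assumes "\<And>i. compact (S i)"
  shows "compact (PiE UNIV S)"
proof -
  have "compactin (product_topology (\<lambda>_. euclidean) UNIV) (PiE UNIV S)"
    using assms by (simp add: compactin_PiE)
  then show ?thesis by (simp add: euclidean_product_topology)
qed

lemma compact_Int_decseq_closed_nonempty:
  assumes "compact X" and closed: "\<And>n::nat. closed (A n)" and "decseq A" and ne: "\<And>n. X \<inter> A n \<noteq> {}"
  shows "X \<inter> (\<Inter>n. A n) \<noteq> {}"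
proof (rule compact_imp_fip_image[OF \<open>compact X\<close> closed])
  fix I :: "nat set" assume "finite I"
  have "A (Max (insert 0 I)) \<subseteq> A k" if "k \<in> I" for k
    by (rule decseqD[OF \<open>decseq A\<close>]) (use that \<open>finite I\<close> in simp)
  then have "X \<inter> A (Max (insert 0 I)) \<subseteq> X \<inter> (\<Inter>k\<in>I. A k)" by blast
  then show "X \<inter> (\<Inter>k\<in>I. A k) \<noteq> {}" using ne by fastforce
qed

context mixed_gains
begin

definition avg_orbit_on :: "int set \<Rightarrow> (int \<Rightarrow> nat \<Rightarrow> real) \<Rightarrow> bool" where
  "avg_orbit_on T s \<longleftrightarrow> (\<forall>m\<in>T. subinvariant (s m) \<and> (\<forall>i<n. s (m - 1) i = avg (s m) i))"

lemma funpow_avg_sum_le_double: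
  "(\<Sum>i<n. (avg ^^ k) S i) \<le> 2 ^ l * (\<Sum>i<n. (avg ^^ (k + l)) S i)"
proof -
  have "avg ^^ (k + l) = avg ^^ l \<circ> avg ^^ k" unfolding add.commute[of k l] by (rule funpow_add)
  then have "(avg ^^ k) S i \<le> 2 ^ l * (avg ^^ (k + l)) S i" if "i < n" for i
    using funpow_avg_ge[OF that, of "(avg ^^ k) S" l] by (simp add: pos_divide_le_eq mult.commute)
  then show ?thesis unfolding sum_distrib_left by (intro sum_mono) auto
qed

lemma funpow_avg_sum_antimono:
  assumes "subinvariant S" "k \<le> l"
  shows "(\<Sum>i<n. (avg ^^ l) S i) \<le> (\<Sum>i<n. (avg ^^ k) S i)"
  by (rule lift_Suc_antimono_le[OF _ \<open>k \<le> l\<close>])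
     (auto intro!: sum_mono avg_le subinvariant_funpow_avg assms)

lemma exists_normalizing_exponent:
  assumes S: "subinvariant S" and large: "2 ^ N < (\<Sum>i<n. S i)"
  obtains K where "N < K" "(\<Sum>i<n. (avg ^^ K) S i) \<le> 1" "1 / 2 \<le> (\<Sum>i<n. (avg ^^ K) S i)"
proof -
  define T where "T = (\<lambda>k. \<Sum>i<n. (avg ^^ k) S i)"
  have T_large: "1 < T k" if "k \<le> N" for k
  proof -
    have "(2::real) ^ k \<le> 2 ^ N" using that by simp
    also have "\<dots> < T 0" using large by (simp add: T_def)
    also have "\<dots> \<le> 2 ^ k * T k" using funpow_avg_sum_le_double[of 0 S k] by (simp add: T_def)
    finally show ?thesis by simp
  qed
  have "T \<longlonglongrightarrow> (\<Sum>i<n. 0)"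
    unfolding T_def by (intro tendsto_sum funpow_avg_tendsto_0 S) auto
  then have "\<forall>\<^sub>F k in sequentially. T k < 1" by (intro order_tendstoD) auto
  then have "\<exists>k. T k < 1" using eventually_happens by fastforce
  then have "\<exists>k. T k \<le> 1" using less_imp_le by blast
  then obtain K where K: "T K \<le> 1" "\<And>k. k < K \<Longrightarrow> \<not> T k \<le> 1"
    using exists_least_iff[of "\<lambda>k. T k \<le> 1"] by blast
  have "N < K" using T_large[of K] K(1) by (cases "N < K") auto
  moreover from this have "1 < T (K - 1)" using K(2)[of "K - 1"] by auto
  then have "1 / 2 \<le> T K"
    using funpow_avg_sum_le_double[of "K - 1" S 1] \<open>N < K\<close> by (simp add: T_def)
  ultimately show ?thesis using that K(1) by (simp add: T_def)
qed

lemma funpow_avg_component_le: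
  assumes S: "subinvariant S" and normalized: "(\<Sum>i<n. (avg ^^ K) S i) \<le> 1" and "m \<le> int K" "i < n"
  shows "(avg ^^ nat (int K - m)) S i \<le> 2 ^ nat m"
proof -
  define k where "k = nat (int K - m)"
  have "(avg ^^ k) S i \<le> (\<Sum>i<n. (avg ^^ k) S i)"
    using \<open>i < n\<close> subinvariant_nonneg[OF subinvariant_funpow_avg[OF S]] by (intro member_le_sum) auto
  also have "\<dots> \<le> 2 ^ nat m * (\<Sum>i<n. (avg ^^ K) S i)"
  proof (cases "0 \<le> m")
    case True
    then have "K = k + nat m" using \<open>m \<le> int K\<close> unfolding k_def by linarith
    then show ?thesis using funpow_avg_sum_le_double[of k S "nat m"] by simp
  next
    case False
    then show ?thesis using funpow_avg_sum_antimono[OF S, of K k] by (simp add: k_def)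
  qed
  also have "\<dots> \<le> 2 ^ nat m * 1" using normalized by (intro mult_left_mono) auto
  finally show ?thesis by (simp add: k_def)
qed

lemma exists_bounded_avg_orbit_upto:
  fixes N :: nat
  assumes "\<And>R. 0 < R \<Longrightarrow> \<exists>S. subinvariant S \<and> (\<Sum>i<n. S i) = R"
  obtains s where "avg_orbit_on {..int N} s" "1 / 2 \<le> (\<Sum>i<n. s 0 i)"
    "\<And>m i. s m i \<in> {0..2 ^ nat m}"
proof -
  obtain S where S: "subinvariant S" "(\<Sum>i<n. S i) = 2 ^ N + 1"
    using assms[of "2 ^ N + 1"] by (auto simp: add_pos_pos)
  define y where "y = (\<lambda>k. (avg ^^ k) S)"
  obtain K where K: "N < K" "(\<Sum>i<n. y K i) \<le> 1" "1 / 2 \<le> (\<Sum>i<n. y K i)"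
    using exists_normalizing_exponent[OF S(1), of N] S(2) unfolding y_def by auto
  have sub: "subinvariant (y k)" for k unfolding y_def by (rule subinvariant_funpow_avg[OF S(1)])
  define s where "s = (\<lambda>m i. if m \<le> int K \<and> i < n then y (nat (int K - m)) i else 0)"
  have s: "s m i = y (nat (int K - m)) i" if "m \<le> int K" "i < n" for m i using that by (simp add: s_def)
  show ?thesis
  proof (rule that[of s])
    show "avg_orbit_on {..int N} s"
      unfolding avg_orbit_on_def
    proof
      fix m assume "m \<in> {..int N}"
      then have m: "m \<le> int K" "nat (int K - (m - 1)) = Suc (nat (int K - m))" using K(1) by auto
      have "subinvariant (s m)"
        unfolding subinvariant_def using m(1) subinvariantD[OF sub] M_cong[of "s m" "y (nat (int K - m))"]
        by (simp add: s)
      moreover have "s (m - 1) i = avg (s m) i" if "i < n" for i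
        using m that avg_cong[of "s m" "y (nat (int K - m))" i] by (simp add: s y_def)
      ultimately show "subinvariant (s m) \<and> (\<forall>i<n. s (m - 1) i = avg (s m) i)" by blast
    qed
    show "1 / 2 \<le> (\<Sum>i<n. s 0 i)" using K(3) by (simp add: s)
    show "s m i \<in> {0..2 ^ nat m}" for m i
      using funpow_avg_component_le[OF S(1), of K m i] K(2) subinvariant_nonneg[OF sub, of i]
      by (auto simp: s_def y_def)
  qed
qed

text \<open>An orbit reaching up to one level need not extend beyond it, so the orbits reaching higher and
  higher levels are combined by compactness (Tychonoff).\<close>

lemma exists_avg_orbit:
  assumes "\<And>R. 0 < R \<Longrightarrow> \<exists>S. subinvariant S \<and> (\<Sum>i<n. S i) = R"
  obtains s where "avg_orbit_on UNIV s" "1 / 2 \<le> (\<Sum>i<n. s 0 i)"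
proof -
  define X where "X = PiE UNIV (\<lambda>m::int. PiE UNIV (\<lambda>i::nat. {0..2 ^ nat m :: real}))"
  have "compact X" unfolding X_def by (intro compact_PiE_UNIV compact_Icc)
  define A where "A = (\<lambda>N::nat. {s. avg_orbit_on {..int N} s \<and> 1 / 2 \<le> (\<Sum>i<n. s 0 i)})"
  have coord: "continuous_on UNIV (\<lambda>s :: int \<Rightarrow> nat \<Rightarrow> real. s m i)" for m i
    by (rule continuous_on_compose2[OF continuous_on_product_coordinates[of i] continuous_on_product_coordinates]) simp
  have imp: "closed {s. P \<longrightarrow> Q s}" if "P \<Longrightarrow> closed {s. Q s}"
    for P and Q :: "(int \<Rightarrow> nat \<Rightarrow> real) \<Rightarrow> bool"
    using that by (cases P) auto
  have "closed (A N)" for N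
    unfolding A_def avg_orbit_on_def subinvariant_def avg_def Ball_def
    by (intro closed_Collect_conj closed_Collect_all imp closed_Collect_le closed_Collect_eq
          continuous_intros M_continuous_on coord) auto
  moreover have "decseq A"
    unfolding decseq_def A_def avg_orbit_on_def by auto
  moreover have "X \<inter> A N \<noteq> {}" for N
  proof -
    obtain s where "avg_orbit_on {..int N} s" "1 / 2 \<le> (\<Sum>i<n. s 0 i)" "\<And>m i. s m i \<in> {0..2 ^ nat m}"
      using exists_bounded_avg_orbit_upto[OF assms] by blast
    then have "s \<in> X \<inter> A N" by (simp add: X_def A_def PiE_UNIV_domain)
    then show ?thesis by blast
  qed
  ultimately have "X \<inter> (\<Inter>N. A N) \<noteq> {}"
    using compact_Int_decseq_closed_nonempty[OF \<open>compact X\<close>] by blast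
  then obtain s where s: "\<And>N. s \<in> A N" by blast
  have "subinvariant (s m) \<and> (\<forall>i<n. s (m - 1) i = avg (s m) i)" for m
    using s[of "nat m"] unfolding A_def avg_orbit_on_def by auto
  then show ?thesis using that s[of 0] unfolding avg_orbit_on_def A_def by blast
qed

lemma avg_orbit_funpow:
  assumes s: "avg_orbit_on UNIV s" and "i < n"
  shows "s (m - int k) i = (avg ^^ k) (s m) i"
  using \<open>i < n\<close>
proof (induction k arbitrary: i)
  case (Suc k)
  have "s (m - int (Suc k)) i = s (m - int k - 1) i" by (simp add: algebra_simps)
  also have "\<dots> = avg (s (m - int k)) i" using s Suc.prems unfolding avg_orbit_on_def by blast
  also have "\<dots> = avg ((avg ^^ k) (s m)) i" by (rule avg_cong[OF Suc.IH Suc.prems])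
  also have "\<dots> = (avg ^^ Suc k) (s m) i" by simp
  finally show ?case .
qed simp

lemma avg_orbit_pos:
  assumes s: "avg_orbit_on UNIV s" and "0 < (\<Sum>i<n. s 0 i)" and "i < n"
  shows "0 < s m i"
proof -
  have sub: "subinvariant (s m)" for m using s unfolding avg_orbit_on_def by blast
  have "\<not> (\<forall>j<n. s 0 j \<le> 0)"
    using assms(2) sum_nonpos[of "{..<n}" "s 0"] by fastforce
  then obtain j where j: "j < n" "0 < s 0 j" by (auto simp: not_le)
  have "0 < s m j"
  proof (cases "0 \<le> m")
    case True
    have "s 0 j = (avg ^^ nat m) (s m) j" using avg_orbit_funpow[OF s j(1), of m "nat m"] True by simp
    also have "\<dots> \<le> (avg ^^ 0) (s m) j"
      by (rule lift_Suc_antimono_le[of "\<lambda>k. (avg ^^ k) (s m) j"]) (simp_all add: avg_le subinvariant_funpow_avg sub j)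
    finally show ?thesis using j(2) by simp
  next
    case False
    then show ?thesis
      using avg_orbit_funpow[OF s j(1), of 0 "nat (- m)"] funpow_avg_pos[of j "s 0", OF j] by simp
  qed
  then show ?thesis by (rule subinvariant_pos[OF sub j(1) _ \<open>i < n\<close>])
qed

lemma avg_orbit_strict:
  assumes s: "avg_orbit_on UNIV s" and pos: "\<And>m i. i < n \<Longrightarrow> 0 < s m i" and i: "i < n"
  shows "s m i < s (m + 1) i" and "M (s (m + 1)) i < s m i"
proof -
  have "subinvariant (s (m + 1 + int n))" using s unfolding avg_orbit_on_def by blast
  then have "M ((avg ^^ n) (s (m + 1 + int n))) i < (avg ^^ n) (s (m + 1 + int n)) i"
    by (rule funpow_avg_strict) (use pos i in auto)
  moreover have "(avg ^^ n) (s (m + 1 + int n)) j = s (m + 1) j" if "j < n" for j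
    using avg_orbit_funpow[OF s that, of "m + 1 + int n" n] by simp
  ultimately have "M (s (m + 1)) i < s (m + 1) i"
    using M_cong[of "(avg ^^ n) (s (m + 1 + int n))" "s (m + 1)" i] i by simp
  moreover have "s m i = (s (m + 1) i + M (s (m + 1)) i) / 2"
    using avg_orbit_funpow[OF s i, of "m + 1" 1] by (simp add: avg_def)
  ultimately show "s m i < s (m + 1) i" "M (s (m + 1)) i < s m i" by auto
qed

lemma avg_orbit_bounded_component_propagates:
  assumes s: "avg_orbit_on UNIV s" and "i < n" "j < n" and bdd: "\<And>m. s m i \<le> B"
  shows "\<exists>B. \<forall>m. s m j \<le> B"
proof -
  have sub: "subinvariant (s m)" for m using s unfolding avg_orbit_on_def by blast
  have "(i, j) \<in> {(i, j). i < n \<and> j < n \<and> \<not> zero_gain (\<gamma> i j)}\<^sup>*"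
    using irred assms(2,3) by (simp add: gain_irreducible_def)
  then show ?thesis
  proof (induction rule: rtrancl_induct)
    case (step k l)
    then have kl: "k < n" "l < n" "classKinf (\<gamma> k l)" using gains[of k l] by auto
    obtain B where B: "\<And>m. s m k \<le> B" using step.IH by blast
    have "s m l \<le> Kinv (\<gamma> k l) (max 0 B)" for m
    proof -
      have l: "0 \<le> s m l" by (rule subinvariant_nonneg[OF sub kl(2)])
      have "\<gamma> k l (s m l) \<le> M (s m) k" by (rule M_ge_gain[of _ _ "s m", OF kl(1,2) l])
      also have "\<dots> \<le> max 0 B" using subinvariantD[OF sub kl(1), of m] B[of m] by linarith
      finally show ?thesis
        using Kinv_less_iff[OF kl(3) l, of "max 0 B"] by (simp add: not_less[symmetric])
    qed
    then show ?case by blast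
  qed (use bdd in blast)
qed

lemma avg_orbit_unbounded:
  assumes s: "avg_orbit_on UNIV s" and pos: "\<And>m i. i < n \<Longrightarrow> 0 < s m i" and "i < n"
  shows "\<exists>m. B < s m i"
proof (rule ccontr)
  assume "\<not> ?thesis"
  then have "\<exists>B. \<forall>m. s m j \<le> B" if "j < n" for j
    using avg_orbit_bounded_component_propagates[OF s \<open>i < n\<close> that, of B] by (simp add: not_less)
  moreover have inc: "incseq (\<lambda>k. s (int k) j)" if "j < n" for j
  proof (rule incseq_SucI)
    show "s (int k) j \<le> s (int (Suc k)) j" for k
      using avg_orbit_strict(1)[OF s pos that, of "int k"] by (simp add: add.commute)
  qed
  ultimately have "\<exists>l. (\<lambda>k. s (int k) j) \<longlonglongrightarrow> l" if "j < n" for j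
    using incseq_convergent[of "\<lambda>k. s (int k) j"] that by metis
  then obtain l where l: "\<And>j. j < n \<Longrightarrow> (\<lambda>k. s (int k) j) \<longlonglongrightarrow> l j" by metis
  have "l i = 0"
  proof (rule avg_common_limit_eq_0)
    show "(\<lambda>k. s (int (Suc k)) j) \<longlonglongrightarrow> l j" if "j < n" for j by (rule LIMSEQ_Suc[OF l[OF that]])
    show "(\<lambda>k. avg (s (int (Suc k))) j) \<longlonglongrightarrow> l j" if "j < n" for j
      using l[OF that] avg_orbit_funpow[OF s that, of "int (Suc _)" 1] by simp
    show "0 \<le> s (int (Suc k)) j" if "j < n" for k j using pos[OF that] by (rule less_imp_le)
  qed fact
  moreover have "s 0 i \<le> l i" using incseq_le[OF inc l, OF \<open>i < n\<close> \<open>i < n\<close>, of 0] by simp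
  ultimately show False using pos[OF \<open>i < n\<close>, of 0] by simp
qed

lemma exists_two_sided_decay_sequence:
  fixes k :: "nat \<Rightarrow> 'd::finite"
  assumes inj: "inj_on k {..<n}"
  obtains s :: "int \<Rightarrow> nat \<Rightarrow> real" where
    "\<And>m i. i < n \<Longrightarrow> 0 < s m i \<and> s m i < s (m + 1) i \<and> M (s (m + 1)) i < s m i"
    "\<And>i B. i < n \<Longrightarrow> \<exists>m. B < s m i" "\<And>i e. i < n \<Longrightarrow> 0 < e \<Longrightarrow> \<exists>m. s m i < e"
proof -
  obtain s where s: "avg_orbit_on UNIV s" and "1 / 2 \<le> (\<Sum>i<n. s 0 i)"
    using exists_avg_orbit exists_subinvariant_of_sum[OF inj] by metis
  then have pos: "0 < s m i" if "i < n" for m i by (intro avg_orbit_pos[OF s _ that]) simp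
  have "\<exists>m. s m i < e" if "i < n" "0 < e" for i and e :: real
  proof -
    have "subinvariant (s 0)" using s unfolding avg_orbit_on_def by blast
    then have "\<forall>\<^sub>F k in sequentially. (avg ^^ k) (s 0) i < e"
      by (intro order_tendstoD(2)[OF funpow_avg_tendsto_0] that)
    then obtain k where "(avg ^^ k) (s 0) i < e" using eventually_happens by fastforce
    then show ?thesis using avg_orbit_funpow[OF s that(1), of 0 k] by metis
  qed
  then show ?thesis
    using pos avg_orbit_strict[OF s pos] avg_orbit_unbounded[OF s pos] by (intro that[of s]) blast+
qed

end

section \<open>Interpolation of two-sided sequences\<close>

definition interp :: "(int \<Rightarrow> real) \<Rightarrow> real \<Rightarrow> real" where
  "interp s x = s \<lfloor>x\<rfloor> + (x - of_int \<lfloor>x\<rfloor>) * (s (\<lfloor>x\<rfloor> + 1) - s \<lfloor>x\<rfloor>)"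

lemma interp_of_int [simp]: "interp s (of_int k) = s k"
  by (simp add: interp_def)

lemma interp_ge: "s \<lfloor>x\<rfloor> \<le> s (\<lfloor>x\<rfloor> + 1) \<Longrightarrow> s \<lfloor>x\<rfloor> \<le> interp s x"
  unfolding interp_def by (simp add: of_int_floor_le)

lemma interp_le:
  assumes "s \<lfloor>x\<rfloor> \<le> s (\<lfloor>x\<rfloor> + 1)"
  shows "interp s x \<le> s (\<lfloor>x\<rfloor> + 1)"
proof -
  have "x - of_int \<lfloor>x\<rfloor> \<le> 1" by linarith
  from mult_right_mono[OF this, of "s (\<lfloor>x\<rfloor> + 1) - s \<lfloor>x\<rfloor>"] assms show ?thesis by (simp add: interp_def)
qed

lemma interp_mono:
  fixes a b :: int
  assumes s: "\<And>k. a \<le> k \<Longrightarrow> k < b \<Longrightarrow> s k \<le> s (k + 1)" and "of_int a \<le> x" "x \<le> y" "y < of_int b"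
  shows "interp s x \<le> interp s y"
proof -
  have fl: "a \<le> \<lfloor>x\<rfloor>" "\<lfloor>x\<rfloor> \<le> \<lfloor>y\<rfloor>" "\<lfloor>y\<rfloor> < b"
    using assms by (auto simp: le_floor_iff floor_less_iff intro: floor_mono order_trans[OF of_int_floor_le])
  show ?thesis
  proof (cases "\<lfloor>x\<rfloor> = \<lfloor>y\<rfloor>")
    case True
    then show ?thesis using s[of "\<lfloor>x\<rfloor>"] fl \<open>x \<le> y\<close> by (auto simp: interp_def intro!: mult_right_mono)
  next
    case False
    have chain: "i \<le> j \<Longrightarrow> a \<le> i \<Longrightarrow> j \<le> b \<Longrightarrow> s i \<le> s j" for i j
    proof (induction j rule: int_ge_induct)
      case (step j)
      then show ?case using s[of j] by (auto intro: order_trans)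
    qed simp
    have "interp s x \<le> s (\<lfloor>x\<rfloor> + 1)" using fl by (intro interp_le s) auto
    also have "\<dots> \<le> s \<lfloor>y\<rfloor>" using fl False by (intro chain) auto
    also have "\<dots> \<le> interp s y" using fl by (intro interp_ge s) auto
    finally show ?thesis .
  qed
qed

lemma interp_slope_ge:
  fixes a b :: int
  assumes "\<And>k. a \<le> k \<Longrightarrow> k < b \<Longrightarrow> c \<le> s (k + 1) - s k"
  shows "slope_ge c {of_int a..<of_int b} (interp s)"
  unfolding slope_ge_def
proof (intro ballI impI)
  fix x y :: real assume xy: "x \<in> {of_int a..<of_int b}" "y \<in> {of_int a..<of_int b}" "x \<le> y"
  have linear: "interp (\<lambda>k. s k - c * of_int k) z = interp s z - c * z" for z
    by (simp add: interp_def algebra_simps)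
  have "interp (\<lambda>k. s k - c * of_int k) x \<le> interp (\<lambda>k. s k - c * of_int k) y"
    using assms xy by (intro interp_mono[of a b]) (auto simp: algebra_simps)
  then show "c * (y - x) \<le> interp s y - interp s x" unfolding linear by (simp add: right_diff_distrib)
qed

lemma interp_slope_le:
  fixes a b :: int
  assumes "\<And>k. a \<le> k \<Longrightarrow> k < b \<Longrightarrow> s (k + 1) - s k \<le> C"
  shows "slope_le C {of_int a..<of_int b} (interp s)"
proof -
  have "slope_ge (- C) {of_int a..<of_int b} (interp (\<lambda>k. - s k))"
    using assms by (intro interp_slope_ge) fastforce
  moreover have "interp (\<lambda>k. - s k) x = - interp s x" for x by (simp add: interp_def algebra_simps)
  ultimately show ?thesis by (fastforce simp: slope_ge_def slope_le_def)
qed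

lemma ln_slopes:
  fixes a b :: real
  assumes "0 < a"
  shows "slope_ge (1 / b) {a..b} ln" and "slope_le (1 / a) {a..b} ln"
proof -
  have ratio: "(y - x) / y \<le> ln y - ln x" "ln y - ln x \<le> (y - x) / x" if xy: "0 < x" "x \<le> y" for x y :: real
  proof -
    have "ln y - ln x = ln (y / x)" "ln x - ln y = ln (x / y)" using xy by (simp_all add: ln_div)
    moreover have "ln (y / x) \<le> y / x - 1" "ln (x / y) \<le> x / y - 1" using xy by (auto intro!: ln_le_minus_one)
    ultimately show "(y - x) / y \<le> ln y - ln x" "ln y - ln x \<le> (y - x) / x"
      using xy by (auto simp: diff_divide_distrib)
  qed
  show "slope_ge (1 / b) {a..b} ln"
    unfolding slope_ge_def
  proof (intro ballI impI)
    fix x y assume xy: "x \<in> {a..b}" "y \<in> {a..b}" "x \<le> y"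
    then have "(y - x) / b \<le> (y - x) / y" using \<open>0 < a\<close> by (intro divide_left_mono) auto
    then show "1 / b * (y - x) \<le> ln y - ln x" using ratio(1)[of x y] xy \<open>0 < a\<close> by simp
  qed
  show "slope_le (1 / a) {a..b} ln"
    unfolding slope_le_def
  proof (intro ballI impI)
    fix x y assume xy: "x \<in> {a..b}" "y \<in> {a..b}" "x \<le> y"
    then have "(y - x) / x \<le> (y - x) / a" using \<open>0 < a\<close> by (intro divide_left_mono) auto
    then show "ln y - ln x \<le> 1 / a * (y - x)" using ratio(2)[of x y] xy \<open>0 < a\<close> by simp
  qed
qed

lemma ln_mem_floor_interval:
  fixes a b x :: real
  assumes "0 < a" "x \<in> {a..b}"
  shows "ln x \<in> {of_int \<lfloor>ln a\<rfloor>..<of_int (\<lfloor>ln b\<rfloor> + 1)}"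
proof -
  have "ln a \<le> ln x" "ln x \<le> ln b" using assms by auto
  then have "of_int \<lfloor>ln a\<rfloor> \<le> ln x" "ln x < of_int (\<lfloor>ln b\<rfloor> + 1)" by linarith+
  then show ?thesis by simp
qed

lemma positive_slopes_interp_ln:
  assumes s: "\<And>k. s k < s (k + 1)"
  shows "positive_slopes (\<lambda>r. interp s (ln r))"
  unfolding positive_slopes_def
proof (intro allI impI)
  fix a b :: real assume ab: "0 < a" "a \<le> b"
  let ?I = "{\<lfloor>ln a\<rfloor>..<\<lfloor>ln b\<rfloor> + 1}"
  obtain c where c: "0 < c" "\<And>k. k \<in> ?I \<Longrightarrow> c \<le> s (k + 1) - s k"
    using finite_positive_lower_bound[of ?I "\<lambda>k. s (k + 1) - s k"] s by auto
  have interp: "slope_ge c {of_int \<lfloor>ln a\<rfloor>..<of_int (\<lfloor>ln b\<rfloor> + 1)} (interp s)"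
    using c(2) by (intro interp_slope_ge) auto
  have "slope_ge (c * (1 / b)) {a..b} (\<lambda>r. interp s (ln r))"
    unfolding slope_ge_def
  proof (intro ballI impI)
    fix x y assume xy: "x \<in> {a..b}" "y \<in> {a..b}" "x \<le> y"
    have "ln x \<le> ln y" using xy ab by auto
    then have "c * (ln y - ln x) \<le> interp s (ln y) - interp s (ln x)"
      by (rule slope_geD[OF interp
             ln_mem_floor_interval[OF ab(1) xy(1)] ln_mem_floor_interval[OF ab(1) xy(2)]])
    moreover have "c * (1 / b * (y - x)) \<le> c * (ln y - ln x)"
      using slope_geD[OF ln_slopes(1)[OF ab(1)] xy] c(1) by (intro mult_left_mono) auto
    ultimately show "c * (1 / b) * (y - x) \<le> interp s (ln y) - interp s (ln x)" by (simp add: mult.assoc)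
  qed
  then show "\<exists>c>0. slope_ge c {a..b} (\<lambda>r. interp s (ln r))" using c(1) ab by (intro exI[of _ "c * (1 / b)"]) auto
qed

lemma finite_slopes_interp_ln:
  "finite_slopes (\<lambda>r. interp s (ln r))"
  unfolding finite_slopes_def
proof (intro allI impI)
  fix a b :: real assume ab: "0 < a" "a \<le> b"
  define C where "C = Max (insert 1 ((\<lambda>k. s (k + 1) - s k) ` {\<lfloor>ln a\<rfloor>..<\<lfloor>ln b\<rfloor> + 1}))"
  have "1 \<le> C" unfolding C_def by (intro Max_ge) auto
  have interp: "slope_le C {of_int \<lfloor>ln a\<rfloor>..<of_int (\<lfloor>ln b\<rfloor> + 1)} (interp s)"
    unfolding C_def by (intro interp_slope_le Max_ge) auto
  have "slope_le (C * (1 / a)) {a..b} (\<lambda>r. interp s (ln r))"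
    unfolding slope_le_def
  proof (intro ballI impI)
    fix x y assume xy: "x \<in> {a..b}" "y \<in> {a..b}" "x \<le> y"
    have "ln x \<le> ln y" using xy ab by auto
    then have "interp s (ln y) - interp s (ln x) \<le> C * (ln y - ln x)"
      by (rule slope_leD[OF interp
             ln_mem_floor_interval[OF ab(1) xy(1)] ln_mem_floor_interval[OF ab(1) xy(2)]])
    moreover have "C * (ln y - ln x) \<le> C * (1 / a * (y - x))"
      using slope_leD[OF ln_slopes(2)[OF ab(1)] xy] \<open>1 \<le> C\<close> by (intro mult_left_mono) auto
    ultimately show "interp s (ln y) - interp s (ln x) \<le> C * (1 / a) * (y - x)" by (simp add: mult.assoc)
  qed
  then show "\<exists>C>0. slope_le C {a..b} (\<lambda>r. interp s (ln r))"
    using \<open>1 \<le> C\<close> ab by (intro exI[of _ "C * (1 / a)"]) auto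
qed

lemma positive_slopes_imp_strict_mono_on:
  assumes "positive_slopes f"
  shows "strict_mono_on {0<..} f"
proof (rule strict_mono_onI)
  fix x y :: real assume xy: "x \<in> {0<..}" "x < y"
  then obtain c where "0 < c" "slope_ge c {x..y} f"
    using assms unfolding positive_slopes_def by (meson greaterThan_iff less_imp_le)
  then have "c * (y - x) \<le> f y - f x" "0 < c * (y - x)" using slope_geD[of c "{x..y}" f x y] xy by auto
  then show "f x < f y" by linarith
qed

lemma classKinf_interp_ln:
  fixes s :: "int \<Rightarrow> real"
  assumes s: "\<And>k. s k < s (k + 1)" "\<And>k. 0 < s k"
    and small: "\<And>e. 0 < e \<Longrightarrow> \<exists>k. s k < e" and large: "\<And>B. \<exists>k. B < s k"
  shows "classKinf (\<lambda>r. if r \<le> 0 then 0 else interp s (ln r))"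
proof (rule classKinf_extend_0)
  let ?f = "\<lambda>r. interp s (ln r)"
  have smono: "strict_mono_on {0<..} ?f"
    by (intro positive_slopes_imp_strict_mono_on positive_slopes_interp_ln s)
  then show "strict_mono_on {0<..} ?f" .
  have "locLip {0<..} ?f"
    by (intro locLip_if_finite_slopes strict_mono_on_imp_mono_on smono finite_slopes_interp_ln)
  then show "continuous_on {0<..} ?f"
    by (simp add: locLip_open_iff continuous_on_eq_continuous_at lipschitz_near_isCont)
  have pos: "0 < ?f r" for r using interp_ge[of s "ln r"] s(1)[of "\<lfloor>ln r\<rfloor>"] s(2)[of "\<lfloor>ln r\<rfloor>"] by linarith
  have f_exp: "?f (exp (of_int k)) = s k" for k by simp
  show "(?f \<longlongrightarrow> 0) (at_right 0)"
  proof (rule order_tendstoI)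
    fix e :: real assume "0 < e"
    then obtain k where "s k < e" using small by blast
    moreover have "?f r < s k" if "0 < r" "r < exp (of_int k)" for r
      using strict_mono_onD[OF smono, of r "exp (of_int k)"] that f_exp[of k] by simp
    ultimately show "\<forall>\<^sub>F r in at_right 0. ?f r < e"
      unfolding eventually_at_right_field by (intro exI[of _ "exp (of_int k)"]) fastforce
  qed (use pos in \<open>auto intro!: always_eventually less_trans[OF _ pos]\<close>)
  show "filterlim ?f at_top at_top"
    unfolding filterlim_at_top
  proof
    fix Z
    obtain k where k: "Z < s k" using large by blast
    show "\<forall>\<^sub>F r in at_top. Z \<le> ?f r"
      using eventually_gt_at_top[of "exp (of_int k)"]
    proof eventually_elim
      case (elim r)
      then have "0 < r" using exp_gt_zero less_trans by blast
      then show ?case using strict_mono_onD[OF smono, of "exp (of_int k)" r] elim f_exp[of k] k by simp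
    qed
  qed
qed

definition decrease_path :: "nat \<Rightarrow> ((nat \<Rightarrow> real) \<Rightarrow> nat \<Rightarrow> real) \<Rightarrow> (nat \<Rightarrow> real \<Rightarrow> real) \<Rightarrow> bool" where
  "decrease_path n M \<sigma> \<longleftrightarrow>
     (\<forall>i<n. classKinf (\<sigma> i) \<and> locLip {0<..} (Kinv (\<sigma> i)) \<and> positive_slopes (Kinv (\<sigma> i))) \<and>
     (\<forall>r>0. \<forall>i<n. M (\<lambda>j. \<sigma> j r) i < \<sigma> i r)"

lemma Omega_path_imp_decrease_path:
  assumes \<sigma>: "Omega_path n M \<sigma>"
  shows "decrease_path n M \<sigma>"
proof -
  have "positive_slopes (Kinv (\<sigma> i))" if "i < n" for i
  proof (rule positive_slopes_if_derivative_ge)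
    show "locLip {0<..} (Kinv (\<sigma> i))" using \<sigma> that by (simp add: Omega_path_def)
    fix P :: "real set" assume "compact P" "P \<subseteq> {0<..}"
    then obtain c C where "0 < c"
      "\<forall>i<n. \<forall>r\<in>P. \<forall>d. (Kinv (\<sigma> i) has_real_derivative d) (at r) \<longrightarrow> c \<le> d \<and> d \<le> C"
      using \<sigma> unfolding Omega_path_def by meson
    then show "\<exists>c>0. \<forall>r\<in>P. \<forall>d. (Kinv (\<sigma> i) has_real_derivative d) (at r) \<longrightarrow> c \<le> d"
      using that by blast
  qed
  then show ?thesis using \<sigma> by (simp add: decrease_path_def Omega_path_def)
qed

lemma (in mixed_gains) exists_decrease_path:
  fixes k :: "nat \<Rightarrow> 'd::finite"
  assumes inj: "inj_on k {..<n}"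
  obtains \<sigma> where "decrease_path n (\<lambda>s. Dalpha Isum \<alpha> (gain_op n Isum \<gamma> s)) \<sigma>"
proof -
  obtain s :: "int \<Rightarrow> nat \<Rightarrow> real" where
    s: "\<And>m i. i < n \<Longrightarrow> 0 < s m i \<and> s m i < s (m + 1) i \<and> M (s (m + 1)) i < s m i"
    "\<And>i B. i < n \<Longrightarrow> \<exists>m. B < s m i" "\<And>i e. i < n \<Longrightarrow> 0 < e \<Longrightarrow> \<exists>m. s m i < e"
    using exists_two_sided_decay_sequence[OF inj] by blast
  define \<sigma> where "\<sigma> = (\<lambda>i r. if r \<le> 0 then 0 else interp (\<lambda>m. s m i) (ln r))"
  have "classKinf (\<sigma> i) \<and> locLip {0<..} (Kinv (\<sigma> i)) \<and> positive_slopes (Kinv (\<sigma> i))" if i: "i < n" for i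
  proof -
    have K: "classKinf (\<sigma> i)" unfolding \<sigma>_def using s i by (intro classKinf_interp_ln) blast+
    have "positive_slopes (\<sigma> i)" "finite_slopes (\<sigma> i)"
      using positive_slopes_interp_ln[of "\<lambda>m. s m i"] finite_slopes_interp_ln[of "\<lambda>m. s m i"] s(1)[OF i]
      by (auto simp: positive_slopes_def finite_slopes_def slope_ge_def slope_le_def \<sigma>_def)
    then have "finite_slopes (Kinv (\<sigma> i))" "positive_slopes (Kinv (\<sigma> i))" using Kinv_slopes[OF K] by blast+
    moreover have "mono_on {0<..} (Kinv (\<sigma> i))"
      using classK_le[OF classKinf_classK[OF Kinv_classKinf[OF K]]] by (intro mono_onI) auto
    ultimately show ?thesis using K locLip_if_finite_slopes by blast
  qed
  moreover have "Dalpha Isum \<alpha> (gain_op n Isum \<gamma> (\<lambda>j. \<sigma> j r)) i < \<sigma> i r" if r: "0 < r" and i: "i < n" for r i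
  proof -
    have between: "s \<lfloor>ln r\<rfloor> j \<le> \<sigma> j r" "\<sigma> j r \<le> s (\<lfloor>ln r\<rfloor> + 1) j" if j: "j < n" for j
      using interp_ge[of "\<lambda>m. s m j" "ln r"] interp_le[of "\<lambda>m. s m j" "ln r"] s(1)[OF j, of "\<lfloor>ln r\<rfloor>"] r
      by (auto simp: \<sigma>_def)
    have "0 \<le> \<sigma> j r" if "j < n" for j using between(1)[OF that] s(1)[OF that, of "\<lfloor>ln r\<rfloor>"] by linarith
    then have "Dalpha Isum \<alpha> (gain_op n Isum \<gamma> (\<lambda>j. \<sigma> j r)) i = M (\<lambda>j. \<sigma> j r) i" using M_eq i by simp
    also have "\<dots> \<le> M (s (\<lfloor>ln r\<rfloor> + 1)) i" using between by (intro M_mono i) auto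
    also have "\<dots> < s \<lfloor>ln r\<rfloor> i" using s(1)[OF i] by blast
    also have "\<dots> \<le> \<sigma> i r" using between[OF i] by blast
    finally show ?thesis .
  qed
  ultimately have "decrease_path n (\<lambda>s. Dalpha Isum \<alpha> (gain_op n Isum \<gamma> s)) \<sigma>"
    by (simp add: decrease_path_def)
  then show ?thesis by (rule that)
qed

section \<open>Dini decrease\<close>

definition dini_decrease :: "('a::real_normed_vector \<Rightarrow> real) \<Rightarrow> 'a \<Rightarrow> 'a \<Rightarrow> real \<Rightarrow> bool" where
  "dini_decrease f x w a \<longleftrightarrow> (\<forall>e>0. \<forall>\<^sub>F h in at_right 0. f (x + h *\<^sub>R w) \<le> f x - h * (a - e))"

lemma dini_decrease_mono:
  assumes "dini_decrease f x w a" "a' \<le> a"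
  shows "dini_decrease f x w a'"
  unfolding dini_decrease_def
proof (intro allI impI)
  fix e :: real assume "0 < e"
  then have "\<forall>\<^sub>F h in at_right 0. f (x + h *\<^sub>R w) \<le> f x - h * (a - e)"
    using assms(1) by (simp add: dini_decrease_def)
  then show "\<forall>\<^sub>F h in at_right 0. f (x + h *\<^sub>R w) \<le> f x - h * (a' - e)"
    using eventually_at_right_less[of 0]
  proof eventually_elim
    case (elim h)
    have "h * (a' - e) \<le> h * (a - e)" using assms(2) elim by (intro mult_left_mono) auto
    then show ?case using elim by linarith
  qed
qed

lemma dini_decrease_imp_derivative_le:
  assumes D: "(f has_derivative D) (at x)" and dini: "dini_decrease f x w a"
  shows "D w \<le> - a"
proof (rule field_le_epsilon)
  fix e :: real assume "0 < e"
  have "((\<lambda>h. (f (x + h *\<^sub>R w) - f x) / h) \<longlongrightarrow> D w) (at 0)"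
    using has_derivative_along_line[of f D x 0 w] D by (simp add: has_field_derivative_iff)
  then have lim: "((\<lambda>h. (f (x + h *\<^sub>R w) - f x) / h) \<longlongrightarrow> D w) (at_right 0)"
    by (rule tendsto_within_subset) auto
  have "\<forall>\<^sub>F h in at_right 0. f (x + h *\<^sub>R w) \<le> f x - h * (a - e)"
    using dini \<open>0 < e\<close> by (simp add: dini_decrease_def)
  then have "\<forall>\<^sub>F h in at_right 0. (f (x + h *\<^sub>R w) - f x) / h \<le> - a + e"
    using eventually_at_right_less[of 0]
    by eventually_elim (simp add: field_simps)
  then show "D w \<le> - a + e" by (rule tendsto_upperbound[OF lim]) (simp add: trivial_limit_at_right_real)
qed

lemma lipschitz_on_abs_derivative_le:
  fixes f :: "'a::real_normed_vector \<Rightarrow> real"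
  assumes lip: "L-lipschitz_on S f" and S: "open S" "y \<in> S" and D: "(f has_derivative D) (at y)"
  shows "\<bar>D v\<bar> \<le> L * norm v"
proof -
  have "((\<lambda>h. (f (y + h *\<^sub>R v) - f y) / h) \<longlongrightarrow> D v) (at 0)"
    using has_derivative_along_line[of f D y 0 v] D by (simp add: has_field_derivative_iff)
  then have lim: "((\<lambda>h. \<bar>(f (y + h *\<^sub>R v) - f y) / h\<bar>) \<longlongrightarrow> \<bar>D v\<bar>) (at 0)"
    by (rule tendsto_rabs)
  have "((\<lambda>h. y + h *\<^sub>R v) \<longlongrightarrow> y + 0 *\<^sub>R v) (at 0)" by (intro tendsto_intros)
  then have "\<forall>\<^sub>F h in at 0. y + h *\<^sub>R v \<in> S" using S topological_tendstoD by fastforce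
  then have "\<forall>\<^sub>F h in at 0. \<bar>(f (y + h *\<^sub>R v) - f y) / h\<bar> \<le> L * norm v"
    using eventually_neq_at_within[of 0]
  proof eventually_elim
    case (elim h)
    have "\<bar>f (y + h *\<^sub>R v) - f y\<bar> \<le> L * norm (h *\<^sub>R v)"
      using lipschitz_onD[OF lip elim(1) S(2)] by (simp add: dist_norm)
    then show ?case using elim by (simp add: abs_divide field_simps)
  qed
  then show ?thesis by (rule tendsto_upperbound[OF lim]) simp
qed

lemma eventually_segment_in_ball:
  fixes x w :: "'a::real_normed_vector"
  assumes "0 < r"
  shows "\<forall>\<^sub>F h in at_right 0. \<forall>t\<in>{0..h}. x + t *\<^sub>R w \<in> ball x r"
proof -
  have "((\<lambda>h. h * norm w) \<longlongrightarrow> 0 * norm w) (at_right 0)" by (intro tendsto_intros)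
  then have "\<forall>\<^sub>F h in at_right 0. h * norm w < r" using assms by (intro order_tendstoD) auto
  then show ?thesis
  proof (eventually_elim, intro ballI)
    fix h t assume "h * norm w < r" "t \<in> {0..h}"
    moreover from this have "t * norm w \<le> h * norm w" by (intro mult_right_mono) auto
    ultimately show "x + t *\<^sub>R w \<in> ball x r" by (simp add: dist_norm)
  qed
qed

lemma eventually_derivative_le_frozen_direction:
  fixes f :: "'a::real_normed_vector \<Rightarrow> real"
  assumes lip: "lipschitz_near f x" and \<phi>: "isCont \<phi> x" and a: "isCont a x" and "0 < e"
    and deriv: "\<forall>\<^sub>F y in nhds x. \<forall>D. (f has_derivative D) (at y) \<longrightarrow> D (\<phi> y) \<le> - a y"
  shows "\<forall>\<^sub>F y in nhds x. \<forall>D. (f has_derivative D) (at y) \<longrightarrow> D (\<phi> x) \<le> - (a x - e)"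
proof -
  obtain r L where r: "0 < r" and L: "L-lipschitz_on (ball x r) f" using lip by (rule lipschitz_nearE)
  have \<phi>_lim: "(\<phi> \<longlongrightarrow> \<phi> x) (nhds x)" and a_lim: "(a \<longlongrightarrow> a x) (nhds x)"
    using \<phi> a by (auto simp: isCont_def tendsto_at_iff_tendsto_nhds)
  have "((\<lambda>y. L * norm (\<phi> x - \<phi> y)) \<longlongrightarrow> L * norm (\<phi> x - \<phi> x)) (nhds x)"
    by (intro tendsto_intros \<phi>_lim)
  then have "\<forall>\<^sub>F y in nhds x. L * norm (\<phi> x - \<phi> y) < e / 2"
    by (rule order_tendstoD(2)) (use \<open>0 < e\<close> in simp)
  moreover have "\<forall>\<^sub>F y in nhds x. a x - e / 2 < a y"
    by (rule order_tendstoD(1)[OF a_lim]) (use \<open>0 < e\<close> in simp)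
  moreover note deriv eventually_nhds_ball[OF r]
  ultimately show ?thesis
  proof (eventually_elim, intro allI impI)
    fix y D assume y: "L * norm (\<phi> x - \<phi> y) < e / 2" "a x - e / 2 < a y"
      "\<forall>D. (f has_derivative D) (at y) \<longrightarrow> D (\<phi> y) \<le> - a y" "y \<in> ball x r" and D: "(f has_derivative D) (at y)"
    have "D (\<phi> x) = D (\<phi> y) + D (\<phi> x - \<phi> y)"
      using has_derivative_linear[OF D] by (simp add: linear_diff)
    moreover have "D (\<phi> y) \<le> - a y" using y(3) D by blast
    moreover have "D (\<phi> x - \<phi> y) \<le> L * norm (\<phi> x - \<phi> y)"
      using lipschitz_on_abs_derivative_le[OF L open_ball y(4) D] abs_le_D1 by blast
    ultimately show "D (\<phi> x) \<le> - (a x - e)" using y(1,2) by linarith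
  qed
qed

lemma dini_decrease_if_derivative_le_near:
  fixes f :: "'a::euclidean_space \<Rightarrow> real"
  assumes lip: "lipschitz_near f x" and \<phi>: "isCont \<phi> x" and a: "isCont a x"
    and deriv: "\<forall>\<^sub>F y in nhds x. \<forall>D. (f has_derivative D) (at y) \<longrightarrow> D (\<phi> y) \<le> - a y"
  shows "dini_decrease f x (\<phi> x) (a x)"
  unfolding dini_decrease_def
proof (intro allI impI)
  fix e :: real assume "0 < e"
  obtain r L where r: "0 < r" and L: "L-lipschitz_on (ball x r) f" using lip by (rule lipschitz_nearE)
  obtain d where d: "0 < d"
    "\<And>y D. dist y x < d \<Longrightarrow> (f has_derivative D) (at y) \<Longrightarrow> D (\<phi> x) \<le> - (a x - e)"
    using eventually_derivative_le_frozen_direction[OF lip \<phi> a \<open>0 < e\<close> deriv]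
    unfolding eventually_nhds_metric by blast
  have "\<forall>\<^sub>F h in at_right 0. \<forall>t\<in>{0..h}. x + t *\<^sub>R \<phi> x \<in> ball x (min r d)"
    using r d(1) by (intro eventually_segment_in_ball) simp
  then show "\<forall>\<^sub>F h in at_right 0. f (x + h *\<^sub>R \<phi> x) \<le> f x - h * (a x - e)"
    using eventually_at_right_less[of 0]
  proof eventually_elim
    case (elim h)
    have "f (x + h *\<^sub>R \<phi> x) \<le> f x + (- (a x - e)) * h"
      by (rule lipschitz_increment_le_if_derivative_le[OF lipschitz_on_subset[OF L, of "ball x (min r d)"]])
         (use elim d(2) in \<open>auto simp: dist_commute\<close>)
    then show ?case by (simp add: algebra_simps)
  qed
qed

lemma dini_decrease_compose:
  fixes f :: "'a::real_normed_vector \<Rightarrow> real"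
  assumes dini: "dini_decrease f x w a" and "0 < a" "0 \<le> c"
    and nonneg: "\<And>y. 0 \<le> f y" and "0 < f x" and mono: "mono_on {0..} \<tau>"
    and slope: "\<And>e. 0 < e \<Longrightarrow> \<forall>\<^sub>F t in at_left (f x). (c - e) * (f x - t) \<le> \<tau> (f x) - \<tau> t"
  shows "dini_decrease (\<lambda>y. \<tau> (f y)) x w (c * a)"
  unfolding dini_decrease_def
proof (intro allI impI)
  fix \<epsilon> :: real assume "0 < \<epsilon>"
  define e where "e = min (a / 2) (\<epsilon> / (a + c))"
  have "0 < a + c" "e \<le> \<epsilon> / (a + c)" using \<open>0 < a\<close> \<open>0 \<le> c\<close> by (auto simp: e_def)
  then have e: "0 < e" "e < a" "e * (a + c) \<le> \<epsilon>"
    using \<open>0 < a\<close> \<open>0 < \<epsilon>\<close> by (auto simp: pos_le_divide_eq) (auto simp: e_def)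
  have "c * a - \<epsilon> \<le> (c - e) * (a - e)"
    using e(3) zero_le_square[of e] by (simp add: algebra_simps del: zero_le_square)
  then have rate: "h * (c * a - \<epsilon>) \<le> (c - e) * (h * (a - e))" if "0 < h" for h
    using mult_left_mono[of _ _ h] that by (simp add: mult.left_commute)
  define t where "t = (\<lambda>h. f x - h * (a - e))"
  have t_less: "\<forall>\<^sub>F h in at_right 0. t h < f x"
    using eventually_at_right_less[of 0] by eventually_elim (simp add: t_def e)
  have "(t \<longlongrightarrow> f x - 0 * (a - e)) (at_right 0)" unfolding t_def by (intro tendsto_intros)
  then have t_lim: "(t \<longlongrightarrow> f x) (at_right 0)" by simp
  then have "filterlim t (at_left (f x)) (at_right 0)"
    using t_less by (auto simp: filterlim_at elim: eventually_mono)
  then have "\<forall>\<^sub>F h in at_right 0. (c - e) * (f x - t h) \<le> \<tau> (f x) - \<tau> (t h)"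
    using slope[OF e(1)] by (rule eventually_compose_filterlim[rotated])
  moreover have "\<forall>\<^sub>F h in at_right 0. 0 < t h" using t_lim \<open>0 < f x\<close> by (rule order_tendstoD)
  moreover have "\<forall>\<^sub>F h in at_right 0. f (x + h *\<^sub>R w) \<le> t h"
    using dini e(1) unfolding dini_decrease_def t_def by blast
  ultimately show "\<forall>\<^sub>F h in at_right 0. \<tau> (f (x + h *\<^sub>R w)) \<le> \<tau> (f x) - h * (c * a - \<epsilon>)"
    using eventually_at_right_less[of 0]
  proof eventually_elim
    case (elim h)
    have "\<tau> (f (x + h *\<^sub>R w)) \<le> \<tau> (t h)"
      using elim by (intro mono_onD[OF mono]) (auto simp: nonneg)
    moreover have "f x - t h = h * (a - e)" by (simp add: t_def)
    ultimately show ?case using elim(1) rate[OF elim(4)] by simp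
  qed
qed

lemma eventually_Max_image_eq_active:
  fixes f :: "'i \<Rightarrow> 'a::t2_space \<Rightarrow> real"
  assumes "finite I" "I \<noteq> {}" and cont: "\<And>i. i \<in> I \<Longrightarrow> isCont (f i) x"
  defines "A \<equiv> {i \<in> I. f i x = Max ((\<lambda>i. f i x) ` I)}"
  shows "\<forall>\<^sub>F y in nhds x. Max ((\<lambda>i. f i y) ` I) = Max ((\<lambda>i. f i y) ` A)" and "A \<noteq> {}"
proof -
  have "Max ((\<lambda>i. f i x) ` I) \<in> (\<lambda>i. f i x) ` I" using assms(1,2) by (intro Max_in) auto
  then obtain a where a: "a \<in> A" by (auto simp: A_def)
  then show "A \<noteq> {}" by blast
  have "\<forall>\<^sub>F y in nhds x. f i y < f a y" if i: "i \<in> I - A" for i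
  proof -
    have "f i x \<le> Max ((\<lambda>i. f i x) ` I)" using i \<open>finite I\<close> by (intro Max_ge) auto
    then have "0 < f a x - f i x" using i a by (auto simp: A_def)
    moreover have "((\<lambda>y. f a y - f i y) \<longlongrightarrow> f a x - f i x) (nhds x)"
      using cont[of a] cont[of i] a i by (auto simp: A_def isCont_def tendsto_at_iff_tendsto_nhds intro!: tendsto_diff)
    ultimately have "\<forall>\<^sub>F y in nhds x. 0 < f a y - f i y" by (intro order_tendstoD)
    then show ?thesis by eventually_elim simp
  qed
  then have "\<forall>\<^sub>F y in nhds x. \<forall>i\<in>I - A. f i y < f a y"
    using \<open>finite I\<close> by (intro eventually_ball_finite) auto
  then show "\<forall>\<^sub>F y in nhds x. Max ((\<lambda>i. f i y) ` I) = Max ((\<lambda>i. f i y) ` A)"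
  proof eventually_elim
    case (elim y)
    have A: "finite A" "A \<subseteq> I" using \<open>finite I\<close> by (auto simp: A_def)
    have "f i y \<le> Max ((\<lambda>i. f i y) ` A)" if "i \<in> I" for i
    proof (cases "i \<in> A")
      case False
      then have "f i y \<le> f a y" using elim that by (simp add: less_imp_le)
      also have "\<dots> \<le> Max ((\<lambda>i. f i y) ` A)" using a A by (intro Max_ge) auto
      finally show ?thesis .
    qed (use A in auto)
    then have "Max ((\<lambda>i. f i y) ` I) \<le> Max ((\<lambda>i. f i y) ` A)"
      using \<open>finite I\<close> \<open>I \<noteq> {}\<close> by (intro Max.boundedI) auto
    moreover have "Max ((\<lambda>i. f i y) ` A) \<le> Max ((\<lambda>i. f i y) ` I)"
      using a A \<open>finite I\<close> by (intro Max_mono image_mono) auto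
    ultimately show ?case by (rule antisym)
  qed
qed

lemma dini_decrease_Max_image:
  fixes f :: "'i \<Rightarrow> 'a::real_normed_vector \<Rightarrow> real"
  assumes "finite I" "I \<noteq> {}" and cont: "\<And>i. i \<in> I \<Longrightarrow> isCont (f i) x"
    and active: "\<And>i. i \<in> I \<Longrightarrow> f i x = Max ((\<lambda>i. f i x) ` I) \<Longrightarrow> dini_decrease (f i) x w a"
  shows "dini_decrease (\<lambda>y. Max ((\<lambda>i. f i y) ` I)) x w a"
  unfolding dini_decrease_def
proof (intro allI impI)
  fix e :: real assume "0 < e"
  let ?m = "Max ((\<lambda>i. f i x) ` I)"
  let ?A = "{i \<in> I. f i x = ?m}"
  note eq_active = eventually_Max_image_eq_active[OF assms(1,2) cont]
  have "((\<lambda>h. x + h *\<^sub>R w) \<longlongrightarrow> x + 0 *\<^sub>R w) (at_right 0)" by (intro tendsto_intros)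
  then have "filterlim (\<lambda>h. x + h *\<^sub>R w) (nhds x) (at_right 0)" by simp
  then have "\<forall>\<^sub>F h in at_right 0. Max ((\<lambda>i. f i (x + h *\<^sub>R w)) ` I) = Max ((\<lambda>i. f i (x + h *\<^sub>R w)) ` ?A)"
    using eq_active(1) by (rule eventually_compose_filterlim[rotated])
  moreover have "\<forall>\<^sub>F h in at_right 0. \<forall>i\<in>?A. f i (x + h *\<^sub>R w) \<le> f i x - h * (a - e)"
    using active \<open>0 < e\<close> \<open>finite I\<close> by (intro eventually_ball_finite) (auto simp: dini_decrease_def)
  ultimately show "\<forall>\<^sub>F h in at_right 0. Max ((\<lambda>i. f i (x + h *\<^sub>R w)) ` I) \<le> ?m - h * (a - e)"
  proof eventually_elim
    case (elim h)
    show ?case using elim(2) eq_active(2) \<open>finite I\<close> unfolding elim(1) by (intro Max.boundedI) auto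
  qed
qed

section \<open>Lyapunov functions with Dini decrease\<close>

definition proper_posdef :: "('a::real_normed_vector \<Rightarrow> real) \<Rightarrow> bool" where
  "proper_posdef V \<longleftrightarrow>
     (\<exists>\<psi>1 \<psi>2. classKinf \<psi>1 \<and> classKinf \<psi>2 \<and> (\<forall>x. \<psi>1 (norm x) \<le> V x \<and> V x \<le> \<psi>2 (norm x)))"

lemma proper_posdefE:
  assumes "proper_posdef V"
  obtains \<psi>1 \<psi>2 where "classKinf \<psi>1" "classKinf \<psi>2" "\<And>x. \<psi>1 (norm x) \<le> V x" "\<And>x. V x \<le> \<psi>2 (norm x)"
  using assms unfolding proper_posdef_def by blast

lemma proper_posdef_0: "proper_posdef V \<Longrightarrow> V 0 = 0"
  by (elim proper_posdefE) (metis antisym classK_zero classKinf_classK norm_zero)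

lemma proper_posdef_pos: "proper_posdef V \<Longrightarrow> x \<noteq> 0 \<Longrightarrow> 0 < V x"
  by (elim proper_posdefE) (meson classK_pos classKinf_classK less_le_trans zero_less_norm_iff)

lemma proper_posdef_nonneg: "proper_posdef V \<Longrightarrow> 0 \<le> V x"
  using proper_posdef_pos[of V x] proper_posdef_0[of V] by (cases "x = 0") auto

definition dini_Lyap :: "('a::real_normed_vector \<Rightarrow> 'b::real_normed_vector \<Rightarrow> 'a) \<Rightarrow> ('a \<Rightarrow> real) \<Rightarrow> bool" where
  "dini_Lyap F V \<longleftrightarrow> continuous_on UNIV V \<and> proper_posdef V \<and> locLip (UNIV - {0}) V \<and>
     (\<exists>\<gamma> \<alpha>. classK \<gamma> \<and> posdef \<alpha> \<and>
        (\<forall>x u. x \<noteq> 0 \<longrightarrow> \<gamma> (norm u) \<le> V x \<longrightarrow> dini_decrease V x (F x u) (\<alpha> (norm x))))"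

lemma dini_Lyap_imp_ISS_Lyap:
  fixes F :: "real^'d::finite \<Rightarrow> real^'m::finite \<Rightarrow> real^'d"
  assumes V: "dini_Lyap F V"
  shows "ISS_Lyap F V"
proof -
  have proper: "proper_posdef V" using V by (simp add: dini_Lyap_def)
  obtain \<gamma> \<alpha> where \<gamma>: "classK \<gamma>" "posdef \<alpha>"
    "\<And>x u. x \<noteq> 0 \<Longrightarrow> \<gamma> (norm u) \<le> V x \<Longrightarrow> dini_decrease V x (F x u) (\<alpha> (norm x))"
    using V unfolding dini_Lyap_def by blast
  have "D (F x u) \<le> - \<alpha> (norm x)" if D: "(V has_derivative D) (at x)" and u: "\<gamma> (norm u) \<le> V x" for x u D
  proof (cases "x = 0")
    case False
    then show ?thesis using dini_decrease_imp_derivative_le[OF D \<gamma>(3)[OF False u]] by blast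
  next
    case True
    have "\<forall>y\<in>ball 0 1. V 0 \<le> V y" by (simp add: proper_posdef_0[OF proper] proper_posdef_nonneg[OF proper])
    then have "D = (\<lambda>h. 0)"
      using differential_zero_maxmin[of 0 "ball 0 1" V D] D True by simp
    moreover have "\<alpha> 0 = 0" using \<gamma>(2) by (simp add: posdef_def)
    ultimately show ?thesis using True by simp
  qed
  then show ?thesis using V \<gamma>(1,2) unfolding ISS_Lyap_def dini_Lyap_def proper_posdef_def by blast
qed

section \<open>The composite Lyapunov function\<close>

lemma bproj_in_bspace [simp]: "bproj blk i x \<in> bspace blk i"
  by (simp add: bproj_def bspace_def)

lemma bproj_bspace: "x \<in> bspace blk i \<Longrightarrow> bproj blk i x = x"
  by (auto simp: bproj_def bspace_def vec_eq_iff)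

lemma bproj_linear: "linear (bproj blk i)"
  by (rule linearI) (auto simp: bproj_def vec_eq_iff)

lemma bproj_add: "bproj blk i (x + y) = bproj blk i x + bproj blk i y"
  and bproj_diff: "bproj blk i (x - y) = bproj blk i x - bproj blk i y"
  and bproj_scaleR: "bproj blk i (c *\<^sub>R x) = c *\<^sub>R bproj blk i x"
  using bproj_linear[of blk i] by (auto simp: linear_add linear_diff linear_cmul)

lemma norm_bproj_le: "norm (bproj blk i x) \<le> norm x"
  by (rule norm_le_componentwise_cart) (simp add: bproj_def)

lemma dist_bproj_le: "dist (bproj blk i x) (bproj blk i y) \<le> dist x y"
  using norm_bproj_le[of blk i "x - y"] by (simp add: dist_norm bproj_diff)

lemma bproj_continuous: "continuous_on S (bproj blk i)"
  using bproj_linear linear_continuous_on linear_conv_bounded_linear by blast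

lemma sum_bproj:
  assumes "\<forall>k. blk k < n"
  shows "(\<Sum>i<n. bproj blk i x) = x"
  using assms by (auto simp: vec_eq_iff bproj_def)

lemma exists_large_block:
  assumes "\<forall>k. blk k < n" "0 < n"
  shows "\<exists>i<n. norm x / real n \<le> norm (bproj blk i x)"
proof (rule ccontr)
  assume "\<not> ?thesis"
  then have "\<And>i. i < n \<Longrightarrow> norm (bproj blk i x) < norm x / real n" by force
  then have "(\<Sum>i<n. norm (bproj blk i x)) < (\<Sum>i<n. norm x / real n)"
    using assms(2) by (intro sum_strict_mono) auto
  moreover have "norm x \<le> (\<Sum>i<n. norm (bproj blk i x))"
    using norm_sum[of "\<lambda>i. bproj blk i x" "{..<n}"] sum_bproj[OF assms(1), of x] by simp
  ultimately show False using assms(2) by simp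
qed

lemma continuous_on_Max_image:
  fixes f :: "'i \<Rightarrow> 'z::topological_space \<Rightarrow> real"
  assumes "finite I" "I \<noteq> {}" "\<And>j. j \<in> I \<Longrightarrow> continuous_on S (f j)"
  shows "continuous_on S (\<lambda>z. Max ((\<lambda>j. f j z) ` I))"
  unfolding continuous_on_def
proof
  fix x assume "x \<in> S"
  then show "((\<lambda>z. Max ((\<lambda>j. f j z) ` I)) \<longlongrightarrow> Max ((\<lambda>j. f j x) ` I)) (at x within S)"
    using assms(3) by (intro tendsto_Max_image[OF assms(1,2)]) (auto simp: continuous_on_def)
qed

locale network =
  fixes n :: nat and blk :: "'d::finite \<Rightarrow> nat"
    and F :: "real^'d \<Rightarrow> real^'m::finite \<Rightarrow> real^'d"
    and Isum :: "nat set" and V :: "nat \<Rightarrow> real^'d \<Rightarrow> real"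
    and \<gamma> :: "nat \<Rightarrow> nat \<Rightarrow> real \<Rightarrow> real"
    and gi :: "nat \<Rightarrow> real \<Rightarrow> real" and \<alpha>i :: "nat \<Rightarrow> real \<Rightarrow> real" and \<alpha> :: "real \<Rightarrow> real"
    and \<sigma> :: "nat \<Rightarrow> real \<Rightarrow> real"
  assumes n_pos: "0 < n" and blk_range: "\<forall>k. blk k < n"
    and F_cont: "continuous_on UNIV (case_prod F)"
    and gains: "\<And>i j. i < n \<Longrightarrow> j < n \<Longrightarrow> classKinf (\<gamma> i j) \<or> zero_gain (\<gamma> i j)"
    and subISS: "\<And>i. i < n \<Longrightarrow> sub_ISS_Lyap n blk Isum F V \<gamma> gi \<alpha>i i"
    and alpha: "classKinf \<alpha>"
    and path: "decrease_path n (\<lambda>s. Dalpha Isum \<alpha> (gain_op n Isum \<gamma> s)) \<sigma>"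
begin

definition subV :: "nat \<Rightarrow> real^'d \<Rightarrow> real" where
  "subV i x = V i (bproj blk i x)"

definition scaledV :: "nat \<Rightarrow> real^'d \<Rightarrow> real" where
  "scaledV i x = Kinv (\<sigma> i) (subV i x)"

definition maxV :: "real^'d \<Rightarrow> real" where
  "maxV x = Max ((\<lambda>i. scaledV i x) ` {..<n})"

definition active :: "nat \<Rightarrow> real^'d \<Rightarrow> bool" where
  "active i x \<longleftrightarrow> scaledV i x = maxV x"

definition threshold :: "nat \<Rightarrow> real^'m \<Rightarrow> real^'d \<Rightarrow> real" where
  "threshold i u x = (if i \<in> Isum then (\<Sum>j<n. \<gamma> i j (subV j x)) + gi i (norm u)
     else max (Max ((\<lambda>j. \<gamma> i j (subV j x)) ` {..<n})) (gi i (norm u)))"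

lemma path_classKinf: "i < n \<Longrightarrow> classKinf (\<sigma> i)"
  and path_locLip_Kinv: "i < n \<Longrightarrow> locLip {0<..} (Kinv (\<sigma> i))"
  and path_positive_slopes: "i < n \<Longrightarrow> positive_slopes (Kinv (\<sigma> i))"
  and path_decrease: "0 < r \<Longrightarrow> i < n \<Longrightarrow> Dalpha Isum \<alpha> (gain_op n Isum \<gamma> (\<lambda>j. \<sigma> j r)) i < \<sigma> i r"
  using path by (simp_all add: decrease_path_def)

lemma path_Kinv_classK: "i < n \<Longrightarrow> classK (Kinv (\<sigma> i))"
  using path_classKinf Kinv_classKinf classKinf_classK by blast

lemma input_gain_classK: "i < n \<Longrightarrow> classK (gi i)"
  and rate_posdef: "i < n \<Longrightarrow> posdef (\<alpha>i i)"
  using subISS unfolding sub_ISS_Lyap_def by blast+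

lemma subV_bounds:
  assumes "i < n"
  obtains \<psi>1 \<psi>2 where "classKinf \<psi>1" "classKinf \<psi>2"
    "\<And>x. \<psi>1 (norm (bproj blk i x)) \<le> subV i x" "\<And>x. subV i x \<le> \<psi>2 (norm (bproj blk i x))"
  using subISS[OF assms] unfolding sub_ISS_Lyap_def subV_def by auto

lemma subV_eq_0: "i < n \<Longrightarrow> bproj blk i x = 0 \<Longrightarrow> subV i x = 0"
  by (elim subV_bounds) (metis antisym classK_zero classKinf_classK norm_zero)

lemma subV_pos: "i < n \<Longrightarrow> bproj blk i x \<noteq> 0 \<Longrightarrow> 0 < subV i x"
  by (elim subV_bounds) (meson classK_pos classKinf_classK less_le_trans zero_less_norm_iff)

lemma subV_nonneg: "i < n \<Longrightarrow> 0 \<le> subV i x"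
  using subV_eq_0[of i x] subV_pos[of i x] by fastforce

lemma subV_continuous: "i < n \<Longrightarrow> continuous_on UNIV (subV i)"
proof -
  assume "i < n"
  then have "continuous_on (bspace blk i) (V i)" using subISS unfolding sub_ISS_Lyap_def by blast
  from continuous_on_compose2[OF this bproj_continuous[of UNIV]] show ?thesis
    by (simp add: subV_def[abs_def] image_subset_iff)
qed

lemma subV_lipschitz_near:
  assumes i: "i < n" and x: "bproj blk i x \<noteq> 0"
  shows "lipschitz_near (subV i) x"
proof -
  let ?\<xi> = "bproj blk i x"
  have "locLip (bspace blk i - {0}) (V i)" using subISS[OF i] by (simp add: sub_ISS_Lyap_def)
  then obtain \<delta> L where \<delta>: "0 < \<delta>" and L: "L-lipschitz_on ((bspace blk i - {0}) \<inter> ball ?\<xi> \<delta>) (V i)"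
    using x bproj_in_bspace[of blk i x] unfolding locLip_iff_lipschitz_on by blast
  define r where "r = min \<delta> (norm ?\<xi>)"
  have "bproj blk i y \<in> (bspace blk i - {0}) \<inter> ball ?\<xi> \<delta>" if "y \<in> ball x r" for y
  proof -
    have "dist ?\<xi> (bproj blk i y) < r" using that dist_bproj_le[of blk i x y] by simp
    then show ?thesis by (auto simp: r_def)
  qed
  then have image: "bproj blk i ` ball x r \<subseteq> (bspace blk i - {0}) \<inter> ball ?\<xi> \<delta>" by (rule image_subsetI)
  have "1-lipschitz_on (ball x r) (bproj blk i)"
    by (rule lipschitz_onI) (simp_all add: dist_bproj_le)
  then have "(L * 1)-lipschitz_on (ball x r) (\<lambda>y. V i (bproj blk i y))"
    by (rule lipschitz_on_compose2) (rule lipschitz_on_subset[OF L image])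
  then show ?thesis
    unfolding subV_def[abs_def] using \<delta> x by (intro lipschitz_nearI[of r]) (auto simp: r_def)
qed

lemma threshold_continuous:
  assumes i: "i < n"
  shows "continuous_on UNIV (threshold i u)"
proof -
  have cont: "continuous_on UNIV (\<lambda>x. \<gamma> i j (subV j x))" if j: "j < n" for j
    by (rule continuous_on_compose2[OF gain_function_continuous[OF gains[OF i j]] subV_continuous[OF j]])
       (auto simp: subV_nonneg[OF j])
  have "continuous_on UNIV (\<lambda>x. Max ((\<lambda>j. \<gamma> i j (subV j x)) ` {..<n}))"
    using cont n_pos by (intro continuous_on_Max_image) auto
  then show ?thesis
    unfolding threshold_def[abs_def] using cont
    by (cases "i \<in> Isum") (auto intro!: continuous_on_add continuous_on_max continuous_on_sum continuous_on_const)
qed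

lemma subV_derivative_le:
  assumes i: "i < n" and D: "(subV i has_derivative D) (at y)" and ge: "threshold i u y \<le> subV i y"
  shows "D (bproj blk i (F y u)) \<le> - \<alpha>i i (norm (bproj blk i y))"
proof -
  have "(V i has_derivative D) (at (bproj blk i y) within bspace blk i)"
  proof (rule has_derivative_transform[of _ _ _ "\<lambda>\<zeta>. subV i ((y - bproj blk i y) + \<zeta>)"])
    show "bproj blk i y \<in> bspace blk i" by simp
    show "V i \<zeta> = subV i ((y - bproj blk i y) + \<zeta>)" if "\<zeta> \<in> bspace blk i" for \<zeta>
      using that by (simp add: subV_def bproj_add bproj_diff bproj_bspace)
    have shift: "((\<lambda>\<zeta>. (y - bproj blk i y) + \<zeta>) has_derivative (\<lambda>z. z)) (at (bproj blk i y) within bspace blk i)"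
      by (auto intro!: derivative_eq_intros)
    have "(subV i has_derivative D) (at ((y - bproj blk i y) + bproj blk i y))" using D by simp
    from has_derivative_compose[OF shift this]
    show "((\<lambda>\<zeta>. subV i ((y - bproj blk i y) + \<zeta>)) has_derivative D) (at (bproj blk i y) within bspace blk i)" .
  qed
  then show ?thesis using subISS[OF i] ge unfolding sub_ISS_Lyap_def threshold_def subV_def by blast
qed

lemma subV_dini_decrease:
  assumes i: "i < n" and x: "bproj blk i x \<noteq> 0" and less: "threshold i u x < subV i x"
  shows "dini_decrease (subV i) x (F x u) (\<alpha>i i (norm (bproj blk i x)))"
proof -
  have "dini_decrease (subV i) x (bproj blk i (F x u)) (\<alpha>i i (norm (bproj blk i x)))"
  proof (rule dini_decrease_if_derivative_le_near[OF subV_lipschitz_near[OF i x]])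
    have "continuous_on UNIV (\<lambda>y. F y u)"
      using continuous_on_compose2[OF F_cont continuous_on_Pair[OF continuous_on_id continuous_on_const[of _ u]]] by simp
    then have "continuous_on UNIV (\<lambda>y. bproj blk i (F y u))"
      by (rule continuous_on_compose2[OF bproj_continuous[of UNIV]]) simp
    then show "isCont (\<lambda>y. bproj blk i (F y u)) x" by (simp add: continuous_on_eq_continuous_at)
    have "continuous_on UNIV (\<lambda>y. \<alpha>i i (norm (bproj blk i y)))"
      by (rule continuous_on_compose2[OF posdef_continuous_on[OF rate_posdef[OF i] order_refl]])
         (auto intro!: continuous_on_norm bproj_continuous)
    then show "isCont (\<lambda>y. \<alpha>i i (norm (bproj blk i y))) x" by (simp add: continuous_on_eq_continuous_at)
    have "open {y. threshold i u y < subV i y}"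
      by (intro open_Collect_less subV_continuous threshold_continuous i)
    then have "\<forall>\<^sub>F y in nhds x. threshold i u y < subV i y"
      using eventually_nhds_in_open[of _ x] less by fastforce
    then show "\<forall>\<^sub>F y in nhds x. \<forall>D. (subV i has_derivative D) (at y) \<longrightarrow>
        D (bproj blk i (F y u)) \<le> - \<alpha>i i (norm (bproj blk i y))"
      by eventually_elim (auto intro: subV_derivative_le[OF i])
  qed
  then show ?thesis by (simp add: dini_decrease_def subV_def bproj_add bproj_scaleR bproj_bspace)
qed

lemma scaledV_le_maxV: "i < n \<Longrightarrow> scaledV i x \<le> maxV x"
  unfolding maxV_def by (intro Max_ge) auto

lemma maxV_attained: obtains i where "i < n" "active i x"
proof -
  have "maxV x \<in> (\<lambda>i. scaledV i x) ` {..<n}" unfolding maxV_def using n_pos by (intro Max_in) auto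
  then show ?thesis using that by (auto simp: active_def)
qed

lemma subV_le_iff: "i < n \<Longrightarrow> 0 \<le> r \<Longrightarrow> subV i x \<le> \<sigma> i r \<longleftrightarrow> scaledV i x \<le> r"
  unfolding scaledV_def by (simp add: Kinv_le_iff path_classKinf subV_nonneg)

lemma subV_eq_if_active: "i < n \<Longrightarrow> active i x \<Longrightarrow> subV i x = \<sigma> i (maxV x)"
  unfolding active_def scaledV_def by (metis Kinv_Kinf path_classKinf subV_nonneg)

lemma scaledV_continuous: "i < n \<Longrightarrow> continuous_on UNIV (scaledV i)"
  unfolding scaledV_def[abs_def]
  by (rule continuous_on_compose2[OF classK_cont[OF path_Kinv_classK] subV_continuous]) (auto simp: subV_nonneg)

lemma maxV_continuous: "continuous_on UNIV maxV"
  unfolding maxV_def[abs_def] using scaledV_continuous n_pos by (intro continuous_on_Max_image) auto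

lemma scaledV_pos_iff: "i < n \<Longrightarrow> 0 < scaledV i x \<longleftrightarrow> bproj blk i x \<noteq> 0"
  using subV_pos[of i x] subV_eq_0[of i x] classK_pos[OF path_Kinv_classK, of i "subV i x"]
    classK_zero[OF path_Kinv_classK, of i]
  by (cases "bproj blk i x = 0") (auto simp: scaledV_def)

lemma scaledV_bounds:
  assumes i: "i < n"
  obtains \<psi>1 \<psi>2 where "classKinf \<psi>1" "classKinf \<psi>2"
    "\<And>x. \<psi>1 (norm (bproj blk i x)) \<le> scaledV i x" "\<And>x. scaledV i x \<le> \<psi>2 (norm (bproj blk i x))"
proof -
  obtain p1 p2 where p: "classKinf p1" "classKinf p2"
    "\<And>x. p1 (norm (bproj blk i x)) \<le> subV i x" "\<And>x. subV i x \<le> p2 (norm (bproj blk i x))"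
    using subV_bounds[OF i] by blast
  show ?thesis
  proof (rule that)
    show "classKinf (\<lambda>r. Kinv (\<sigma> i) (p1 r))" "classKinf (\<lambda>r. Kinv (\<sigma> i) (p2 r))"
      using p by (auto intro: classKinf_compose Kinv_classKinf path_classKinf[OF i])
    show "Kinv (\<sigma> i) (p1 (norm (bproj blk i x))) \<le> scaledV i x"
      "scaledV i x \<le> Kinv (\<sigma> i) (p2 (norm (bproj blk i x)))" for x
      unfolding scaledV_def using p classK_nonneg[OF classKinf_classK[OF p(1)]] subV_nonneg[OF i]
      by (auto intro!: classK_le[OF path_Kinv_classK[OF i]])
  qed
qed

lemma maxV_proper_posdef: "proper_posdef maxV"
proof -
  have "\<forall>i. \<exists>\<psi>1 \<psi>2. i < n \<longrightarrow> classKinf \<psi>1 \<and> classKinf \<psi>2 \<and>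
      (\<forall>x. \<psi>1 (norm (bproj blk i x)) \<le> scaledV i x \<and> scaledV i x \<le> \<psi>2 (norm (bproj blk i x)))"
    using scaledV_bounds by metis
  then obtain p1 p2 where p: "\<And>i. i < n \<Longrightarrow> classKinf (p1 i)" "\<And>i. i < n \<Longrightarrow> classKinf (p2 i)"
    "\<And>i x. i < n \<Longrightarrow> p1 i (norm (bproj blk i x)) \<le> scaledV i x"
    "\<And>i x. i < n \<Longrightarrow> scaledV i x \<le> p2 i (norm (bproj blk i x))"
    by metis
  have "classKinf (\<lambda>r. p1 i ((1 / real n) * r))" if "i < n" for i
    using n_pos by (intro classKinf_compose[OF p(1)[OF that] classKinf_cmult]) simp
  then obtain \<psi>1 where \<psi>1: "classKinf \<psi>1" "\<And>i r. i < n \<Longrightarrow> 0 \<le> r \<Longrightarrow> \<psi>1 r \<le> p1 i ((1 / real n) * r)"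
    using classKinf_finite_lower[of "{..<n}" "\<lambda>i r. p1 i ((1 / real n) * r)"] by auto
  obtain \<psi>2 where \<psi>2: "classKinf \<psi>2" "\<And>i r. i < n \<Longrightarrow> 0 \<le> r \<Longrightarrow> p2 i r \<le> \<psi>2 r"
    using classKinf_finite_upper[of "{..<n}" p2] p(2) by auto
  have "\<psi>1 (norm x) \<le> maxV x" for x
  proof -
    obtain i where i: "i < n" "norm x / real n \<le> norm (bproj blk i x)"
      using exists_large_block[OF blk_range n_pos] by blast
    have "\<psi>1 (norm x) \<le> p1 i ((1 / real n) * norm x)" using \<psi>1(2)[OF i(1)] by simp
    also have "\<dots> \<le> p1 i (norm (bproj blk i x))"
      using i(2) by (intro classK_le[OF classKinf_classK[OF p(1)[OF i(1)]]]) auto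
    also have "\<dots> \<le> maxV x" using p(3)[OF i(1), of x] scaledV_le_maxV[OF i(1), of x] by simp
    finally show ?thesis .
  qed
  moreover have "maxV x \<le> \<psi>2 (norm x)" for x
  proof -
    obtain i where i: "i < n" "active i x" by (rule maxV_attained)
    then have "maxV x \<le> p2 i (norm (bproj blk i x))" using p(4)[OF i(1), of x] by (simp add: active_def)
    also have "\<dots> \<le> p2 i (norm x)"
      by (intro classK_le[OF classKinf_classK[OF p(2)[OF i(1)]]] norm_bproj_le norm_ge_zero)
    also have "\<dots> \<le> \<psi>2 (norm x)" using \<psi>2(2)[OF i(1)] by simp
    finally show ?thesis .
  qed
  ultimately show ?thesis using \<psi>1(1) \<psi>2(1) unfolding proper_posdef_def by blast
qed

lemma active_block_nonzero:
  assumes "i < n" "x \<noteq> 0" "active i x"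
  shows "bproj blk i x \<noteq> 0"
  using scaledV_pos_iff[OF assms(1), of x] proper_posdef_pos[OF maxV_proper_posdef assms(2)] assms(3) by (simp add: active_def)

lemma scaledV_lipschitz_near:
  assumes i: "i < n" and x: "bproj blk i x \<noteq> 0"
  shows "lipschitz_near (scaledV i) x"
  unfolding scaledV_def[abs_def]
proof (rule lipschitz_near_compose[OF subV_lipschitz_near[OF i x]])
  show "lipschitz_near (Kinv (\<sigma> i)) (subV i x)"
    using path_locLip_Kinv[OF i] subV_pos[OF i x] by (simp add: locLip_open_iff)
qed

lemma maxV_locLip: "locLip (UNIV - {0}) maxV"
proof -
  have "lipschitz_near maxV x" if "x \<noteq> 0" for x
  proof -
    let ?A = "{i \<in> {..<n}. active i x}"
    have "isCont (scaledV i) x" if "i \<in> {..<n}" for i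
      using scaledV_continuous that by (simp add: continuous_on_eq_continuous_at)
    then have eq: "\<forall>\<^sub>F y in nhds x. maxV y = Max ((\<lambda>i. scaledV i y) ` ?A)" and "?A \<noteq> {}"
      using eventually_Max_image_eq_active[where I="{..<n}" and f=scaledV and x=x] n_pos by (auto simp: active_def maxV_def)
    from \<open>?A \<noteq> {}\<close> have "lipschitz_near (\<lambda>y. Max ((\<lambda>i. scaledV i y) ` ?A)) x"
      using active_block_nonzero[OF _ \<open>x \<noteq> 0\<close>] by (intro lipschitz_near_Max_image scaledV_lipschitz_near) auto
    then show ?thesis using lipschitz_near_cong[OF eq] by simp
  qed
  then show ?thesis by (subst locLip_open_iff) auto
qed

text \<open>With \<open>D = id + \<alpha>\<close>, the path condition \<open>D w < \<sigma>\<^sub>i r\<close> for a sum row leaves the room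
  \<open>\<sigma>\<^sub>i r - w > \<alpha> (D\<^sup>-\<^sup>1 (\<sigma>\<^sub>i r))\<close> for the input.\<close>

definition input_margin :: "nat \<Rightarrow> real \<Rightarrow> real" where
  "input_margin i r = (if i \<in> Isum then \<alpha> (Kinv (\<lambda>s. s + \<alpha> s) (\<sigma> i r)) else (1 / 2) * \<sigma> i r)"

lemma id_plus_alpha_classKinf: "classKinf (\<lambda>s. s + \<alpha> s)"
  by (intro classKinf_add classKinf_id classKinf_classK alpha)

lemma input_margin_classKinf:
  assumes i: "i < n"
  shows "classKinf (input_margin i)"
proof -
  have "classKinf (\<lambda>r. \<alpha> (Kinv (\<lambda>s. s + \<alpha> s) (\<sigma> i r)))"
    by (rule classKinf_compose[OF alpha classKinf_compose[OF Kinv_classKinf[OF id_plus_alpha_classKinf] path_classKinf[OF i]]])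
  moreover have "classKinf (\<lambda>r. (1 / 2) * \<sigma> i r)"
    by (rule classKinf_compose[OF classKinf_cmult path_classKinf[OF i]]) simp
  ultimately show ?thesis unfolding input_margin_def[abs_def] by (cases "i \<in> Isum") simp_all
qed

lemma sum_gains_add_input_margin_less:
  assumes i: "i < n" "i \<in> Isum" and r: "0 < r"
  shows "(\<Sum>j<n. \<gamma> i j (\<sigma> j r)) + input_margin i r < \<sigma> i r"
proof -
  let ?w = "\<Sum>j<n. \<gamma> i j (\<sigma> j r)" and ?D = "\<lambda>s. s + \<alpha> s"
  have "0 \<le> ?w"
    using r by (intro sum_nonneg gain_function_nonneg[OF gains[OF i(1)]] classK_nonneg[OF classKinf_classK[OF path_classKinf]]) auto
  moreover have "?D ?w < \<sigma> i r" using path_decrease[OF r i(1)] i(2) by (simp add: Dalpha_def gain_op_def)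
  moreover have "0 \<le> \<sigma> i r" using classK_nonneg[OF classKinf_classK[OF path_classKinf[OF i(1)]], of r] r by simp
  ultimately have "?w < Kinv ?D (\<sigma> i r)" "?D (Kinv ?D (\<sigma> i r)) = \<sigma> i r"
    using less_Kinv_iff[OF id_plus_alpha_classKinf, of ?w "\<sigma> i r"] Kinv_Kinf[OF id_plus_alpha_classKinf, of "\<sigma> i r"]
    by simp_all
  then show ?thesis using i(2) by (simp add: input_margin_def)
qed

lemma threshold_less_if_active:
  assumes i: "i < n" and x: "x \<noteq> 0" and active: "active i x"
    and u: "gi i (norm u) \<le> input_margin i (maxV x)"
  shows "threshold i u x < subV i x"
proof -
  define r where "r = maxV x"
  have r: "0 < r" using proper_posdef_pos[OF maxV_proper_posdef x] by (simp add: r_def)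
  have subV: "subV i x = \<sigma> i r" using subV_eq_if_active[OF i active] by (simp add: r_def)
  have gain_le: "\<gamma> i j (subV j x) \<le> \<gamma> i j (\<sigma> j r)" if j: "j < n" for j
    using subV_le_iff[OF j, of r x] scaledV_le_maxV[OF j, of x] r
    by (intro gain_function_le[OF gains[OF i j]] subV_nonneg j) (simp_all add: r_def)
  show ?thesis
  proof (cases "i \<in> Isum")
    case True
    have "(\<Sum>j<n. \<gamma> i j (subV j x)) \<le> (\<Sum>j<n. \<gamma> i j (\<sigma> j r))" by (intro sum_mono gain_le) auto
    then show ?thesis
      using sum_gains_add_input_margin_less[OF i True r] u True by (simp add: threshold_def subV r_def)
  next
    case False
    have "Max ((\<lambda>j. \<gamma> i j (subV j x)) ` {..<n}) \<le> Max ((\<lambda>j. \<gamma> i j (\<sigma> j r)) ` {..<n})"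
      using n_pos gain_le by (intro Max_image_mono) auto
    also have "\<dots> < \<sigma> i r" using path_decrease[OF r i] False by (simp add: Dalpha_def gain_op_def)
    finally have "Max ((\<lambda>j. \<gamma> i j (subV j x)) ` {..<n}) < \<sigma> i r" .
    moreover have "gi i (norm u) < \<sigma> i r"
      using u classK_pos[OF classKinf_classK[OF path_classKinf[OF i]] r] False by (simp add: input_margin_def r_def)
    ultimately show ?thesis using False by (simp add: threshold_def subV)
  qed
qed

definition dominating_gain :: "(real \<Rightarrow> real) \<Rightarrow> bool" where
  "dominating_gain \<eta> \<longleftrightarrow>
     (\<forall>i<n. \<forall>x u. x \<noteq> 0 \<longrightarrow> active i x \<longrightarrow> \<eta> (norm u) \<le> maxV x \<longrightarrow> threshold i u x < subV i x)"

lemma exists_dominating_gain: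
  obtains \<eta> where "classK \<eta>" "dominating_gain \<eta>"
proof -
  have "classK (\<lambda>r. Kinv (input_margin i) (gi i r))" if "i < n" for i
    by (rule classK_compose[OF classKinf_classK[OF Kinv_classKinf[OF input_margin_classKinf[OF that]]] input_gain_classK[OF that]])
  then obtain \<eta> where \<eta>: "classK \<eta>" "\<And>i r. i < n \<Longrightarrow> 0 \<le> r \<Longrightarrow> Kinv (input_margin i) (gi i r) \<le> \<eta> r"
    using classK_finite_upper[of "{..<n}" "\<lambda>i r. Kinv (input_margin i) (gi i r)"] by auto
  have "threshold i u x < subV i x"
    if i: "i < n" "active i x" and x: "x \<noteq> 0" and u: "\<eta> (norm u) \<le> maxV x" for i x u
  proof (rule threshold_less_if_active[OF i(1) x i(2)])
    have "0 \<le> gi i (norm u)" using input_gain_classK[OF i(1)] by (rule classK_nonneg) simp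
    moreover have "Kinv (input_margin i) (gi i (norm u)) \<le> maxV x" using \<eta>(2)[OF i(1), of "norm u"] u by simp
    ultimately show "gi i (norm u) \<le> input_margin i (maxV x)"
      using Kinv_le_iff[OF input_margin_classKinf[OF i(1)]] proper_posdef_pos[OF maxV_proper_posdef x] by simp
  qed
  then show ?thesis using that[OF \<eta>(1)] by (simp add: dominating_gain_def)
qed

lemma active_subV_bounds:
  assumes i: "i < n" and a: "0 < a"
  obtains v1 v2 where "0 < v1" "\<And>x. norm x \<in> {a..b} \<Longrightarrow> active i x \<Longrightarrow> subV i x \<in> {v1..v2}"
proof -
  obtain \<psi>1 \<psi>2 where \<psi>: "classKinf \<psi>1" "classKinf \<psi>2" "\<And>x. \<psi>1 (norm x) \<le> maxV x" "\<And>x. maxV x \<le> \<psi>2 (norm x)"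
    using maxV_proper_posdef unfolding proper_posdef_def by blast
  note K = classKinf_classK[OF \<psi>(1)] classKinf_classK[OF \<psi>(2)] classKinf_classK[OF path_classKinf[OF i]]
  show ?thesis
  proof (rule that)
    show "0 < \<sigma> i (\<psi>1 a)" by (intro classK_pos[OF K(3)] classK_pos[OF K(1)] a)
    fix x assume x: "norm x \<in> {a..b}" "active i x"
    have "\<psi>1 a \<le> maxV x" using classK_le[OF K(1), of a "norm x"] \<psi>(3)[of x] x a by simp
    moreover have "maxV x \<le> \<psi>2 b" using classK_le[OF K(2), of "norm x" b] \<psi>(4)[of x] x a by simp
    moreover have "0 \<le> \<psi>1 a" "0 \<le> maxV x"
      using classK_nonneg[OF K(1), of a] a proper_posdef_nonneg[OF maxV_proper_posdef] by auto
    ultimately show "subV i x \<in> {\<sigma> i (\<psi>1 a)..\<sigma> i (\<psi>2 b)}"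
      using subV_eq_if_active[OF i x(2)] by (auto intro: classK_le[OF K(3)])
  qed
qed

lemma active_block_norm_bound:
  assumes i: "i < n" and a: "0 < a"
  obtains l where "0 < l" "\<And>x. norm x \<in> {a..b} \<Longrightarrow> active i x \<Longrightarrow> norm (bproj blk i x) \<in> {l..b}"
proof -
  obtain v1 v2 where v: "0 < v1" "\<And>x. norm x \<in> {a..b} \<Longrightarrow> active i x \<Longrightarrow> subV i x \<in> {v1..v2}"
    using active_subV_bounds[OF i a] by blast
  obtain \<psi>1 \<psi> where "classKinf \<psi>1" and \<psi>: "classKinf \<psi>"
    and "\<And>x. \<psi>1 (norm (bproj blk i x)) \<le> subV i x" and subV_le: "\<And>x. subV i x \<le> \<psi> (norm (bproj blk i x))"
    using subV_bounds[OF i] by blast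
  show ?thesis
  proof (rule that)
    show "0 < Kinv \<psi> v1" by (rule classK_pos[OF classKinf_classK[OF Kinv_classKinf[OF \<psi>]] v(1)])
    fix x assume x: "norm x \<in> {a..b}" "active i x"
    have "v1 \<le> \<psi> (norm (bproj blk i x))" using v(2)[OF x] subV_le[of x] by simp
    then have "Kinv \<psi> v1 \<le> norm (bproj blk i x)" using Kinv_le_iff[OF \<psi>] v(1) by simp
    then show "norm (bproj blk i x) \<in> {Kinv \<psi> v1..b}" using norm_bproj_le[of blk i x] x(1) by simp
  qed
qed

lemma active_scaledV_dini_decrease:
  assumes i: "i < n" and a: "0 < a"
  obtains e where "0 < e"
    "\<And>x u. norm x \<in> {a..b} \<Longrightarrow> active i x \<Longrightarrow> threshold i u x < subV i x \<Longrightarrow> dini_decrease (scaledV i) x (F x u) e"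
proof -
  obtain v1 v2 where v: "0 < v1" "\<And>x. norm x \<in> {a..b} \<Longrightarrow> active i x \<Longrightarrow> subV i x \<in> {v1..v2}"
    using active_subV_bounds[OF i a] by blast
  obtain l where l: "0 < l" "\<And>x. norm x \<in> {a..b} \<Longrightarrow> active i x \<Longrightarrow> norm (bproj blk i x) \<in> {l..b}"
    using active_block_norm_bound[OF i a] by blast
  obtain m where m: "0 < m" "\<And>r. r \<in> {l..b} \<Longrightarrow> m \<le> \<alpha>i i r"
    using posdef_bounded_below[OF rate_posdef[OF i] l(1)] by blast
  have "0 < v1 / 2" "v1 / 2 \<le> max v1 v2" using v(1) by auto
  then obtain c where c: "0 < c" "slope_ge c {v1 / 2..max v1 v2} (Kinv (\<sigma> i))"
    using path_positive_slopes[OF i] unfolding positive_slopes_def by meson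
  show ?thesis
  proof (rule that)
    show "0 < c * m" using c(1) m(1) by simp
    fix x u assume x: "norm x \<in> {a..b}" "active i x" and less: "threshold i u x < subV i x"
    have subV: "subV i x \<in> {v1..v2}" by (rule v(2)[OF x])
    have "x \<noteq> 0" using x(1) a by auto
    then have "dini_decrease (subV i) x (F x u) (\<alpha>i i (norm (bproj blk i x)))"
      using active_block_nonzero[OF i _ x(2)] by (intro subV_dini_decrease[OF i _ less]) blast
    then have decrease: "dini_decrease (subV i) x (F x u) m" by (rule dini_decrease_mono) (rule m(2)[OF l(2)[OF x]])
    show "dini_decrease (scaledV i) x (F x u) (c * m)"
      unfolding scaledV_def[abs_def]
    proof (rule dini_decrease_compose[OF decrease])
      show "mono_on {0..} (Kinv (\<sigma> i))" by (intro mono_onI) (auto intro: classK_le[OF path_Kinv_classK[OF i]])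
      fix e :: real assume "0 < e"
      show "\<forall>\<^sub>F t in at_left (subV i x). (c - e) * (subV i x - t) \<le> Kinv (\<sigma> i) (subV i x) - Kinv (\<sigma> i) t"
      proof (rule eventually_at_leftI)
        show "v1 / 2 < subV i x" using subV v(1) by auto
        fix t assume t: "t \<in> {v1 / 2<..<subV i x}"
        have "(c - e) * (subV i x - t) \<le> c * (subV i x - t)" using t \<open>0 < e\<close> by (intro mult_right_mono) auto
        also have "\<dots> \<le> Kinv (\<sigma> i) (subV i x) - Kinv (\<sigma> i) t" using t subV by (intro slope_geD[OF c(2)]) auto
        finally show "(c - e) * (subV i x - t) \<le> Kinv (\<sigma> i) (subV i x) - Kinv (\<sigma> i) t" .
      qed
    qed (use m(1) c(1) subV v(1) subV_nonneg[OF i] in auto)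
  qed
qed

lemma maxV_dini_decrease_on_annulus:
  assumes a: "0 < a"
    and \<eta>: "dominating_gain \<eta>"
  obtains e where "0 < e"
    "\<And>x u. norm x \<in> {a..b} \<Longrightarrow> \<eta> (norm u) \<le> maxV x \<Longrightarrow> dini_decrease maxV x (F x u) e"
proof -
  have "\<exists>e>0. \<forall>x u. norm x \<in> {a..b} \<longrightarrow> active i x \<longrightarrow>
      threshold i u x < subV i x \<longrightarrow> dini_decrease (scaledV i) x (F x u) e" if "i < n" for i
    by (rule active_scaledV_dini_decrease[OF that a, of b]) blast
  then obtain e where e: "\<And>i. i < n \<Longrightarrow> 0 < e i"
    "\<And>i x u. i < n \<Longrightarrow> norm x \<in> {a..b} \<Longrightarrow> active i x \<Longrightarrow> threshold i u x < subV i x \<Longrightarrow>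
       dini_decrease (scaledV i) x (F x u) (e i)"
    by metis
  obtain e0 where e0: "0 < e0" "\<And>i. i < n \<Longrightarrow> e0 \<le> e i"
    using finite_positive_lower_bound[of "{..<n}" e] e(1) by auto
  show ?thesis
  proof (rule that[OF e0(1)])
    fix x and u :: "real^'m" assume x: "norm x \<in> {a..b}" and u: "\<eta> (norm u) \<le> maxV x"
    show "dini_decrease maxV x (F x u) e0"
      unfolding maxV_def[abs_def]
    proof (rule dini_decrease_Max_image)
      show "isCont (scaledV i) x" if "i \<in> {..<n}" for i
        using scaledV_continuous that by (simp add: continuous_on_eq_continuous_at)
      fix i assume "i \<in> {..<n}" "scaledV i x = Max ((\<lambda>i. scaledV i x) ` {..<n})"
      then have i: "i < n" "active i x" by (auto simp: active_def maxV_def)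
      have "x \<noteq> 0" using x a by auto
      then have "threshold i u x < subV i x" using \<eta> i u unfolding dominating_gain_def by blast
      then show "dini_decrease (scaledV i) x (F x u) e0"
        using dini_decrease_mono[OF e(2)[OF i(1) x i(2)] e0(2)[OF i(1)]] by blast
    qed (use n_pos in auto)
  qed
qed

lemma maxV_dini_Lyap: "dini_Lyap F maxV"
proof -
  obtain \<eta> where \<eta>: "classK \<eta>" "dominating_gain \<eta>"
    using exists_dominating_gain by blast
  define P where
    "P = (\<lambda>\<rho> e. \<forall>x u. norm x = \<rho> \<longrightarrow> \<eta> (norm u) \<le> maxV x \<longrightarrow> dini_decrease maxV x (F x u) e)"
  have mono: "P \<rho> e'" if "P \<rho> e" "0 < e'" "e' \<le> e" for \<rho> e e'
    using that dini_decrease_mono unfolding P_def by blast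
  have "\<exists>e>0. \<forall>\<rho>\<in>{a..b}. P \<rho> e" if "0 < a" "a \<le> b" for a b
    by (rule maxV_dini_decrease_on_annulus[OF \<open>0 < a\<close> \<eta>(2), where b=b]) (auto simp: P_def)
  then obtain q where q: "posdef q" "\<And>\<rho>. 0 < \<rho> \<Longrightarrow> P \<rho> (q \<rho>) \<and> q \<rho> \<le> \<rho>"
    using posdef_minorant[of P] mono by blast
  have "dini_decrease maxV x (F x u) (q (norm x))" if "x \<noteq> 0" "\<eta> (norm u) \<le> maxV x" for x u
    using q(2)[of "norm x"] that unfolding P_def by simp
  then show ?thesis
    unfolding dini_Lyap_def using maxV_continuous maxV_proper_posdef maxV_locLip \<eta>(1) q(1) by blast
qed

end

section \<open>From Dini decrease to an estimate of class KL\<close>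

lemma classKL_exp:
  assumes A: "classKinf A" and B: "classKinf B"
  shows "classKL (\<lambda>r t. A (B r * exp (- t)))"
  unfolding classKL_def
proof (intro conjI allI impI)
  note K = classKinf_classK[OF A] classKinf_classK[OF B]
  have B_nonneg: "0 \<le> B r" if "0 \<le> r" for r by (rule classK_nonneg[OF K(2) that])
  have "continuous_on ({0..} \<times> {0..}) (\<lambda>p::real \<times> real. B (fst p))"
    by (rule continuous_on_compose2[OF classK_cont[OF K(2)] continuous_on_fst[OF continuous_on_id]]) auto
  then have "continuous_on ({0..} \<times> {0..}) (\<lambda>p. B (fst p) * exp (- snd p))"
    by (intro continuous_on_mult continuous_on_exp continuous_on_minus continuous_on_snd[OF continuous_on_id])
  then have "continuous_on ({0..} \<times> {0..}) (\<lambda>p. A (B (fst p) * exp (- snd p)))"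
    by (rule continuous_on_compose2[OF classK_cont[OF K(1)]]) (auto simp: B_nonneg)
  then show "continuous_on ({0..} \<times> {0..}) (\<lambda>(r, t). A (B r * exp (- t)))" by (simp add: case_prod_unfold)
  show "classK (\<lambda>r. A (B r * exp (- t)))" for t
  proof -
    have "classKinf (\<lambda>r. A (exp (- t) * B r))"
      by (rule classKinf_compose[OF A classKinf_compose[OF classKinf_cmult B]]) simp
    then show ?thesis using classKinf_classK by (simp add: mult.commute)
  qed
  fix r :: real assume r: "0 \<le> r"
  show "A (B r * exp (- t2)) \<le> A (B r * exp (- t1))" if "0 \<le> t1" "t1 \<le> t2" for t1 t2
    using that B_nonneg[OF r] by (intro classK_le[OF K(1)] mult_left_mono) auto
  have "((\<lambda>t. B r * exp (- t)) \<longlongrightarrow> B r * 0) at_top"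
    by (intro tendsto_mult tendsto_const filterlim_compose[OF exp_at_bot] filterlim_uminus_at_bot_at_top)
  then have "((\<lambda>t. A (B r * exp (- t))) \<longlongrightarrow> A 0) at_top"
    using B_nonneg[OF r] by (intro continuous_on_tendsto_compose[OF classK_cont[OF K(1)]]) auto
  then show "((\<lambda>t. A (B r * exp (- t))) \<longlongrightarrow> 0) at_top" by (simp add: classK_zero[OF K(1)])
qed

lemma exists_primitive_on_pos:
  fixes f :: "real \<Rightarrow> real"
  assumes cont: "continuous_on {0<..} f"
  obtains G where "\<And>s. 0 < s \<Longrightarrow> (G has_real_derivative f s) (at s)"
proof (rule that)
  fix s :: real assume s: "0 < s"
  define a b where "a = min 1 s / 2" and "b = max 1 s + 1"
  have ab: "0 < a" "a < s" "s < b" "a \<le> 1" "1 \<le> b" using s by (auto simp: a_def b_def min_def)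
  have "continuous_on {a..b} f" using ab by (intro continuous_on_subset[OF cont]) auto
  then have "((\<lambda>s. LBINT y=ereal 1..ereal s. f y) has_vector_derivative f s) (at s within {a..b})"
    using ab by (intro interval_integral_FTC2) auto
  then have "((\<lambda>s. LBINT y=ereal 1..ereal s. f y) has_vector_derivative f s) (at s)"
    using ab at_within_Icc_at[of a s b] by simp
  then show "((\<lambda>s. LBINT y=ereal 1..ereal s. f y) has_real_derivative f s) (at s)"
    by (simp add: has_real_derivative_iff_has_vector_derivative)
qed

lemma classKinf_exp_primitive:
  fixes G :: "real \<Rightarrow> real"
  assumes G: "\<And>s. 0 < s \<Longrightarrow> (G has_real_derivative g s) (at s)" and g: "\<And>s. 0 < s \<Longrightarrow> 1 / s \<le> g s"
  shows "classKinf (\<lambda>s. if s \<le> 0 then 0 else exp (G s))"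
proof (rule classKinf_extend_0)
  have mono: "G s - ln s \<le> G t - ln t" if st: "0 < s" "s \<le> t" for s t
  proof (rule DERIV_nonneg_imp_nondecreasing[OF st(2)])
    fix x assume "s \<le> x" "x \<le> t"
    then have x: "0 < x" using st by simp
    have "((\<lambda>x. G x - ln x) has_real_derivative g x - 1 / x) (at x)"
      using x G[OF x] by (auto intro!: derivative_eq_intros simp: inverse_eq_divide)
    then show "\<exists>y. ((\<lambda>x. G x - ln x) has_real_derivative y) (at x) \<and> 0 \<le> y" using g[OF x] by force
  qed
  have exp_eq: "exp (G 1 + ln s) = exp (G 1) * s" if "0 < s" for s using that by (simp add: exp_add)
  have below: "exp (G s) \<le> exp (G 1) * s" if "0 < s" "s \<le> 1" for s
    unfolding exp_eq[OF that(1), symmetric] using mono[OF that] by simp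
  have above: "exp (G 1) * s \<le> exp (G s)" if "1 \<le> s" for s
    using mono[of 1 s] that exp_eq[of s, symmetric] by simp
  show "continuous_on {0<..} (\<lambda>s. exp (G s))"
    by (intro continuous_on_exp continuous_at_imp_continuous_on ballI DERIV_isCont[OF G]) simp
  show "strict_mono_on {0<..} (\<lambda>s. exp (G s))"
  proof (rule strict_mono_onI)
    fix s t :: real assume "s \<in> {0<..}" "t \<in> {0<..}" "s < t"
    then have "ln s < ln t" "G s - ln s \<le> G t - ln t" using mono[of s t] by simp_all
    then have "G s < G t" by linarith
    then show "exp (G s) < exp (G t)" by simp
  qed
  show "((\<lambda>s. exp (G s)) \<longlongrightarrow> 0) (at_right 0)"
  proof (rule tendsto_sandwich)
    show "\<forall>\<^sub>F s in at_right 0. exp (G s) \<le> exp (G 1) * s"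
      using below by (intro eventually_at_rightI[of 0 1]) auto
    show "((\<lambda>_. 0) \<longlongrightarrow> (0::real)) (at_right (0::real))" by (rule tendsto_const)
    show "((\<lambda>s. exp (G 1) * s) \<longlongrightarrow> 0) (at_right 0)" by (rule tendsto_eq_intros | simp)+
  qed simp
  show "filterlim (\<lambda>s. exp (G s)) at_top at_top"
  proof (rule filterlim_at_top_mono)
    show "filterlim (\<lambda>s. exp (G 1) * s) at_top at_top"
      by (rule filterlim_tendsto_pos_mult_at_top[OF tendsto_const _ filterlim_ident]) simp
    show "\<forall>\<^sub>F s in at_top. exp (G 1) * s \<le> exp (G s)"
      using eventually_ge_at_top[of 1] by eventually_elim (rule above)
  qed
qed

text \<open>If \<open>v\<close> decreases at rate \<open>\<kappa> v\<close>, then \<open>H v\<close> decreases at rate \<open>H v\<close>.\<close>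

lemma exists_exponential_rescaling:
  fixes \<kappa> :: "real \<Rightarrow> real"
  assumes cont: "continuous_on {0<..} \<kappa>" and \<kappa>: "\<And>s. 0 < s \<Longrightarrow> 0 < \<kappa> s \<and> \<kappa> s \<le> s"
  obtains H where "classKinf H" "\<And>s. 0 < s \<Longrightarrow> (H has_real_derivative H s / \<kappa> s) (at s)"
proof -
  have "continuous_on {0<..} (\<lambda>s. 1 / \<kappa> s)"
    using \<kappa> by (intro continuous_on_divide continuous_on_const cont) (auto simp: less_imp_neq[symmetric])
  then obtain G where G: "\<And>s. 0 < s \<Longrightarrow> (G has_real_derivative 1 / \<kappa> s) (at s)"
    by (rule exists_primitive_on_pos) blast
  define H where "H = (\<lambda>s. if s \<le> 0 then 0 else exp (G s))"
  have "1 / s \<le> 1 / \<kappa> s" if "0 < s" for s using \<kappa>[OF that] by (simp add: frac_le)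
  with G have "classKinf H" unfolding H_def by (rule classKinf_exp_primitive)
  moreover have "(H has_real_derivative H s / \<kappa> s) (at s)" if s: "0 < s" for s
  proof (rule has_field_derivative_transform_within_open)
    show "((\<lambda>s. exp (G s)) has_real_derivative H s / \<kappa> s) (at s)"
      using G[OF s] s by (auto intro!: derivative_eq_intros simp: H_def)
    show "open {0::real<..}" "s \<in> {0<..}" using s by auto
    show "\<And>x. x \<in> {0<..} \<Longrightarrow> exp (G x) = H x" by (simp add: H_def)
  qed
  ultimately show ?thesis by (rule that)
qed

lemma exists_rate_of_value:
  fixes V :: "'a::real_normed_vector \<Rightarrow> real"
  assumes V: "proper_posdef V" and \<alpha>: "posdef \<alpha>"
  obtains \<kappa> where "continuous_on {0<..} \<kappa>" "\<And>s. 0 < s \<Longrightarrow> 0 < \<kappa> s \<and> \<kappa> s \<le> s"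
    "\<And>x. x \<noteq> 0 \<Longrightarrow> \<kappa> (V x) \<le> \<alpha> (norm x)"
proof -
  obtain \<psi>1 \<psi>2 where \<psi>: "classKinf \<psi>1" "classKinf \<psi>2" "\<And>x. \<psi>1 (norm x) \<le> V x" "\<And>x. V x \<le> \<psi>2 (norm x)"
    using V unfolding proper_posdef_def by blast
  define P where "P = (\<lambda>v e. \<forall>x. V x = v \<longrightarrow> e \<le> \<alpha> (norm x))"
  have mono: "P v e'" if "P v e" "0 < e'" "e' \<le> e" for v e e'
    using that unfolding P_def by fastforce
  have "\<exists>e>0. \<forall>v\<in>{a..b}. P v e" if ab: "0 < a" "a \<le> b" for a b
  proof -
    have "0 < Kinv \<psi>2 a"
      using ab by (intro classK_pos[OF classKinf_classK[OF Kinv_classKinf[OF \<psi>(2)]]])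
    then obtain e where e: "0 < e" "\<And>r. r \<in> {Kinv \<psi>2 a..Kinv \<psi>1 b} \<Longrightarrow> e \<le> \<alpha> r"
      using posdef_bounded_below[OF \<alpha>] by blast
    have "e \<le> \<alpha> (norm x)" if x: "V x \<in> {a..b}" for x
    proof (rule e(2))
      have "a \<le> \<psi>2 (norm x)" "\<psi>1 (norm x) \<le> b" using \<psi>(3)[of x] \<psi>(4)[of x] x by auto
      then show "norm x \<in> {Kinv \<psi>2 a..Kinv \<psi>1 b}"
        using ab Kinv_le_iff[OF \<psi>(2)] Kinv_less_iff[OF \<psi>(1)] by (simp flip: not_less)
    qed
    then show ?thesis using e(1) unfolding P_def by blast
  qed
  then obtain \<kappa> where \<kappa>: "posdef \<kappa>" "\<And>v. 0 < v \<Longrightarrow> P v (\<kappa> v) \<and> \<kappa> v \<le> v"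
    using posdef_minorant[of P] mono by blast
  show ?thesis
  proof (rule that)
    show "continuous_on {0<..} \<kappa>" using \<kappa>(1) by (rule posdef_continuous_on) auto
    show "0 < \<kappa> s \<and> \<kappa> s \<le> s" if "0 < s" for s using \<kappa> posdef_pos that by blast
    show "\<kappa> (V x) \<le> \<alpha> (norm x)" if "x \<noteq> 0" for x
      using \<kappa>(2)[OF proper_posdef_pos[OF V that]] by (simp add: P_def)
  qed
qed

definition exponential_dini_Lyap ::
    "('a::real_normed_vector \<Rightarrow> 'b::real_normed_vector \<Rightarrow> 'a) \<Rightarrow> (real \<Rightarrow> real) \<Rightarrow> ('a \<Rightarrow> real) \<Rightarrow> bool" where
  "exponential_dini_Lyap F \<gamma> U \<longleftrightarrow> continuous_on UNIV U \<and> proper_posdef U \<and> locLip (UNIV - {0}) U \<and> classK \<gamma> \<and>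
     (\<forall>x u. x \<noteq> 0 \<longrightarrow> \<gamma> (norm u) \<le> U x \<longrightarrow> dini_decrease U x (F x u) (U x))"

lemma proper_posdef_classKinf_compose:
  assumes V: "proper_posdef V" and H: "classKinf H"
  shows "proper_posdef (\<lambda>x. H (V x))"
proof -
  obtain \<psi>1 \<psi>2 where \<psi>: "classKinf \<psi>1" "classKinf \<psi>2" "\<And>x. \<psi>1 (norm x) \<le> V x" "\<And>x. V x \<le> \<psi>2 (norm x)"
    using V unfolding proper_posdef_def by blast
  have "H (\<psi>1 (norm x)) \<le> H (V x)" "H (V x) \<le> H (\<psi>2 (norm x))" for x
    using \<psi> classK_nonneg[OF classKinf_classK[OF \<psi>(1)]] proper_posdef_nonneg[OF V]
    by (auto intro!: classK_le[OF classKinf_classK[OF H]])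
  then show ?thesis
    unfolding proper_posdef_def using classKinf_compose[OF H \<psi>(1)] classKinf_compose[OF H \<psi>(2)] by blast
qed

lemma dini_decrease_compose_derivative:
  fixes f :: "'a::real_normed_vector \<Rightarrow> real"
  assumes dini: "dini_decrease f x w a" "0 < a" and f: "\<And>y. 0 \<le> f y" "0 < f x"
    and mono: "mono_on {0..} H" and H: "(H has_real_derivative c) (at (f x))" "0 \<le> c"
  shows "dini_decrease (\<lambda>y. H (f y)) x w (c * a)"
proof (rule dini_decrease_compose[OF dini H(2) f mono])
  fix e :: real assume "0 < e"
  have "((\<lambda>t. (H t - H (f x)) / (t - f x)) \<longlongrightarrow> c) (at_left (f x))"
    using H(1) unfolding has_field_derivative_iff by (rule tendsto_within_subset) simp
  then have "\<forall>\<^sub>F t in at_left (f x). c - e < (H t - H (f x)) / (t - f x)"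
    by (rule order_tendstoD) (use \<open>0 < e\<close> in simp)
  moreover have "\<forall>\<^sub>F t in at_left (f x). t < f x" by (simp add: eventually_at_filter)
  ultimately show "\<forall>\<^sub>F t in at_left (f x). (c - e) * (f x - t) \<le> H (f x) - H t"
    by eventually_elim (simp add: field_simps)
qed

lemma locLip_compose_continuous_derivative:
  fixes f :: "'a::metric_space \<Rightarrow> real"
  assumes "open S" "locLip S f" "open T" "f ` S \<subseteq> T" and cont: "continuous_on T h'"
    and deriv: "\<And>y. y \<in> T \<Longrightarrow> (h has_real_derivative h' y) (at y)"
  shows "locLip S (\<lambda>x. h (f x))"
  unfolding locLip_open_iff[OF \<open>open S\<close>]
proof
  fix x assume "x \<in> S"
  then have "f x \<in> T" using assms(4) by blast
  then have "lipschitz_near h (f x)" by (rule lipschitz_near_if_continuous_derivative[OF \<open>open T\<close> _ cont deriv])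
  moreover have "lipschitz_near f x" using assms(2) \<open>x \<in> S\<close> by (simp add: locLip_open_iff[OF \<open>open S\<close>])
  ultimately show "lipschitz_near (\<lambda>x. h (f x)) x" by (rule lipschitz_near_compose[rotated])
qed

lemma dini_Lyap_imp_exponential:
  assumes V: "dini_Lyap F V"
  obtains \<gamma> U where "exponential_dini_Lyap F \<gamma> U"
proof -
  have cont: "continuous_on UNIV V" and proper: "proper_posdef V" and lip: "locLip (UNIV - {0}) V"
    using V by (auto simp: dini_Lyap_def)
  obtain \<gamma> \<alpha> where \<gamma>: "classK \<gamma>" and \<alpha>: "posdef \<alpha>"
    and dini: "\<And>x u. x \<noteq> 0 \<Longrightarrow> \<gamma> (norm u) \<le> V x \<Longrightarrow> dini_decrease V x (F x u) (\<alpha> (norm x))"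
    using V unfolding dini_Lyap_def by blast
  obtain \<kappa> where \<kappa>_cont: "continuous_on {0<..} \<kappa>" and \<kappa>: "\<And>s. 0 < s \<Longrightarrow> 0 < \<kappa> s \<and> \<kappa> s \<le> s"
    and \<kappa>_le: "\<And>x. x \<noteq> 0 \<Longrightarrow> \<kappa> (V x) \<le> \<alpha> (norm x)"
    using exists_rate_of_value[OF proper \<alpha>] by blast
  obtain H where H: "classKinf H" "\<And>s. 0 < s \<Longrightarrow> (H has_real_derivative H s / \<kappa> s) (at s)"
    using exists_exponential_rescaling[OF \<kappa>_cont \<kappa>] by blast
  note K = classKinf_classK[OF H(1)]
  note V_pos = proper_posdef_pos[OF proper] and V_nonneg = proper_posdef_nonneg[OF proper]
  have rate_cont: "continuous_on {0<..} (\<lambda>s. H s / \<kappa> s)"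
    using \<kappa> by (intro continuous_on_divide \<kappa>_cont continuous_on_subset[OF classK_cont[OF K]])
      (auto simp: less_imp_neq[symmetric])
  have "continuous_on UNIV (\<lambda>x. H (V x))"
    by (rule continuous_on_compose2[OF classK_cont[OF K] cont]) (auto simp: V_nonneg)
  moreover have "locLip (UNIV - {0}) (\<lambda>x. H (V x))"
    by (rule locLip_compose_continuous_derivative[OF open_delete[OF open_UNIV] lip open_greaterThan _ rate_cont])
      (use V_pos H(2) in auto)
  moreover have "dini_decrease (\<lambda>x. H (V x)) x (F x u) (H (V x))" if x: "x \<noteq> 0" and u: "H (\<gamma> (norm u)) \<le> H (V x)" for x u
  proof -
    have \<kappa>V: "0 < \<kappa> (V x)" using \<kappa> V_pos[OF x] by blast
    have "\<gamma> (norm u) \<le> V x" using u classK_le_iff[OF K] classK_nonneg[OF \<gamma>] V_nonneg by simp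
    then have "dini_decrease V x (F x u) (\<kappa> (V x))" using dini_decrease_mono[OF dini[OF x] \<kappa>_le[OF x]] by blast
    moreover have "mono_on {0..} H" by (intro mono_onI) (auto intro: classK_le[OF K])
    moreover have "0 \<le> H (V x) / \<kappa> (V x)" using classK_nonneg[OF K V_nonneg] \<kappa>V by simp
    ultimately have "dini_decrease (\<lambda>x. H (V x)) x (F x u) (H (V x) / \<kappa> (V x) * \<kappa> (V x))"
      using \<kappa>V V_nonneg V_pos[OF x] H(2)[OF V_pos[OF x]] by (intro dini_decrease_compose_derivative)
    then show ?thesis using \<kappa>V by simp
  qed
  ultimately have "exponential_dini_Lyap F (\<lambda>r. H (\<gamma> r)) (\<lambda>x. H (V x))"
    using proper_posdef_classKinf_compose[OF proper H(1)] classK_compose[OF K \<gamma>]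
    by (simp add: exponential_dini_Lyap_def)
  then show ?thesis by (rule that)
qed

section \<open>Decay along solutions\<close>

lemma has_integral_bound_AE:
  fixes f :: "real \<Rightarrow> 'x::euclidean_space"
  assumes f: "(f has_integral I) {a..b}" and "a \<le> b" and "0 \<le> B"
    and bound: "AE t in lborel. a \<le> t \<longrightarrow> t \<le> b \<longrightarrow> norm (f t) \<le> B"
  shows "norm I \<le> B * (b - a)"
proof -
  let ?g = "\<lambda>t. if norm (f t) \<le> B then f t else 0"
  have eq: "AE t in lborel. t \<in> {a..b} \<longrightarrow> f t = ?g t" using bound by (rule eventually_mono) auto
  have "(?g has_integral I) {a..b}" using f unfolding has_integral_AE[OF eq] .
  then show ?thesis
    using has_integral_bound[of B ?g I a b] \<open>0 \<le> B\<close> \<open>a \<le> b\<close> by auto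
qed

lemma solution_increment:
  assumes sol: "is_solution F u x T" and st: "0 \<le> s" "s \<le> t" "t \<le> T"
  shows "((\<lambda>r. F (x r) (u r)) has_integral (x t - x s)) {s..t}"
proof -
  let ?f = "\<lambda>r. F (x r) (u r)"
  have t: "(?f has_integral (x t - x 0)) {0..t}" and s: "(?f has_integral (x s - x 0)) {0..s}"
    using sol st unfolding is_solution_def by auto
  have "?f integrable_on {0..t}" using t by (rule has_integral_integrable)
  then have "?f integrable_on {s..t}" by (rule integrable_subinterval_real) (use st in auto)
  then obtain I where I: "(?f has_integral I) {s..t}" by blast
  have "(?f has_integral ((x s - x 0) + I)) {0..t}" by (rule has_integral_combine[OF st(1,2) s I])
  then have "(x s - x 0) + I = x t - x 0" using t has_integral_unique by blast
  then have "I = x t - x s" by (simp add: algebra_simps)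
  then show ?thesis using I by simp
qed

lemma continuous_bounded_on_compact:
  fixes F :: "'x::euclidean_space \<Rightarrow> 'm::euclidean_space \<Rightarrow> 'y::real_normed_vector"
  assumes F: "continuous_on UNIV (case_prod F)" and S: "compact S"
  obtains K where "0 < K" "\<And>x v. x \<in> S \<Longrightarrow> norm v \<le> c \<Longrightarrow> norm (F x v) \<le> K"
proof -
  have "compact (case_prod F ` (S \<times> cball (0::'m) c))"
    by (intro compact_continuous_image continuous_on_subset[OF F] compact_Times S compact_cball) auto
  then obtain K where K: "0 < K" "\<And>y. y \<in> case_prod F ` (S \<times> cball (0::'m) c) \<Longrightarrow> norm y \<le> K"
    using compact_imp_bounded bounded_pos by metis
  show ?thesis
    by (rule that[OF K(1)]) (auto intro!: K(2) image_eqI[of _ "case_prod F" "(_, _)"])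
qed

definition essentially_bounded :: "real \<Rightarrow> (real \<Rightarrow> 'm::real_normed_vector) \<Rightarrow> bool" where
  "essentially_bounded c u \<longleftrightarrow> (AE t in lborel. 0 \<le> t \<longrightarrow> norm (u t) \<le> c)"

lemma solution_lipschitz:
  fixes F :: "'x::euclidean_space \<Rightarrow> 'm::euclidean_space \<Rightarrow> 'x"
  assumes F: "continuous_on UNIV (case_prod F)" and sol: "is_solution F u x T"
    and u: "essentially_bounded c u"
  obtains K where "K-lipschitz_on {0..T} x"
proof -
  have "compact (x ` {0..T})" using sol by (intro compact_continuous_image compact_Icc) (simp add: is_solution_def)
  then obtain K where K: "0 < K" "\<And>y v. y \<in> x ` {0..T} \<Longrightarrow> norm v \<le> c \<Longrightarrow> norm (F y v) \<le> K"
    using continuous_bounded_on_compact[OF F] by blast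
  have "K-lipschitz_on {0..T} x"
  proof (rule lipschitz_on_leI)
    fix s t assume st: "s \<in> {0..T}" "t \<in> {0..T}" "s \<le> t"
    have "norm (x t - x s) \<le> K * (t - s)"
    proof (rule has_integral_bound_AE[OF solution_increment[OF sol] st(3)])
      show "AE r in lborel. s \<le> r \<longrightarrow> r \<le> t \<longrightarrow> norm (F (x r) (u r)) \<le> K"
        using u unfolding essentially_bounded_def by eventually_elim (use st in \<open>auto intro: K(2)\<close>)
    qed (use st K in auto)
    then show "dist (x s) (x t) \<le> K * dist s t" using st by (simp add: dist_norm norm_minus_commute)
  qed (use K in auto)
  then show ?thesis by (rule that)
qed

lemma solution_right_derivative_AE:
  fixes F :: "'x::euclidean_space \<Rightarrow> 'm::euclidean_space \<Rightarrow> 'x"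
  assumes sol: "is_solution F u x T"
  shows "AE t in lborel. 0 < t \<longrightarrow> t < T \<longrightarrow> ((\<lambda>h. (x (t + h) - x t) /\<^sub>R h) \<longlongrightarrow> F (x t) (u t)) (at_right 0)"
proof (cases "0 \<le> T")
  case True
  let ?f = "\<lambda>r. F (x r) (u r)"
  let ?g = "\<lambda>r. if r \<in> {0..T} then ?f r else 0"
  have "?f integrable_on {0..T}" using solution_increment[OF sol order_refl True order_refl] by (rule has_integral_integrable)
  then have "?g integrable_on UNIV" by (simp only: integrable_restrict_UNIV)
  then have "?g integrable_on {a..b}" for a b by (rule integrable_on_subinterval) simp
  from integral_average_tendsto_AE[OF this] show ?thesis
  proof (eventually_elim, intro impI)
    fix t assume lim: "((\<lambda>h. integral {t..t + h} ?g /\<^sub>R h) \<longlongrightarrow> ?g t) (at_right 0)" and t: "0 < t" "t < T"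
    have "\<forall>\<^sub>F h in at_right 0. integral {t..t + h} ?g /\<^sub>R h = (x (t + h) - x t) /\<^sub>R h"
    proof (rule eventually_at_rightI)
      show "0 < T - t" using t by simp
      fix h assume h: "h \<in> {0<..<T - t}"
      have "(?f has_integral (x (t + h) - x t)) {t..t + h}"
        using t h by (intro solution_increment[OF sol]) auto
      then have "(?g has_integral (x (t + h) - x t)) {t..t + h}"
        by (rule has_integral_eq[rotated]) (use t h in auto)
      then show "integral {t..t + h} ?g /\<^sub>R h = (x (t + h) - x t) /\<^sub>R h" by (simp add: integral_unique)
    qed
    from Lim_transform_eventually[OF lim this]
    show "((\<lambda>h. (x (t + h) - x t) /\<^sub>R h) \<longlongrightarrow> ?f t) (at_right 0)" using t by simp
  qed
qed simp

lemma dini_decrease_along_curve: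
  fixes x :: "real \<Rightarrow> 'a::real_normed_vector"
  assumes lip: "lipschitz_near U (x t)" and dini: "dini_decrease U (x t) w a"
    and deriv: "((\<lambda>h. (x (t + h) - x t) /\<^sub>R h) \<longlongrightarrow> w) (at_right 0)"
  shows "dini_decrease (\<lambda>s. U (x s)) t 1 a"
  unfolding dini_decrease_def
proof (intro allI impI)
  fix e :: real assume "0 < e"
  let ?q = "\<lambda>h. (x (t + h) - x t) /\<^sub>R h"
  obtain \<delta> L where \<delta>: "0 < \<delta>" and L: "L-lipschitz_on (ball (x t) \<delta>) U" using lip by (rule lipschitz_nearE)
  have "((\<lambda>h. x t + h *\<^sub>R ?q h) \<longlongrightarrow> x t + 0 *\<^sub>R w) (at_right 0)"
    "((\<lambda>h. x t + h *\<^sub>R w) \<longlongrightarrow> x t + 0 *\<^sub>R w) (at_right 0)" by (intro tendsto_intros deriv)+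
  then have "\<forall>\<^sub>F h in at_right 0. x t + h *\<^sub>R ?q h \<in> ball (x t) \<delta>" "\<forall>\<^sub>F h in at_right 0. x t + h *\<^sub>R w \<in> ball (x t) \<delta>"
    using topological_tendstoD[OF _ open_ball] \<delta> by force+
  moreover have "((\<lambda>h. L * norm (?q h - w)) \<longlongrightarrow> L * norm (w - w)) (at_right 0)" by (intro tendsto_intros deriv)
  then have "\<forall>\<^sub>F h in at_right 0. L * norm (?q h - w) < e / 2"
    by (rule order_tendstoD) (use \<open>0 < e\<close> in simp)
  moreover have "\<forall>\<^sub>F h in at_right 0. U (x t + h *\<^sub>R w) \<le> U (x t) - h * (a - e / 2)"
    using dini \<open>0 < e\<close> by (simp add: dini_decrease_def)
  ultimately show "\<forall>\<^sub>F h in at_right 0. U (x (t + h *\<^sub>R 1)) \<le> U (x t) - h * (a - e)"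
    using eventually_at_right_less[of 0]
  proof eventually_elim
    case (elim h)
    have x: "x t + h *\<^sub>R ?q h = x (t + h)" using elim by simp
    have diff: "x (t + h) - (x t + h *\<^sub>R w) = h *\<^sub>R (?q h - w)" using elim by (simp add: scaleR_diff_right)
    have "U (x (t + h)) - U (x t + h *\<^sub>R w) \<le> L * norm (h *\<^sub>R (?q h - w))"
      using lipschitz_onD[OF L elim(1,2)] unfolding x dist_norm diff by simp
    also have "\<dots> = h * (L * norm (?q h - w))" using elim by simp
    also have "\<dots> \<le> h * (e / 2)" using elim by (intro mult_left_mono) auto
    finally show ?case using elim by (simp add: algebra_simps)
  qed
qed

lemma exponential_decay_if_dini_decrease:
  fixes v :: "real \<Rightarrow> real"
  assumes lip: "L-lipschitz_on {s..t} v" and "s \<le> t"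
    and dini: "AE r in lborel. s < r \<longrightarrow> r < t \<longrightarrow> dini_decrease v r 1 (v r)"
  shows "v t \<le> v s * exp (- (t - s))"
proof -
  have "compact (v ` {s..t})" using lipschitz_on_continuous_on[OF lip] by (rule compact_continuous_image) simp
  then obtain B where B: "0 < B" "\<forall>y\<in>v ` {s..t}. norm y \<le> B"
    using compact_imp_bounded bounded_pos by metis
  have exp_lip: "(exp t)-lipschitz_on {s..t} exp"
    by (rule bounded_derivative_imp_lipschitz[where f' = "\<lambda>r h. exp r * h"])
       (auto intro!: derivative_eq_intros onorm_le simp: abs_mult mult_right_mono)
  have "(exp t * L + B * exp t)-lipschitz_on {s..t} (\<lambda>r. exp r * v r)"
    using B by (intro lipschitz_on_mult_bounded exp_lip lip) auto
  then have "exp t * v t - exp s * v s \<le> 0 * (t - s)"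
  proof (rule lipschitz_real_increment_le[OF _ \<open>s \<le> t\<close>])
    show "AE r in lborel. s < r \<longrightarrow> r < t \<longrightarrow> (\<forall>d. ((\<lambda>r. exp r * v r) has_real_derivative d) (at r) \<longrightarrow> d \<le> 0)"
      using dini
    proof (eventually_elim, intro impI allI)
      fix r d assume "s < r \<longrightarrow> r < t \<longrightarrow> dini_decrease v r 1 (v r)" "s < r" "r < t"
        and d: "((\<lambda>r. exp r * v r) has_real_derivative d) (at r)"
      then have decrease: "dini_decrease v r 1 (v r)" by blast
      have "((\<lambda>r. exp (- r)) has_real_derivative - exp (- r)) (at r)" by (auto intro!: derivative_eq_intros)
      from DERIV_mult[OF this d] have "(v has_real_derivative exp (- r) * d - v r) (at r)"
        by (simp add: exp_minus mult.assoc[symmetric] mult.commute[of d])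
      then have "exp (- r) * d - v r \<le> - v r"
        using dini_decrease_imp_derivative_le[OF _ decrease] unfolding has_field_derivative_def by fastforce
      then show "d \<le> 0" by (simp add: mult_le_0_iff)
    qed
  qed
  then have "exp (- t) * (exp t * v t) \<le> exp (- t) * (exp s * v s)" by (intro mult_left_mono) auto
  then show ?thesis by (simp add: exp_minus exp_diff field_simps)
qed

lemma continuous_bootstrap:
  fixes \<phi> :: "real \<Rightarrow> real"
  assumes cont: "continuous_on {a..b} \<phi>" and init: "\<phi> a < B"
    and step: "\<And>s. s \<in> {a..b} \<Longrightarrow> (\<And>r. r \<in> {a..s} \<Longrightarrow> \<phi> r \<le> B) \<Longrightarrow> \<phi> s < B"
    and s: "s \<in> {a..b}"
  shows "\<phi> s < B"
proof (rule ccontr)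
  assume "\<not> \<phi> s < B"
  define A where "A = {r \<in> {a..b}. B \<le> \<phi> r}"
  have "s \<in> A" using s \<open>\<not> \<phi> s < B\<close> by (simp add: A_def)
  moreover have "closed A"
    unfolding A_def using continuous_closed_preimage[OF cont closed_real_atLeastAtMost closed_atLeast[of B]]
    by (simp add: vimage_def Int_def)
  moreover have bdd: "bdd_below A" by (rule bdd_belowI[of _ a]) (auto simp: A_def)
  ultimately have "Inf A \<in> A" using closed_contains_Inf[of A] by blast
  then have m: "Inf A \<in> {a..b}" "B \<le> \<phi> (Inf A)" by (auto simp: A_def)
  have before: "\<phi> r < B" if "a \<le> r" "r < Inf A" for r
    using cInf_lower[OF _ bdd, of r] that m(1) by (force simp: A_def)
  obtain r where r: "a \<le> r" "r \<le> Inf A" "\<phi> r = B"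
    using IVT'[of \<phi> a B "Inf A"] init m continuous_on_subset[OF cont, of "{a..Inf A}"] by auto
  then have "\<phi> (Inf A) = B" using before[of r] by (cases "r = Inf A") auto
  then have "\<phi> r \<le> B" if "r \<in> {a..Inf A}" for r
    using before[of r] that by (cases "r = Inf A") auto
  then show False using step[OF m(1)] m(2) by fastforce
qed

lemma exponential_dini_Lyap_decay:
  fixes F :: "'x::euclidean_space \<Rightarrow> 'm::euclidean_space \<Rightarrow> 'x"
  assumes F: "continuous_on UNIV (case_prod F)" and U: "exponential_dini_Lyap F \<gamma> U"
    and sol: "is_solution F u x T" and u: "essentially_bounded c u"
    and st: "0 \<le> s" "s \<le> t" "t \<le> T"
    and large: "\<And>r. r \<in> {s..t} \<Longrightarrow> x r \<noteq> 0 \<and> \<gamma> c \<le> U (x r)"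
  shows "U (x t) \<le> U (x s) * exp (- (t - s))"
proof -
  have U_lip: "locLip (UNIV - {0}) U" and \<gamma>: "classK \<gamma>"
    and dini: "\<And>x u. x \<noteq> 0 \<Longrightarrow> \<gamma> (norm u) \<le> U x \<Longrightarrow> dini_decrease U x (F x u) (U x)"
    using U by (auto simp: exponential_dini_Lyap_def)
  obtain K where "K-lipschitz_on {0..T} x" using solution_lipschitz[OF F sol u] by blast
  then have x_lip: "K-lipschitz_on {s..t} x" by (rule lipschitz_on_subset) (use st in auto)
  then have "compact (x ` {s..t})" by (intro compact_continuous_image lipschitz_on_continuous_on compact_Icc)
  moreover have "locLip (x ` {s..t}) U" by (rule locLip_subset[OF U_lip]) (use large in auto)
  ultimately obtain L where "L-lipschitz_on (x ` {s..t}) U" by (rule locLip_compact_imp_lipschitz)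
  from lipschitz_on_compose2[OF x_lip this] show ?thesis
  proof (rule exponential_decay_if_dini_decrease[OF _ st(2)])
    show "AE r in lborel. s < r \<longrightarrow> r < t \<longrightarrow> dini_decrease (\<lambda>r. U (x r)) r 1 (U (x r))"
      using solution_right_derivative_AE[OF sol] u unfolding essentially_bounded_def
    proof (eventually_elim, intro impI)
      fix r assume deriv: "0 < r \<longrightarrow> r < T \<longrightarrow> ((\<lambda>h. (x (r + h) - x r) /\<^sub>R h) \<longlongrightarrow> F (x r) (u r)) (at_right 0)"
        and u_r: "0 \<le> r \<longrightarrow> norm (u r) \<le> c" and r: "s < r" "r < t"
      have "\<gamma> (norm (u r)) \<le> \<gamma> c" using u_r r st by (intro classK_le[OF \<gamma>]) auto
      then have "dini_decrease U (x r) (F (x r) (u r)) (U (x r))" using large[of r] r by (intro dini) auto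
      moreover have "lipschitz_near U (x r)" using U_lip large[of r] r by (simp add: locLip_open_iff open_delete)
      ultimately show "dini_decrease (\<lambda>r. U (x r)) r 1 (U (x r))"
        using deriv r st by (intro dini_decrease_along_curve) auto
    qed
  qed
qed

lemma exponential_dini_Lyap_dichotomy:
  fixes F :: "'x::euclidean_space \<Rightarrow> 'm::euclidean_space \<Rightarrow> 'x"
  assumes F: "continuous_on UNIV (case_prod F)" and U: "exponential_dini_Lyap F \<gamma> U"
    and sol: "is_solution F u x T" and u: "0 \<le> c" "essentially_bounded c u"
    and t: "t \<in> {0..T}"
  shows "U (x t) \<le> \<gamma> c \<or> U (x t) \<le> U (x 0) * exp (- t)"
proof (cases "U (x t) \<le> \<gamma> c")
  case False
  then obtain l where l: "\<gamma> c < l" "l < U (x t)" using dense not_le by blast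
  have U_cont: "continuous_on UNIV U" and U_0: "U 0 = 0" and \<gamma>: "classK \<gamma>" and U_nonneg: "\<And>y. 0 \<le> U y"
    using U proper_posdef_0 proper_posdef_nonneg by (auto simp: exponential_dini_Lyap_def)
  have "0 < l" using classK_nonneg[OF \<gamma> u(1)] l(1) by simp
  have decay: "U (x t) \<le> U (x s) * exp (- (t - s))" if s: "s \<in> {0..t}" and "\<And>r. r \<in> {s..t} \<Longrightarrow> l \<le> U (x r)" for s
  proof (rule exponential_dini_Lyap_decay[OF F U sol u(2)])
    fix r assume "r \<in> {s..t}"
    then show "x r \<noteq> 0 \<and> \<gamma> c \<le> U (x r)" using that(2)[of r] l(1) \<open>0 < l\<close> U_0 by auto
  qed (use s t in auto)
  have "- U (x (t - s)) < - l" if s: "s \<in> {0..t}" for s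
  proof (rule continuous_bootstrap[OF _ _ _ s])
    have "continuous_on {0..T} x" using sol by (simp add: is_solution_def)
    then have "continuous_on {0..t} (\<lambda>s. x (t - s))"
      by (rule continuous_on_compose2) (use t in \<open>auto intro!: continuous_intros\<close>)
    then show "continuous_on {0..t} (\<lambda>s. - U (x (t - s)))"
      by (intro continuous_on_minus continuous_on_compose2[OF U_cont]) auto
    show "- U (x (t - 0)) < - l" using l(2) by simp
    fix s assume s: "s \<in> {0..t}" and above: "\<And>r. r \<in> {0..s} \<Longrightarrow> - U (x (t - r)) \<le> - l"
    have "U (x t) \<le> U (x (t - s)) * exp (- (t - (t - s)))"
    proof (rule decay)
      fix r assume "r \<in> {t - s..t}"
      then show "l \<le> U (x r)" using above[of "t - r"] by auto
    qed (use s in auto)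
    also have "\<dots> \<le> U (x (t - s)) * 1" using s U_nonneg by (intro mult_left_mono) auto
    finally show "- U (x (t - s)) < - l" using l(2) by simp
  qed
  then have "l \<le> U (x r)" if "r \<in> {0..t}" for r using that by (force dest: spec[of _ "t - r"])
  then show ?thesis using decay[of 0] t by simp
qed simp

lemma exponential_dini_Lyap_KL_estimate:
  fixes F :: "'x::euclidean_space \<Rightarrow> 'm::euclidean_space \<Rightarrow> 'x"
  assumes F: "continuous_on UNIV (case_prod F)" and U: "exponential_dini_Lyap F \<gamma> U"
  obtains \<beta> \<gamma>' where "classKL \<beta>" "classK \<gamma>'"
    "\<And>u x T c t. is_solution F u x T \<Longrightarrow> 0 \<le> c \<Longrightarrow> essentially_bounded c u \<Longrightarrow> t \<in> {0..T} \<Longrightarrow>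
       norm (x t) \<le> \<beta> (norm (x 0)) t + \<gamma>' c"
proof -
  have proper: "proper_posdef U" and \<gamma>: "classK \<gamma>" using U by (auto simp: exponential_dini_Lyap_def)
  obtain \<psi>1 \<psi>2 where \<psi>: "classKinf \<psi>1" "classKinf \<psi>2" "\<And>x. \<psi>1 (norm x) \<le> U x" "\<And>x. U x \<le> \<psi>2 (norm x)"
    using proper unfolding proper_posdef_def by blast
  note K1 = classKinf_classK[OF Kinv_classKinf[OF \<psi>(1)]] and K2 = classKinf_classK[OF \<psi>(2)]
  define \<beta> where "\<beta> = (\<lambda>r t. Kinv \<psi>1 (\<psi>2 r * exp (- t)))"
  have norm_le: "norm y \<le> Kinv \<psi>1 (U y)" for y
    using Kinv_less_iff[OF \<psi>(1) norm_ge_zero proper_posdef_nonneg[OF proper, of y], of y] \<psi>(3)[of y] by linarith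
  show ?thesis
  proof (rule that[of \<beta> "\<lambda>c. Kinv \<psi>1 (\<gamma> c)"])
    show "classKL \<beta>" unfolding \<beta>_def by (rule classKL_exp[OF Kinv_classKinf[OF \<psi>(1)] \<psi>(2)])
    show "classK (\<lambda>c. Kinv \<psi>1 (\<gamma> c))" by (rule classK_compose[OF K1 \<gamma>])
    fix u :: "real \<Rightarrow> 'm" and x T c t
    assume sol: "is_solution F u x T" and u: "0 \<le> c" "essentially_bounded c u" and t: "t \<in> {0..T}"
    have nonneg: "0 \<le> \<beta> (norm (x 0)) t" "0 \<le> Kinv \<psi>1 (\<gamma> c)"
      unfolding \<beta>_def by (intro classK_nonneg[OF K1] mult_nonneg_nonneg classK_nonneg[OF K2] classK_nonneg[OF \<gamma>] u; simp)+
    from exponential_dini_Lyap_dichotomy[OF F U sol u t]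
    show "norm (x t) \<le> \<beta> (norm (x 0)) t + Kinv \<psi>1 (\<gamma> c)"
    proof
      assume "U (x t) \<le> \<gamma> c"
      then have "Kinv \<psi>1 (U (x t)) \<le> Kinv \<psi>1 (\<gamma> c)" by (intro classK_le[OF K1] proper_posdef_nonneg[OF proper])
      then show ?thesis using norm_le[of "x t"] nonneg by linarith
    next
      assume "U (x t) \<le> U (x 0) * exp (- t)"
      also have "\<dots> \<le> \<psi>2 (norm (x 0)) * exp (- t)" by (intro mult_right_mono \<psi>(4)) simp
      finally have "Kinv \<psi>1 (U (x t)) \<le> \<beta> (norm (x 0)) t"
        unfolding \<beta>_def by (intro classK_le[OF K1] proper_posdef_nonneg[OF proper])
      then show ?thesis using norm_le[of "x t"] nonneg by linarith
    qed
  qed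
qed

section \<open>Global existence\<close>

lemma measurable_bounded_integrable_on:
  fixes f :: "real \<Rightarrow> 'x::euclidean_space"
  assumes [measurable]: "f \<in> borel_measurable borel" and B: "\<And>s. norm (f s) \<le> B"
  shows "f integrable_on {a..b}"
proof -
  have "integrable lborel (\<lambda>s. indicator {a..b} s *\<^sub>R f s)"
  proof (rule Bochner_Integration.integrable_bound)
    show "integrable lborel (\<lambda>s. indicator {a..b} s * B :: real)"
      by (intro integrable_mult_left integrable_real_indicator) (use emeasure_bounded_finite[of "{a..b}"] in auto)
    have "0 \<le> B" using B[of 0] norm_ge_zero order_trans by blast
    then show "AE s in lborel. norm (indicator {a..b} s *\<^sub>R f s) \<le> norm (indicator {a..b} s * B)"
      using B by (intro AE_I2) (auto simp: indicator_def)
  qed auto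
  then have "set_integrable lborel {a..b} f" by (simp add: set_integrable_def)
  then show ?thesis by (rule set_borel_integral_eq_integral(1))
qed

locale bounded_lipschitz_ode =
  fixes f :: "real \<Rightarrow> 'x::euclidean_space \<Rightarrow> 'x" and K L :: real and x0 :: 'x
  assumes measurable_along: "\<And>y. continuous_on UNIV y \<Longrightarrow> (\<lambda>s. f s (y s)) \<in> borel_measurable borel"
    and bound: "\<And>s y. norm (f s y) \<le> K"
    and lip: "\<And>s y z. norm (f s y - f s z) \<le> L * norm (y - z)"
    and L_pos: "0 < L"
begin

definition picard :: "(real \<Rightarrow> 'x) \<Rightarrow> real \<Rightarrow> 'x" where
  "picard y t = x0 + integral {0..max 0 t} (\<lambda>s. f s (y s))"

definition unweight :: "(real \<Rightarrow>\<^sub>C 'x) \<Rightarrow> real \<Rightarrow> 'x" where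
  "unweight h s = exp (2 * L * s) *\<^sub>R h s"

definition weighted_picard :: "(real \<Rightarrow>\<^sub>C 'x) \<Rightarrow> real \<Rightarrow> 'x" where
  "weighted_picard h t = exp (- (2 * L * max 0 t)) *\<^sub>R picard (unweight h) t"

lemma K_nonneg: "0 \<le> K"
  using bound[of 0 0] norm_ge_zero order_trans by blast

lemma integrable_along: "continuous_on UNIV y \<Longrightarrow> (\<lambda>s. f s (y s)) integrable_on {a..b}"
  by (rule measurable_bounded_integrable_on[OF measurable_along bound])

lemma picard_0: "picard y 0 = x0"
  by (simp add: picard_def)

lemma picard_has_integral:
  assumes "continuous_on UNIV y" "0 \<le> t"
  shows "((\<lambda>s. f s (y s)) has_integral (picard y t - x0)) {0..t}"
  using integrable_integral[OF integrable_along[OF assms(1)], of 0 t] assms(2) by (simp add: picard_def)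

lemma picard_lipschitz:
  assumes y: "continuous_on UNIV y"
  shows "K-lipschitz_on UNIV (picard y)"
proof (rule lipschitz_on_leI[OF _ K_nonneg])
  fix s t :: real assume "s \<le> t"
  let ?f = "\<lambda>s. f s (y s)" and ?s = "max 0 s" and ?t = "max 0 t"
  have "picard y t - picard y s = integral {?s..?t} ?f"
    unfolding picard_def
    using Henstock_Kurzweil_Integration.integral_combine[of 0 ?s ?t ?f] integrable_along[OF y] \<open>s \<le> t\<close>
    by (simp add: algebra_simps)
  moreover have "norm (integral {?s..?t} ?f) \<le> K * (?t - ?s)"
    using \<open>s \<le> t\<close> bound
    by (intro has_integral_bound_AE[OF integrable_integral[OF integrable_along[OF y]]] K_nonneg AE_I2) auto
  moreover have "K * (?t - ?s) \<le> K * (t - s)" using \<open>s \<le> t\<close> K_nonneg by (intro mult_left_mono) auto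
  ultimately have "norm (picard y t - picard y s) \<le> K * (t - s)" by (metis order_trans)
  then show "dist (picard y s) (picard y t) \<le> K * dist s t"
    using \<open>s \<le> t\<close> by (simp add: dist_norm norm_minus_commute)
qed

lemma picard_diff_le:
  assumes y: "continuous_on UNIV y" and z: "continuous_on UNIV z" and t: "0 \<le> t" and d: "0 \<le> d"
    and close: "\<And>s. norm (y s - z s) \<le> exp (2 * L * s) * d"
  shows "norm (picard y t - picard z t) \<le> exp (2 * L * t) * (d / 2)"
proof -
  have exp_integral: "((\<lambda>s. L * d * exp (2 * L * s)) has_integral (d / 2 * exp (2 * L * t) - d / 2 * exp (2 * L * 0))) {0..t}"
    using L_pos t by (intro fundamental_theorem_of_calculus)
      (auto intro!: derivative_eq_intros simp flip: has_real_derivative_iff_has_vector_derivative)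
  have "picard y t - picard z t = integral {0..t} (\<lambda>s. f s (y s) - f s (z s))"
    using t integrable_along[OF y] integrable_along[OF z]
    by (simp add: picard_def Henstock_Kurzweil_Integration.integral_diff)
  also have "norm \<dots> \<le> integral {0..t} (\<lambda>s. L * d * exp (2 * L * s))"
  proof (rule integral_norm_bound_integral)
    show "(\<lambda>s. f s (y s) - f s (z s)) integrable_on {0..t}"
      by (intro Henstock_Kurzweil_Integration.integrable_diff integrable_along y z)
    show "(\<lambda>s. L * d * exp (2 * L * s)) integrable_on {0..t}" using exp_integral by (rule has_integral_integrable)
    fix s
    have "L * norm (y s - z s) \<le> L * (exp (2 * L * s) * d)" using L_pos close by (intro mult_left_mono) auto
    then show "norm (f s (y s) - f s (z s)) \<le> L * d * exp (2 * L * s)"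
      using lip[of s "y s" "z s"] by (simp add: mult_ac)
  qed
  also have "\<dots> = d / 2 * exp (2 * L * t) - d / 2" using integral_unique[OF exp_integral] by simp
  finally show ?thesis using d by (simp add: mult.commute)
qed

lemma unweight_continuous: "continuous_on UNIV (unweight h)"
proof -
  have "continuous_on UNIV (apply_bcontfun h)" using apply_bcontfun[of h] by (simp add: bcontfun_def)
  then show ?thesis unfolding unweight_def[abs_def] by (intro continuous_intros)
qed

lemma weighted_picard_bcontfun: "weighted_picard h \<in> bcontfun"
  unfolding bcontfun_def
proof (intro CollectI conjI)
  show "continuous_on UNIV (weighted_picard h)"
    unfolding weighted_picard_def[abs_def]
    by (intro continuous_intros lipschitz_on_continuous_on[OF picard_lipschitz[OF unweight_continuous]])
  have "norm (weighted_picard h t) \<le> norm x0 + K / (2 * L)" for t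
  proof -
    let ?r = "max 0 t"
    have "picard (unweight h) ?r = picard (unweight h) t" by (simp add: picard_def)
    then have "norm (picard (unweight h) t - x0) \<le> K * ?r"
      using lipschitz_onD[OF picard_lipschitz[OF unweight_continuous], of ?r 0 h] by (simp add: dist_norm picard_0)
    then have "norm (picard (unweight h) t) \<le> norm x0 + K * ?r"
      using norm_triangle_sub[of "picard (unweight h) t" x0] by linarith
    then have "norm (weighted_picard h t) \<le> exp (- (2 * L * ?r)) * (norm x0 + K * ?r)"
      by (simp add: weighted_picard_def)
    also have "\<dots> = exp (- (2 * L * ?r)) * norm x0 + K / (2 * L) * (2 * L * ?r * exp (- (2 * L * ?r)))"
      using L_pos by (simp add: field_simps)
    also have "\<dots> \<le> 1 * norm x0 + K / (2 * L) * 1"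
    proof (intro add_mono mult_right_mono mult_left_mono)
      show "exp (- (2 * L * ?r)) \<le> 1" using L_pos by simp
      have "2 * L * ?r \<le> exp (2 * L * ?r)" using exp_ge_add_one_self[of "2 * L * ?r"] by linarith
      then show "2 * L * ?r * exp (- (2 * L * ?r)) \<le> 1" by (simp add: exp_minus field_simps)
    qed (use K_nonneg L_pos in auto)
    finally show ?thesis by simp
  qed
  then show "bounded (range (weighted_picard h))" by (intro boundedI) auto
qed

text \<open>In the norm weighted by \<open>exp (- 2 L t)\<close> the Picard iteration is a contraction on all of \<open>[0, \<infinity>)\<close>.\<close>

lemma weighted_picard_contraction:
  "dist (weighted_picard h t) (weighted_picard k t) \<le> 1 / 2 * dist h k"
proof -
  let ?r = "max 0 t"
  have "norm (unweight h s - unweight k s) \<le> exp (2 * L * s) * dist h k" for s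
    using dist_bounded[of h s k] by (simp add: unweight_def dist_norm flip: scaleR_diff_right)
  then have "norm (picard (unweight h) ?r - picard (unweight k) ?r) \<le> exp (2 * L * ?r) * (dist h k / 2)"
    by (intro picard_diff_le unweight_continuous) auto
  moreover have "picard y ?r = picard y t" for y by (simp add: picard_def)
  ultimately have diff_le: "norm (picard (unweight h) t - picard (unweight k) t) \<le> exp (2 * L * ?r) * (dist h k / 2)"
    by simp
  have "dist (weighted_picard h t) (weighted_picard k t)
      = exp (- (2 * L * ?r)) * norm (picard (unweight h) t - picard (unweight k) t)"
    by (simp add: weighted_picard_def dist_norm flip: scaleR_diff_right)
  also have "\<dots> \<le> exp (- (2 * L * ?r)) * (exp (2 * L * ?r) * (dist h k / 2))"
    by (intro mult_left_mono diff_le) simp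
  also have "\<dots> = 1 / 2 * dist h k" by (simp add: exp_minus)
  finally show ?thesis .
qed

lemma exists_global_solution:
  obtains x where "continuous_on UNIV x" "x 0 = x0"
    "\<And>t. 0 \<le> t \<Longrightarrow> ((\<lambda>s. f s (x s)) has_integral (x t - x0)) {0..t}"
proof -
  define \<Psi> where "\<Psi> = (\<lambda>h. Bcontfun (weighted_picard h))"
  have \<Psi>: "apply_bcontfun (\<Psi> h) = weighted_picard h" for h
    unfolding \<Psi>_def by (rule Bcontfun_inverse[OF weighted_picard_bcontfun])
  have "dist (\<Psi> h) (\<Psi> k) \<le> 1 / 2 * dist h k" for h k
    by (rule dist_bound) (simp only: \<Psi> weighted_picard_contraction)
  then obtain h where h: "\<Psi> h = h" using banach_fix_type[of "1 / 2" \<Psi>] by auto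
  define x where "x = picard (unweight h)"
  have unweight_eq: "unweight h t = x t" if "0 \<le> t" for t
    using \<Psi>[of h] that unfolding h by (simp add: unweight_def weighted_picard_def x_def exp_minus)
  show ?thesis
  proof (rule that)
    show "continuous_on UNIV x"
      unfolding x_def by (rule lipschitz_on_continuous_on[OF picard_lipschitz[OF unweight_continuous]])
    show "x 0 = x0" by (simp add: x_def picard_0)
    fix t :: real assume "0 \<le> t"
    then have "((\<lambda>s. f s (unweight h s)) has_integral (x t - x0)) {0..t}"
      unfolding x_def by (rule picard_has_integral[OF unweight_continuous])
    then show "((\<lambda>s. f s (x s)) has_integral (x t - x0)) {0..t}"
      by (rule has_integral_eq[rotated]) (simp add: unweight_eq)
  qed
qed

end

lemma local_lipschitz_compact_bounds:
  fixes F :: "'x::euclidean_space \<Rightarrow> 'm::euclidean_space \<Rightarrow> 'x"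
  assumes F: "continuous_on UNIV (case_prod F)" and lip: "local_lipschitz UNIV UNIV (\<lambda>v x. F x v)"
    and S: "compact S"
  obtains K L where "0 < L" "\<And>y v. y \<in> S \<Longrightarrow> norm v \<le> c \<Longrightarrow> norm (F y v) \<le> K"
    "\<And>v. norm v \<le> c \<Longrightarrow> L-lipschitz_on S (\<lambda>y. F y v)"
proof -
  obtain K where K: "\<And>y v. y \<in> S \<Longrightarrow> norm v \<le> c \<Longrightarrow> norm (F y v) \<le> K"
    using continuous_bounded_on_compact[OF F S] by blast
  obtain L where L: "\<And>v. v \<in> cball 0 c \<Longrightarrow> L-lipschitz_on S (\<lambda>y. F y v)"
  proof (rule local_lipschitz_compact_implies_lipschitz[OF local_lipschitz_subset[OF lip] S compact_cball])
    show "continuous_on (cball 0 c) (F y)" for y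
      using continuous_on_compose2[OF F continuous_on_Pair[OF continuous_on_const[of _ y] continuous_on_id]] by simp
  qed auto
  have "(\<bar>L\<bar> + 1)-lipschitz_on S (\<lambda>y. F y v)" if "norm v \<le> c" for v
    using that by (intro lipschitz_on_le[OF L]) auto
  with K show ?thesis by (intro that[of "\<bar>L\<bar> + 1" K]) auto
qed

lemma bounded_lipschitz_ode_closest_point:
  fixes F :: "'x::euclidean_space \<Rightarrow> 'm::euclidean_space \<Rightarrow> 'x"
  assumes F: "continuous_on UNIV (case_prod F)" and lip: "local_lipschitz UNIV UNIV (\<lambda>v x. F x v)"
    and S: "compact S" "convex S" "S \<noteq> {}"
    and w: "w \<in> borel_measurable borel" "\<And>s. norm (w s) \<le> c"
  obtains K L where "bounded_lipschitz_ode (\<lambda>s y. F (closest_point S y) (w s)) K L"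
proof -
  let ?P = "closest_point S"
  have closed: "closed S" using S(1) by (rule compact_imp_closed)
  have P: "?P y \<in> S" for y using closed S(3) by (rule closest_point_in_set)
  obtain K L where L_pos: "0 < L" and K: "\<And>y v. y \<in> S \<Longrightarrow> norm v \<le> c \<Longrightarrow> norm (F y v) \<le> K"
    and L: "\<And>v. norm v \<le> c \<Longrightarrow> L-lipschitz_on S (\<lambda>y. F y v)"
    by (rule local_lipschitz_compact_bounds[OF F lip S(1), of c]) (rule that)
  have "bounded_lipschitz_ode (\<lambda>s y. F (?P y) (w s)) K L"
  proof
    fix y :: "real \<Rightarrow> 'x" assume y: "continuous_on UNIV y"
    have P_measurable: "(\<lambda>s. ?P (y s)) \<in> borel_measurable borel"
      using continuous_on_compose2[OF continuous_on_closest_point[OF S(2) closed S(3), of UNIV] y]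
      by (intro borel_measurable_continuous_onI) simp
    show "(\<lambda>s. F (?P (y s)) (w s)) \<in> borel_measurable borel"
      by (rule borel_measurable_continuous_Pair[OF P_measurable w(1)]) (use F in \<open>simp add: case_prod_unfold\<close>)
  next
    fix s y z
    show "norm (F (?P y) (w s)) \<le> K" by (intro K P w(2))
    have "dist (F (?P y) (w s)) (F (?P z) (w s)) \<le> L * dist (?P y) (?P z)"
      by (intro lipschitz_onD[OF L] P w(2))
    also have "\<dots> \<le> L * dist y z"
      using L_pos closest_point_lipschitz[OF S(2) closed S(3)] by (intro mult_left_mono) auto
    finally show "norm (F (?P y) (w s) - F (?P z) (w s)) \<le> L * norm (y - z)" by (simp add: dist_norm)
  qed (rule L_pos)
  then show ?thesis by (rule that)
qed

lemma exists_solution_while_in_compact: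
  fixes F :: "'x::euclidean_space \<Rightarrow> 'm::euclidean_space \<Rightarrow> 'x"
  assumes F: "continuous_on UNIV (case_prod F)" and lip: "local_lipschitz UNIV UNIV (\<lambda>v x. F x v)"
    and S: "compact S" "convex S" "S \<noteq> {}"
    and u: "u \<in> borel_measurable lborel" "0 \<le> c" "essentially_bounded c u"
  obtains x where "continuous_on UNIV x" "x 0 = x0"
    "\<And>T. 0 \<le> T \<Longrightarrow> (\<And>s. s \<in> {0..T} \<Longrightarrow> x s \<in> S) \<Longrightarrow> is_solution F u x T"
proof -
  let ?P = "closest_point S"
  define w where "w = (\<lambda>s. if norm (u s) \<le> c then u s else 0)"
  have w_measurable: "w \<in> borel_measurable borel" unfolding w_def using u(1) by measurable
  have "norm (w s) \<le> c" for s using u(2) by (simp add: w_def)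
  then obtain K L where "bounded_lipschitz_ode (\<lambda>s y. F (?P y) (w s)) K L"
    by (rule bounded_lipschitz_ode_closest_point[OF F lip S w_measurable])
  then interpret bounded_lipschitz_ode "\<lambda>s y. F (?P y) (w s)" K L x0 .
  obtain x where x: "continuous_on UNIV x" "x 0 = x0"
    "\<And>t. 0 \<le> t \<Longrightarrow> ((\<lambda>s. F (?P (x s)) (w s)) has_integral (x t - x0)) {0..t}"
    using exists_global_solution by blast
  have "is_solution F u x T" if in_S: "\<And>s. s \<in> {0..T} \<Longrightarrow> x s \<in> S" for T
    unfolding is_solution_def
  proof (intro conjI ballI)
    show "continuous_on {0..T} x" using x(1) by (rule continuous_on_subset) simp
    fix t assume t: "t \<in> {0..T}"
    have "AE s in lborel. s \<in> {0..t} \<longrightarrow> F (?P (x s)) (w s) = F (x s) (u s)"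
      using u(3) unfolding essentially_bounded_def
      by eventually_elim (use t in_S in \<open>auto simp: w_def closest_point_self\<close>)
    from has_integral_AE[OF this] show "((\<lambda>s. F (x s) (u s)) has_integral (x t - x 0)) {0..t}"
      using x(2) x(3)[of t] t by simp
  qed
  then show ?thesis using that x(1,2) by blast
qed

lemma global_existence_if_a_priori_bound:
  fixes F :: "'x::euclidean_space \<Rightarrow> 'm::euclidean_space \<Rightarrow> 'x"
  assumes F: "continuous_on UNIV (case_prod F)" and lip: "local_lipschitz UNIV UNIV (\<lambda>v x. F x v)"
    and u: "u \<in> borel_measurable lborel" "0 \<le> c" "essentially_bounded c u"
    and bound: "\<And>x T t. is_solution F u x T \<Longrightarrow> x 0 = x0 \<Longrightarrow> t \<in> {0..T} \<Longrightarrow> norm (x t) \<le> R"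
  obtains x where "x 0 = x0" "\<And>T. 0 \<le> T \<Longrightarrow> is_solution F u x T"
proof -
  have "is_solution F u (\<lambda>_. x0) 0" by (simp add: is_solution_def has_integral_refl)
  then have x0: "norm x0 \<le> R" using bound[of "\<lambda>_. x0" 0 0] by simp
  moreover have "0 \<le> R" using x0 norm_ge_zero order_trans by blast
  ultimately obtain x where x: "continuous_on UNIV x" "x 0 = x0"
    "\<And>T. 0 \<le> T \<Longrightarrow> (\<And>s. s \<in> {0..T} \<Longrightarrow> x s \<in> cball 0 (R + 1)) \<Longrightarrow> is_solution F u x T"
    using exists_solution_while_in_compact[OF F lip compact_cball convex_cball _ u, of 0 "R + 1" x0] by auto
  have "norm (x t) < R + 1" if t: "0 \<le> t" for t
  proof (rule continuous_bootstrap[where \<phi>="\<lambda>s. norm (x s)" and a=0 and b=t])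
    show "continuous_on {0..t} (\<lambda>s. norm (x s))"
      by (intro continuous_on_norm continuous_on_subset[OF x(1)]) simp
    show "norm (x 0) < R + 1" using x0 x(2) by simp
    show "norm (x s) < R + 1" if "s \<in> {0..t}" and "\<And>r. r \<in> {0..s} \<Longrightarrow> norm (x r) \<le> R + 1" for s
      using bound[OF x(3)[of s] x(2), of s] that by fastforce
    show "t \<in> {0..t}" using t by simp
  qed
  then have "is_solution F u x T" if "0 \<le> T" for T using that by (intro x(3)) (auto simp: less_imp_le)
  then show ?thesis using that x(2) by blast
qed

lemma linf_essential_bound:
  assumes "admissible_input u"
  shows "0 \<le> linf u" and "essentially_bounded (linf u) u"
proof -
  let ?S = "{c. 0 \<le> c \<and> (AE t in lborel. 0 \<le> t \<longrightarrow> norm (u t) \<le> c)}"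
  obtain c where "AE t in lborel. 0 \<le> t \<longrightarrow> norm (u t) \<le> c" using assms by (auto simp: admissible_input_def)
  then have "AE t in lborel. 0 \<le> t \<longrightarrow> norm (u t) \<le> max 0 c" by (rule eventually_mono) auto
  then have nonempty: "?S \<noteq> {}" by (auto intro!: exI[of _ "max 0 c"])
  show "0 \<le> linf u" unfolding linf_def by (rule cInf_greatest[OF nonempty]) auto
  have "AE t in lborel. \<forall>k::nat. 0 \<le> t \<longrightarrow> norm (u t) \<le> linf u + 1 / Suc k"
    unfolding AE_all_countable
  proof
    fix k :: nat
    have "Inf ?S < linf u + 1 / Suc k" by (simp add: linf_def)
    then obtain d where "d \<in> ?S" "d < linf u + 1 / Suc k" using cInf_lessD[OF nonempty] by blast
    then show "AE t in lborel. 0 \<le> t \<longrightarrow> norm (u t) \<le> linf u + 1 / Suc k"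
      by (auto elim!: eventually_mono)
  qed
  then show "essentially_bounded (linf u) u"
    unfolding essentially_bounded_def
  proof (rule eventually_mono, intro impI)
    fix t :: real assume below: "\<forall>k::nat. 0 \<le> t \<longrightarrow> norm (u t) \<le> linf u + 1 / Suc k" and "0 \<le> t"
    have "(\<lambda>k. linf u + 1 / real (Suc k)) \<longlonglongrightarrow> linf u + 0"
      by (intro tendsto_add tendsto_const LIMSEQ_Suc[OF lim_1_over_n])
    then show "norm (u t) \<le> linf u" using below \<open>0 \<le> t\<close> by (intro LIMSEQ_le_const) auto
  qed
qed

lemma dini_Lyap_imp_ISS:
  fixes F :: "'x::euclidean_space \<Rightarrow> 'm::euclidean_space \<Rightarrow> 'x"
  assumes F: "continuous_on UNIV (case_prod F)" and lip: "local_lipschitz UNIV UNIV (\<lambda>v x. F x v)"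
    and V: "dini_Lyap F V"
  shows "ISS F"
proof -
  obtain \<gamma>0 U where "exponential_dini_Lyap F \<gamma>0 U" using V by (rule dini_Lyap_imp_exponential)
  then obtain \<beta> \<gamma> where \<beta>: "classKL \<beta>" and \<gamma>: "classK \<gamma>" and estimate:
    "\<And>u x T c t. is_solution F u x T \<Longrightarrow> 0 \<le> c \<Longrightarrow> essentially_bounded c u \<Longrightarrow> t \<in> {0..T} \<Longrightarrow>
       norm (x t) \<le> \<beta> (norm (x 0)) t + \<gamma> c"
    using exponential_dini_Lyap_KL_estimate[OF F] by blast
  have "\<exists>x. x 0 = x0 \<and> (\<forall>T\<ge>0. is_solution F u x T)" if u: "admissible_input u" for x0 u
  proof (rule global_existence_if_a_priori_bound[OF F lip _ linf_essential_bound[OF u]])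
    show "u \<in> borel_measurable lborel" using u by (simp add: admissible_input_def)
    fix x T t assume "is_solution F u x T" "x 0 = x0" and t: "t \<in> {0..T}"
    then have "norm (x t) \<le> \<beta> (norm x0) t + \<gamma> (linf u)"
      using estimate[OF _ linf_essential_bound[OF u] t] by blast
    also have "\<beta> (norm x0) t \<le> \<beta> (norm x0) 0" using \<beta> t by (simp add: classKL_def)
    finally show "norm (x t) \<le> \<beta> (norm x0) 0 + \<gamma> (linf u)" by simp
  qed blast
  moreover have "norm (x t) \<le> \<beta> (norm (x 0)) t + \<gamma> (linf u)"
    if "admissible_input u" "is_solution F u x T" "t \<in> {0..T}" for u x T t
    by (rule estimate[OF that(2) linf_essential_bound[OF that(1)] that(3)])
  ultimately show ?thesis unfolding ISS_def using \<beta> \<gamma> by blast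
qed

lemma sys_regular_imp_local_lipschitz:
  fixes F :: "real^'d::finite \<Rightarrow> real^'m::finite \<Rightarrow> real^'d"
  assumes reg: "sys_regular n blk blkU F" and blk: "\<forall>k. blk k < n"
  shows "local_lipschitz UNIV UNIV (\<lambda>u x. F x u)"
proof (rule local_lipschitzI)
  fix u0 :: "real^'m" and \<xi> :: "real^'d"
  have "\<forall>i. \<exists>\<delta> L. i < n \<longrightarrow> 0 < \<delta> \<and> (\<forall>x\<in>ball \<xi> \<delta>. \<forall>y\<in>ball \<xi> \<delta>. \<forall>u. norm (bproj blkU i u) \<le> norm u0 + 1 \<longrightarrow>
      norm (bproj blk i (F x u) - bproj blk i (F y u)) \<le> L * norm (x - y))"
    using reg unfolding sys_regular_def by meson
  then obtain \<delta> L where \<delta>: "\<And>i. i < n \<Longrightarrow> 0 < \<delta> i"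
    and L: "\<And>i x y u. i < n \<Longrightarrow> x \<in> ball \<xi> (\<delta> i) \<Longrightarrow> y \<in> ball \<xi> (\<delta> i) \<Longrightarrow> norm (bproj blkU i u) \<le> norm u0 + 1 \<Longrightarrow>
      norm (bproj blk i (F x u) - bproj blk i (F y u)) \<le> L i * norm (x - y)"
    by metis
  obtain d where d: "0 < d" "\<And>i. i < n \<Longrightarrow> d \<le> \<delta> i"
    using finite_positive_lower_bound[of "{..<n}" \<delta>] \<delta> by auto
  define r where "r = min 1 (d / 2)"
  have r: "0 < r" "r \<le> 1" "r < d" using d(1) by (auto simp: r_def)
  have "(\<Sum>i<n. \<bar>L i\<bar>)-lipschitz_on (cball \<xi> r \<inter> UNIV) (\<lambda>x. F x u)" if u: "u \<in> cball u0 r \<inter> UNIV" for u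
  proof (rule lipschitz_onI)
    fix x y assume xy: "x \<in> cball \<xi> r \<inter> UNIV" "y \<in> cball \<xi> r \<inter> UNIV"
    have block: "norm (bproj blk i (F x u - F y u)) \<le> \<bar>L i\<bar> * norm (x - y)" if i: "i < n" for i
    proof -
      have "norm u \<le> norm u0 + 1" using u r(2) norm_triangle_sub[of u u0] by (auto simp: dist_norm norm_minus_commute)
      then have "norm (bproj blkU i u) \<le> norm u0 + 1" using norm_bproj_le[of blkU i u] by linarith
      then have "norm (bproj blk i (F x u - F y u)) \<le> L i * norm (x - y)"
        unfolding bproj_diff using xy r(3) d(2)[OF i] by (intro L[OF i]) auto
      also have "\<dots> \<le> \<bar>L i\<bar> * norm (x - y)" by (intro mult_right_mono) auto
      finally show ?thesis .
    qed
    have "norm (F x u - F y u) = norm (\<Sum>i<n. bproj blk i (F x u - F y u))" using sum_bproj[OF blk] by simp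
    also have "\<dots> \<le> (\<Sum>i<n. norm (bproj blk i (F x u - F y u)))" by (rule norm_sum)
    also have "\<dots> \<le> (\<Sum>i<n. \<bar>L i\<bar> * norm (x - y))" by (intro sum_mono block) simp
    finally show "dist (F x u) (F y u) \<le> (\<Sum>i<n. \<bar>L i\<bar>) * dist x y" by (simp add: sum_distrib_right dist_norm)
  qed (simp add: sum_nonneg)
  then show "\<exists>r>0. \<exists>L. \<forall>u\<in>cball u0 r \<inter> UNIV. L-lipschitz_on (cball \<xi> r \<inter> UNIV) (\<lambda>x. F x u)"
    using r(1) by blast
qed

section \<open>The small-gain theorem\<close>

theorem theorem5:
  fixes n :: nat
    and blk :: "'d::finite \<Rightarrow> nat" and blkU :: "'m::finite \<Rightarrow> nat"
    and F :: "real^'d \<Rightarrow> real^'m \<Rightarrow> real^'d"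
    and Isum :: "nat set"
    and V :: "nat \<Rightarrow> real^'d \<Rightarrow> real"
    and \<gamma> :: "nat \<Rightarrow> nat \<Rightarrow> real \<Rightarrow> real"
    and gi :: "nat \<Rightarrow> real \<Rightarrow> real" and \<alpha>i :: "nat \<Rightarrow> real \<Rightarrow> real"
    and \<alpha> :: "real \<Rightarrow> real"
  assumes n_pos: "0 < n"
    and blk_range: "\<forall>k. blk k < n" and blk_nonempty: "\<forall>i<n. \<exists>k. blk k = i"
    and blkU_range: "\<forall>j. blkU j < n"
    and Isum_sub: "Isum \<subseteq> {..<n}"
    and regular: "sys_regular n blk blkU F"
    and gains: "\<forall>i<n. \<forall>j<n. classKinf (\<gamma> i j) \<or> zero_gain (\<gamma> i j)"
    and gains_diag: "\<forall>i<n. zero_gain (\<gamma> i i)"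
    and subISS: "\<forall>i<n. sub_ISS_Lyap n blk Isum F V \<gamma> gi \<alpha>i i"
    and irred: "gain_irreducible n \<gamma>"
    and alpha: "classKinf \<alpha>"
    and small_gain: "\<forall>s. (\<forall>i<n. 0 \<le> s i) \<and> (\<exists>i<n. s i \<noteq> 0) \<longrightarrow>
                       (\<exists>i<n. gain_op n Isum \<gamma> (Dalpha Isum \<alpha> s) i < s i)"
  shows "ISS F \<and>
    (\<forall>\<sigma>. Omega_path n (\<lambda>s. Dalpha Isum \<alpha> (gain_op n Isum \<gamma> s)) \<sigma> \<longrightarrow>
       ISS_Lyap F (\<lambda>x. Max ((\<lambda>i. Kinv (\<sigma> i) (V i (bproj blk i x))) ` {..<n})))"
proof -
  have F_cont: "continuous_on UNIV (case_prod F)" using regular by (simp add: sys_regular_def)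
  have lyap: "dini_Lyap F (\<lambda>x. Max ((\<lambda>i. Kinv (\<sigma> i) (V i (bproj blk i x))) ` {..<n}))"
    if \<sigma>: "decrease_path n (\<lambda>s. Dalpha Isum \<alpha> (gain_op n Isum \<gamma> s)) \<sigma>" for \<sigma>
  proof -
    interpret network n blk F Isum V \<gamma> gi \<alpha>i \<alpha> \<sigma>
      using n_pos blk_range F_cont gains subISS alpha \<sigma> by unfold_locales auto
    show ?thesis using maxV_dini_Lyap by (simp add: maxV_def[abs_def] scaledV_def subV_def)
  qed
  interpret mixed_gains n Isum \<gamma> \<alpha>
    using n_pos gains irred alpha small_gain by unfold_locales auto
  obtain k where k: "\<And>i. i < n \<Longrightarrow> blk (k i) = i" using blk_nonempty by metis
  have "inj_on k {..<n}" by (rule inj_onI) (metis k lessThan_iff)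
  then obtain \<sigma> where "decrease_path n (\<lambda>s. Dalpha Isum \<alpha> (gain_op n Isum \<gamma> s)) \<sigma>"
    by (rule exists_decrease_path)
  then have "ISS F"
    by (rule dini_Lyap_imp_ISS[OF F_cont sys_regular_imp_local_lipschitz[OF regular blk_range] lyap])
  then show ?thesis
    using lyap dini_Lyap_imp_ISS_Lyap Omega_path_imp_decrease_path by blast
qed

end
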